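(* Let $\mathbf{k}$ be a field of characteristic $p>0$, let $\mathrm{A}$ be a ($\mathbf{k}$-linear, small) category with an automorphism $\Sigma$ and let $s\in\mathbb{Z}$. Then $$\mathrm{Z}^*(\mathrm{A})=K_{0,s}(\mathrm{A}/\Sigma)\supseteq K_{1,s}(\mathrm{A}/\Sigma)\supseteq\dots\supseteq K_{r,s}(\mathrm{A}/\Sigma)\supseteq\dots\supseteq R_s(\mathrm{A}/\Sigma)$$ is a decreasing sequence of graded ideals of $\mathrm{Z}^*(\mathrm{A})$. In particular, $$\mathrm{Z}^*(\mathrm{A})=K_0(\mathrm{A}/\Sigma)\supseteq K_1(\mathrm{A}/\Sigma)\supseteq\dots\supseteq K_r(\mathrm{A}/\Sigma)\supseteq\dots\supseteq R(\mathrm{A}/\Sigma)$$ is a decreasing sequence of graded ideals. Moreover, if $\mathrm{A}'$ is another category with an automorphism $\Sigma'$ and there is an equivalence $F:\mathrm{A}\to\mathrm{A}'$ such that $F\Sigma\cong\Sigma'F$, then $F$ induces an isomorphism of graded algebras $\varphi_F:\mathrm{Z}^*(\mathrm{A})\to\mathrm{Z}^*(\mathrm{A}')$ such that $\varphi_F\big(K_r(\mathrm{A}/\Sigma)\big)=K_r(\mathrm{A}'/\Sigma')$ for all $r\ge 0$.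
   Context: All categories are small and $\mathbf{k}$-linear; $\mathrm{A}_x^y=\mathrm{Hom}_{\mathrm{A}}(x,y)$; $fg$ means $f$ after $g$. Graded center $\mathrm{Z}^*(\mathrm{A})=\mathrm{Z}^*(\mathrm{A},\Sigma)$: $\mathrm{Z}^n(\mathrm{A})$ ($n\in\mathbb{Z}$) is the group of natural transformations $\eta:\mathrm{Id}_{\mathrm{A}}\to\Sigma^n$ with $\eta_{\Sigma x}=(-1)^n\Sigma(\eta_x)$ for all $x$; the product of $\eta$ of degree $n$ and $\theta$ of degree $m$ is $(\eta\theta)_x=\Sigma^m(\eta_x)\theta_x$. Orbit category $\mathrm{A}/\Sigma$: the graded category with the objects of $\mathrm{A}$, with $((\mathrm{A}/\Sigma)_x^y)_n=\mathrm{A}_x^{\Sigma^ny}$ and composition $g\circ f=\Sigma^n(g)f$ for $f$ of degree $n$. For a graded category $\mathrm{B}$: the center $\mathrm{B}^{\mathrm{B}}=\oplus_i\mathrm{B}^{\mathrm{B}}_i$, where $\mathrm{B}^{\mathrm{B}}_i$ consists of families $(m_x)_x\in\prod_x(\mathrm{B}_x^x)_i$ with $fm_x=(-1)^{ij}m_yf$ for all $f\in(\mathrm{B}_x^y)_j$; $[\mathrm{B},\mathrm{B}]\subseteq\oplus_x\mathrm{B}_x^x$ is spanned by $fu-(-1)^{ij}uf$ for $u\in(\mathrm{B}_x^y)_i$, $f\in(\mathrm{B}_y^x)_j$; $\mathrm{B}_{\mathrm{B}}=\oplus_x\mathrm{B}_x^x/[\mathrm{B},\mathrm{B}]$, a graded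 $\mathrm{B}^{\mathrm{B}}$-bimodule. The map $\xi_p(\sum_nf_n)=\sum_nf_n^p$ ($f_n$ homogeneous of degree $n$) induces a well-defined map $\xi_p:\mathrm{B}_{\mathrm{B}}\to\mathrm{B}_{\mathrm{B}}$; $T_r\mathrm{B}=\ker\xi_p^r$; $(K_{r,s}\mathrm{B})_n=\{a\in\mathrm{B}^{\mathrm{B}}_n\mid a(T_r\mathrm{B})_{s-n}=(T_r\mathrm{B})_{s-n}a=0\}$, $K_{r,s}\mathrm{B}=\oplus_n(K_{r,s}\mathrm{B})_n$; $K_r\mathrm{B}=\cap_sK_{r,s}\mathrm{B}$; $R_s\mathrm{B}=\cap_{r\ge0}K_{r,s}\mathrm{B}$; $R\mathrm{B}=\cap_{r\ge0}K_r\mathrm{B}$. The algebras $\mathrm{Z}^*(\mathrm{A})$ and $(\mathrm{A}/\Sigma)^{\mathrm{A}/\Sigma}$ are identified via $\eta\leftrightarrow(\eta_x)_{x\in\mathrm{A}}$, so that the ideals above are regarded in $\mathrm{Z}^*(\mathrm{A})$. Induced map: given a natural isomorphism $\upsilon:\Sigma'F\to F\Sigma$ with induced natural isomorphisms $\upsilon^n:(\Sigma')^nF\to F\Sigma^n$ ($n\in\mathbb{Z}$), the map $\varphi_F$ is the one characterized by $\varphi_F(\eta)_{Fx}=(\upsilon^n_x)^{-1}F(\eta_x)$ for $\eta\in\mathrm{Z}^n(\mathrm{A})$, $x\in\mathrm{A}$. *)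

theory Defs
  imports "HOL-Algebra.Algebra"
begin

text \<open>The characteristic of a ring: \<open>n \<cdot> 1 = 0\<close> exactly for the multiples \<open>n\<close> of \<open>p\<close>.\<close>

definition has_characteristic :: "('k, 'r) ring_scheme \<Rightarrow> nat \<Rightarrow> bool" where
  "has_characteristic K p \<longleftrightarrow> (\<forall>n::nat. [n] \<cdot>\<^bsub>K\<^esub> \<one>\<^bsub>K\<^esub> = \<zero>\<^bsub>K\<^esub> \<longleftrightarrow> p dvd n)"

definition sgn_mult :: "('k, 'm) module \<Rightarrow> int \<Rightarrow> 'm \<Rightarrow> 'm" where
  \<comment> \<open>\<open>(-1)\<^sup>n v\<close>\<close>
  "sgn_mult M n v = (if even n then v else \<ominus>\<^bsub>M\<^esub> v)"


section \<open>Linear categories and functors\<close>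

text \<open>
  \<open>Hom A x y\<close> is the \<open>K\<close>-module \<open>A\<^sub>x\<^sup>y\<close> of morphisms from \<open>x\<close> to \<open>y\<close>; the ring
  multiplication and unit contained in the record type \<^typ>\<open>('k, 'm) module\<close> are never used.
  \<open>cat_comp A x y z g f\<close> is the composite \<open>g f\<close> of \<open>f : x \<rightarrow> y\<close> and \<open>g : y \<rightarrow> z\<close>. Morphism
  modules of different pairs of objects need not be disjoint, so composition (and, below, the
  action of a functor on morphisms) also takes the objects as arguments.
\<close>

record ('k, 'o, 'm) lin_cat =
  Obj :: "'o set"
  Hom :: "'o \<Rightarrow> 'o \<Rightarrow> ('k, 'm) module"
  cat_comp :: "'o \<Rightarrow> 'o \<Rightarrow> 'o \<Rightarrow> 'm \<Rightarrow> 'm \<Rightarrow> 'm"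
  ident :: "'o \<Rightarrow> 'm"

locale linear_category =
  fixes K :: "('k, 'r) ring_scheme" and A :: "('k, 'o, 'm) lin_cat"
  assumes Hom_module: "\<lbrakk>x \<in> Obj A; y \<in> Obj A\<rbrakk> \<Longrightarrow> module K (Hom A x y)"
    and comp_closed:
      "\<lbrakk>x \<in> Obj A; y \<in> Obj A; z \<in> Obj A; g \<in> carrier (Hom A y z); f \<in> carrier (Hom A x y)\<rbrakk>
        \<Longrightarrow> cat_comp A x y z g f \<in> carrier (Hom A x z)"
    and comp_add_left:
      "\<lbrakk>x \<in> Obj A; y \<in> Obj A; z \<in> Obj A; g \<in> carrier (Hom A y z); h \<in> carrier (Hom A y z);
        f \<in> carrier (Hom A x y)\<rbrakk>
        \<Longrightarrow> cat_comp A x y z (g \<oplus>\<^bsub>Hom A y z\<^esub> h) f = cat_comp A x y z g f \<oplus>\<^bsub>Hom A x z\<^esub> cat_comp A x y z h f"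
    and comp_add_right:
      "\<lbrakk>x \<in> Obj A; y \<in> Obj A; z \<in> Obj A; g \<in> carrier (Hom A y z); f \<in> carrier (Hom A x y);
        h \<in> carrier (Hom A x y)\<rbrakk>
        \<Longrightarrow> cat_comp A x y z g (f \<oplus>\<^bsub>Hom A x y\<^esub> h) = cat_comp A x y z g f \<oplus>\<^bsub>Hom A x z\<^esub> cat_comp A x y z g h"
    and comp_smult_left:
      "\<lbrakk>x \<in> Obj A; y \<in> Obj A; z \<in> Obj A; c \<in> carrier K; g \<in> carrier (Hom A y z);
        f \<in> carrier (Hom A x y)\<rbrakk>
        \<Longrightarrow> cat_comp A x y z (c \<odot>\<^bsub>Hom A y z\<^esub> g) f = c \<odot>\<^bsub>Hom A x z\<^esub> cat_comp A x y z g f"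
    and comp_smult_right:
      "\<lbrakk>x \<in> Obj A; y \<in> Obj A; z \<in> Obj A; c \<in> carrier K; g \<in> carrier (Hom A y z);
        f \<in> carrier (Hom A x y)\<rbrakk>
        \<Longrightarrow> cat_comp A x y z g (c \<odot>\<^bsub>Hom A x y\<^esub> f) = c \<odot>\<^bsub>Hom A x z\<^esub> cat_comp A x y z g f"
    and comp_assoc:
      "\<lbrakk>w \<in> Obj A; x \<in> Obj A; y \<in> Obj A; z \<in> Obj A; h \<in> carrier (Hom A y z);
        g \<in> carrier (Hom A x y); f \<in> carrier (Hom A w x)\<rbrakk>
        \<Longrightarrow> cat_comp A w x z (cat_comp A x y z h g) f = cat_comp A w y z h (cat_comp A w x y g f)"
    and ident_closed: "x \<in> Obj A \<Longrightarrow> ident A x \<in> carrier (Hom A x x)"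
    and comp_ident_left:
      "\<lbrakk>x \<in> Obj A; y \<in> Obj A; f \<in> carrier (Hom A x y)\<rbrakk> \<Longrightarrow> cat_comp A x y y (ident A y) f = f"
    and comp_ident_right:
      "\<lbrakk>x \<in> Obj A; y \<in> Obj A; f \<in> carrier (Hom A x y)\<rbrakk> \<Longrightarrow> cat_comp A x x y f (ident A x) = f"

definition inverse_morphism :: "('k, 'o, 'm) lin_cat \<Rightarrow> 'o \<Rightarrow> 'o \<Rightarrow> 'm \<Rightarrow> 'm \<Rightarrow> bool" where
  "inverse_morphism A x y f g \<longleftrightarrow> g \<in> carrier (Hom A y x) \<and>
     cat_comp A x y x g f = ident A x \<and> cat_comp A y x y f g = ident A y"

definition inv_mor :: "('k, 'o, 'm) lin_cat \<Rightarrow> 'o \<Rightarrow> 'o \<Rightarrow> 'm \<Rightarrow> 'm" where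
  "inv_mor A x y f = (THE g. inverse_morphism A x y f g)"

record ('o, 'm, 'o2, 'm2) fnctr =
  fobj :: "'o \<Rightarrow> 'o2"
  fmor :: "'o \<Rightarrow> 'o \<Rightarrow> 'm \<Rightarrow> 'm2"

locale linear_functor =
  fixes K :: "('k, 'r) ring_scheme" and A :: "('k, 'o, 'm) lin_cat"
    and A' :: "('k, 'o2, 'm2) lin_cat" and F :: "('o, 'm, 'o2, 'm2) fnctr"
  assumes fobj_closed: "x \<in> Obj A \<Longrightarrow> fobj F x \<in> Obj A'"
    and fmor_closed:
      "\<lbrakk>x \<in> Obj A; y \<in> Obj A; f \<in> carrier (Hom A x y)\<rbrakk>
        \<Longrightarrow> fmor F x y f \<in> carrier (Hom A' (fobj F x) (fobj F y))"
    and fmor_add: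
      "\<lbrakk>x \<in> Obj A; y \<in> Obj A; f \<in> carrier (Hom A x y); g \<in> carrier (Hom A x y)\<rbrakk>
        \<Longrightarrow> fmor F x y (f \<oplus>\<^bsub>Hom A x y\<^esub> g)
          = fmor F x y f \<oplus>\<^bsub>Hom A' (fobj F x) (fobj F y)\<^esub> fmor F x y g"
    and fmor_smult:
      "\<lbrakk>x \<in> Obj A; y \<in> Obj A; c \<in> carrier K; f \<in> carrier (Hom A x y)\<rbrakk>
        \<Longrightarrow> fmor F x y (c \<odot>\<^bsub>Hom A x y\<^esub> f) = c \<odot>\<^bsub>Hom A' (fobj F x) (fobj F y)\<^esub> fmor F x y f"
    and fmor_comp:
      "\<lbrakk>x \<in> Obj A; y \<in> Obj A; z \<in> Obj A; g \<in> carrier (Hom A y z); f \<in> carrier (Hom A x y)\<rbrakk>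
        \<Longrightarrow> fmor F x z (cat_comp A x y z g f)
          = cat_comp A' (fobj F x) (fobj F y) (fobj F z) (fmor F y z g) (fmor F x y f)"
    and fmor_ident: "x \<in> Obj A \<Longrightarrow> fmor F x x (ident A x) = ident A' (fobj F x)"

definition functor_id :: "('o, 'm, 'o, 'm) fnctr" where
  "functor_id = \<lparr>fobj = (\<lambda>x. x), fmor = (\<lambda>x y f. f)\<rparr>"

definition functor_comp ::
  "('o2, 'm2, 'o3, 'm3) fnctr \<Rightarrow> ('o, 'm, 'o2, 'm2) fnctr \<Rightarrow> ('o, 'm, 'o3, 'm3) fnctr" where
  "functor_comp G F = \<lparr>fobj = (\<lambda>x. fobj G (fobj F x)),
     fmor = (\<lambda>x y f. fmor G (fobj F x) (fobj F y) (fmor F x y f))\<rparr>"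

definition functor_eq ::
  "('k, 'o, 'm) lin_cat \<Rightarrow> ('o, 'm, 'o2, 'm2) fnctr \<Rightarrow> ('o, 'm, 'o2, 'm2) fnctr \<Rightarrow> bool" where
  \<comment> \<open>equality of functors with domain \<open>A\<close>, disregarding values outside \<open>A\<close>\<close>
  "functor_eq A F G \<longleftrightarrow> (\<forall>x\<in>Obj A. fobj F x = fobj G x) \<and>
     (\<forall>x\<in>Obj A. \<forall>y\<in>Obj A. \<forall>f\<in>carrier (Hom A x y). fmor F x y f = fmor G x y f)"

definition nat_trans ::
  "('k, 'o, 'm) lin_cat \<Rightarrow> ('k, 'o2, 'm2) lin_cat \<Rightarrow> ('o, 'm, 'o2, 'm2) fnctr \<Rightarrow>
     ('o, 'm, 'o2, 'm2) fnctr \<Rightarrow> ('o \<Rightarrow> 'm2) \<Rightarrow> bool" where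
  "nat_trans A A' F G \<eta> \<longleftrightarrow>
     (\<forall>x\<in>Obj A. \<eta> x \<in> carrier (Hom A' (fobj F x) (fobj G x))) \<and>
     (\<forall>x\<in>Obj A. \<forall>y\<in>Obj A. \<forall>f\<in>carrier (Hom A x y).
        cat_comp A' (fobj F x) (fobj F y) (fobj G y) (\<eta> y) (fmor F x y f)
      = cat_comp A' (fobj F x) (fobj G x) (fobj G y) (fmor G x y f) (\<eta> x))"

definition nat_iso ::
  "('k, 'o, 'm) lin_cat \<Rightarrow> ('k, 'o2, 'm2) lin_cat \<Rightarrow> ('o, 'm, 'o2, 'm2) fnctr \<Rightarrow>
     ('o, 'm, 'o2, 'm2) fnctr \<Rightarrow> ('o \<Rightarrow> 'm2) \<Rightarrow> bool" where
  "nat_iso A A' F G \<eta> \<longleftrightarrow> nat_trans A A' F G \<eta> \<and>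
     (\<forall>x\<in>Obj A. \<exists>g. inverse_morphism A' (fobj F x) (fobj G x) (\<eta> x) g)"

definition automorphism ::
  "('k, 'r) ring_scheme \<Rightarrow> ('k, 'o, 'm) lin_cat \<Rightarrow> ('o, 'm, 'o, 'm) fnctr \<Rightarrow> bool" where
  "automorphism K A S \<longleftrightarrow> linear_functor K A A S \<and>
     (\<exists>G. linear_functor K A A G \<and>
       functor_eq A (functor_comp G S) functor_id \<and> functor_eq A (functor_comp S G) functor_id)"

definition lin_equivalence ::
  "('k, 'r) ring_scheme \<Rightarrow> ('k, 'o, 'm) lin_cat \<Rightarrow> ('k, 'o2, 'm2) lin_cat \<Rightarrow>
     ('o, 'm, 'o2, 'm2) fnctr \<Rightarrow> bool" where
  "lin_equivalence K A A' F \<longleftrightarrow> linear_functor K A A' F \<and>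
     (\<exists>G. linear_functor K A' A G \<and>
       (\<exists>\<alpha>. nat_iso A A (functor_comp G F) functor_id \<alpha>) \<and>
       (\<exists>\<beta>. nat_iso A' A' (functor_comp F G) functor_id \<beta>))"

definition functor_inv ::
  "('k, 'o, 'm) lin_cat \<Rightarrow> ('o, 'm, 'o, 'm) fnctr \<Rightarrow> ('o, 'm, 'o, 'm) fnctr" where
  "functor_inv A S =
     (let T = inv_into (Obj A) (fobj S) in
      \<lparr>fobj = T, fmor = (\<lambda>x y. inv_into (carrier (Hom A (T x) (T y))) (fmor S (T x) (T y)))\<rparr>)"

primrec functor_npow :: "('o, 'm, 'o, 'm) fnctr \<Rightarrow> nat \<Rightarrow> ('o, 'm, 'o, 'm) fnctr" where
  "functor_npow S 0 = functor_id"
| "functor_npow S (Suc n) = functor_comp S (functor_npow S n)"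

definition functor_pow ::
  "('k, 'o, 'm) lin_cat \<Rightarrow> ('o, 'm, 'o, 'm) fnctr \<Rightarrow> int \<Rightarrow> ('o, 'm, 'o, 'm) fnctr" where
  "functor_pow A S n = (if 0 \<le> n then functor_npow S (nat n)
                        else functor_npow (functor_inv A S) (nat (- n)))"


section \<open>The graded center\<close>

text \<open>
  \<open>Z\<^sup>n(A)\<close> consists of families indexed by the objects, extended by \<^const>\<open>undefined\<close>
  outside \<open>Obj A\<close>. An element of \<open>Z\<^sup>*(A) = \<Oplus>\<^sub>n Z\<^sup>n(A)\<close> is a finitely supported function
  \<open>a\<close> with \<open>a n \<in> Z\<^sup>n(A)\<close>.
\<close>

definition center_deg ::
  "('k, 'o, 'm) lin_cat \<Rightarrow> ('o, 'm, 'o, 'm) fnctr \<Rightarrow> int \<Rightarrow> ('o \<Rightarrow> 'm) set" where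
  "center_deg A S n = {\<eta> \<in> extensional (Obj A).
     nat_trans A A functor_id (functor_pow A S n) \<eta> \<and>
     (\<forall>x\<in>Obj A. \<eta> (fobj S x) =
        sgn_mult (Hom A (fobj S x) (fobj (functor_pow A S n) (fobj S x))) n
          (fmor S x (fobj (functor_pow A S n) x) (\<eta> x)))}"

definition center_zero ::
  "('k, 'o, 'm) lin_cat \<Rightarrow> ('o, 'm, 'o, 'm) fnctr \<Rightarrow> int \<Rightarrow> 'o \<Rightarrow> 'm" where
  "center_zero A S n = (\<lambda>x\<in>Obj A. \<zero>\<^bsub>Hom A x (fobj (functor_pow A S n) x)\<^esub>)"

definition graded_center ::
  "('k, 'o, 'm) lin_cat \<Rightarrow> ('o, 'm, 'o, 'm) fnctr \<Rightarrow> ('k, int \<Rightarrow> 'o \<Rightarrow> 'm) module" where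
  "graded_center A S =
     (let P = (\<lambda>n. fobj (functor_pow A S n)) in
     \<lparr>carrier = {a. (\<forall>n. a n \<in> center_deg A S n) \<and> finite {n. a n \<noteq> center_zero A S n}},
      monoid.mult = (\<lambda>a b n. \<lambda>x\<in>Obj A.
        finsum (Hom A x (P n x))
          (\<lambda>i. cat_comp A x (P (n - i) x) (P n x)
                 (fmor (functor_pow A S (n - i)) x (P i x) (a i x)) (b (n - i) x))
          {i. a i \<noteq> center_zero A S i}),
      one = (\<lambda>n. if n = 0 then (\<lambda>x\<in>Obj A. ident A x) else center_zero A S n),
      ring.zero = center_zero A S,
      ring.add = (\<lambda>a b n. \<lambda>x\<in>Obj A. a n x \<oplus>\<^bsub>Hom A x (P n x)\<^esub> b n x),
      module.smult = (\<lambda>c a n. \<lambda>x\<in>Obj A. c \<odot>\<^bsub>Hom A x (P n x)\<^esub> a n x)\<rparr>)"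

text \<open>Notions for a graded algebra \<open>R\<close> whose elements are families indexed by the degree.\<close>

definition homogeneous :: "('k, int \<Rightarrow> 'a) module \<Rightarrow> int \<Rightarrow> (int \<Rightarrow> 'a) set" where
  "homogeneous R n = {a \<in> carrier R. \<forall>m. m \<noteq> n \<longrightarrow> a m = \<zero>\<^bsub>R\<^esub> m}"

definition graded_ideal :: "(int \<Rightarrow> 'a) set \<Rightarrow> ('k, int \<Rightarrow> 'a) module \<Rightarrow> bool" where
  \<comment> \<open>a two-sided ideal containing the homogeneous components of its elements\<close>
  "graded_ideal I R \<longleftrightarrow> ideal I R \<and> (\<forall>a\<in>I. \<forall>n. \<zero>\<^bsub>R\<^esub>(n := a n) \<in> I)"

definition graded_algebra_iso ::
  "('k, 'r) ring_scheme \<Rightarrow> ('k, int \<Rightarrow> 'a) module \<Rightarrow> ('k, int \<Rightarrow> 'b) module \<Rightarrow>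
     ((int \<Rightarrow> 'a) \<Rightarrow> (int \<Rightarrow> 'b)) \<Rightarrow> bool" where
  "graded_algebra_iso K R R' \<phi> \<longleftrightarrow> \<phi> \<in> ring_iso R R' \<and>
     (\<forall>c\<in>carrier K. \<forall>a\<in>carrier R. \<phi> (c \<odot>\<^bsub>R\<^esub> a) = c \<odot>\<^bsub>R'\<^esub> \<phi> a) \<and>
     (\<forall>n. \<phi> ` homogeneous R n = homogeneous R' n)"


section \<open>Graded categories and the orbit category\<close>

text \<open>
  Data of a graded category: \<open>GHom B x y n\<close> is the degree \<open>n\<close> part \<open>(B\<^sub>x\<^sup>y)\<^sub>n\<close>, and
  \<open>gcomp B x y z m n g f\<close> is the composite \<open>g f\<close> of \<open>f \<in> (B\<^sub>x\<^sup>y)\<^sub>n\<close> and \<open>g \<in> (B\<^sub>y\<^sup>z)\<^sub>m\<close>.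
\<close>

record ('k, 'o, 'm) gr_cat =
  GObj :: "'o set"
  GHom :: "'o \<Rightarrow> 'o \<Rightarrow> int \<Rightarrow> ('k, 'm) module"
  gcomp :: "'o \<Rightarrow> 'o \<Rightarrow> 'o \<Rightarrow> int \<Rightarrow> int \<Rightarrow> 'm \<Rightarrow> 'm \<Rightarrow> 'm"
  gident :: "'o \<Rightarrow> 'm"

definition orbit_cat :: "('k, 'o, 'm) lin_cat \<Rightarrow> ('o, 'm, 'o, 'm) fnctr \<Rightarrow> ('k, 'o, 'm) gr_cat" where
  "orbit_cat A S =
     (let P = functor_pow A S in
     \<lparr>GObj = Obj A,
      GHom = (\<lambda>x y n. Hom A x (fobj (P n) y)),
      gcomp = (\<lambda>x y z m n g f.
        cat_comp A x (fobj (P n) y) (fobj (P (m + n)) z) (fmor (P n) y (fobj (P m) z) g) f),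
      gident = ident A\<rparr>)"

text \<open>The degree \<open>n\<close> part of the center \<open>B\<^sup>B\<close>, and \<open>B\<^sup>B = \<Oplus>\<^sub>n (B\<^sup>B)\<^sub>n\<close>, encoded as for
  \<open>Z\<^sup>*(A)\<close>; for \<open>B = A/\<Sigma>\<close> the identification of \<open>\<eta>\<close> with \<open>(\<eta>\<^sub>x)\<^sub>x\<close> is thus the identity.\<close>

definition gcenter_deg :: "('k, 'o, 'm) gr_cat \<Rightarrow> int \<Rightarrow> ('o \<Rightarrow> 'm) set" where
  "gcenter_deg B i = {m \<in> (\<Pi>\<^sub>E x\<in>GObj B. carrier (GHom B x x i)).
     \<forall>x\<in>GObj B. \<forall>y\<in>GObj B. \<forall>j. \<forall>f\<in>carrier (GHom B x y j).
       gcomp B x x y j i f (m x) = sgn_mult (GHom B x y (i + j)) (i * j) (gcomp B x y y i j (m y) f)}"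

definition gcenter :: "('k, 'o, 'm) gr_cat \<Rightarrow> (int \<Rightarrow> 'o \<Rightarrow> 'm) set" where
  "gcenter B = {a. (\<forall>n. a n \<in> gcenter_deg B n) \<and>
     finite {n. a n \<noteq> (\<lambda>x\<in>GObj B. \<zero>\<^bsub>GHom B x x n\<^esub>)}}"

text \<open>
  The \<open>K\<close>-module \<open>\<Oplus>\<^sub>x B\<^sub>x\<^sup>x = \<Oplus>\<^sub>x \<Oplus>\<^sub>n (B\<^sub>x\<^sup>x)\<^sub>n\<close>: \<open>f x n\<close> is the component of \<open>f\<close> in
  \<open>(B\<^sub>x\<^sup>x)\<^sub>n\<close>. The fields \<open>mult\<close> and \<open>one\<close> of the record are irrelevant.
\<close>

definition diag :: "('k, 'o, 'm) gr_cat \<Rightarrow> ('k, 'o \<Rightarrow> int \<Rightarrow> 'm) module" where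
  "diag B = \<lparr>carrier = {f \<in> (\<Pi>\<^sub>E x\<in>GObj B. \<Pi> n\<in>UNIV. carrier (GHom B x x n)).
                 finite {(x, n). x \<in> GObj B \<and> f x n \<noteq> \<zero>\<^bsub>GHom B x x n\<^esub>}},
     monoid.mult = undefined, one = undefined,
     ring.zero = (\<lambda>x\<in>GObj B. \<lambda>n. \<zero>\<^bsub>GHom B x x n\<^esub>),
     ring.add = (\<lambda>f g. \<lambda>x\<in>GObj B. \<lambda>n. f x n \<oplus>\<^bsub>GHom B x x n\<^esub> g x n),
     module.smult = (\<lambda>c f. \<lambda>x\<in>GObj B. \<lambda>n. c \<odot>\<^bsub>GHom B x x n\<^esub> f x n)\<rparr>"

definition diag_homogeneous :: "('k, 'o, 'm) gr_cat \<Rightarrow> int \<Rightarrow> ('o \<Rightarrow> int \<Rightarrow> 'm) set" where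
  "diag_homogeneous B n =
     {f \<in> carrier (diag B). \<forall>x\<in>GObj B. \<forall>m. m \<noteq> n \<longrightarrow> f x m = \<zero>\<^bsub>GHom B x x m\<^esub>}"

definition diag_single :: "('k, 'o, 'm) gr_cat \<Rightarrow> 'o \<Rightarrow> int \<Rightarrow> 'm \<Rightarrow> 'o \<Rightarrow> int \<Rightarrow> 'm" where
  "diag_single B x n v = (\<lambda>y\<in>GObj B. \<lambda>m. if y = x \<and> m = n then v else \<zero>\<^bsub>GHom B y y m\<^esub>)"

text \<open>The subspace \<open>[B,B]\<close> spanned by \<open>f u - (-1)\<^sup>i\<^sup>j u f\<close> for \<open>u \<in> (B\<^sub>x\<^sup>y)\<^sub>i\<close> and
  \<open>f \<in> (B\<^sub>y\<^sup>x)\<^sub>j\<close>.\<close>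

definition commutators :: "('k, 'r) ring_scheme \<Rightarrow> ('k, 'o, 'm) gr_cat \<Rightarrow> ('o \<Rightarrow> int \<Rightarrow> 'm) set" where
  "commutators K B = \<Inter>{N. submodule N K (diag B) \<and>
     (\<forall>x\<in>GObj B. \<forall>y\<in>GObj B. \<forall>i j. \<forall>u\<in>carrier (GHom B x y i). \<forall>f\<in>carrier (GHom B y x j).
        diag_single B x (i + j) (gcomp B x y x j i f u) \<ominus>\<^bsub>diag B\<^esub>
        diag_single B y (i + j) (sgn_mult (GHom B y y (i + j)) (i * j) (gcomp B y x y i j u f)) \<in> N)}"

text \<open>
  The quotient \<open>B\<^sub>B\<close> is the set of cosets of \<open>[B,B]\<close>. Given a map \<open>h\<close> on \<open>\<Oplus>\<^sub>x B\<^sub>x\<^sup>x\<close> that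
  respects cosets, \<open>cocenter_map K B h\<close> is the induced map: all the cosets in the union
  are then equal to the coset of \<open>h f\<close>, for any representative \<open>f\<close>.
\<close>

definition cocenter :: "('k, 'r) ring_scheme \<Rightarrow> ('k, 'o, 'm) gr_cat \<Rightarrow> ('o \<Rightarrow> int \<Rightarrow> 'm) set set" where
  "cocenter K B = a_rcosets\<^bsub>diag B\<^esub> (commutators K B)"

definition cocenter_deg ::
  "('k, 'r) ring_scheme \<Rightarrow> ('k, 'o, 'm) gr_cat \<Rightarrow> int \<Rightarrow> ('o \<Rightarrow> int \<Rightarrow> 'm) set set" where
  "cocenter_deg K B n = (\<lambda>f. commutators K B +>\<^bsub>diag B\<^esub> f) ` diag_homogeneous B n"

definition cocenter_zero :: "('k, 'r) ring_scheme \<Rightarrow> ('k, 'o, 'm) gr_cat \<Rightarrow> ('o \<Rightarrow> int \<Rightarrow> 'm) set" where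
  "cocenter_zero K B = commutators K B +>\<^bsub>diag B\<^esub> \<zero>\<^bsub>diag B\<^esub>"

definition cocenter_map ::
  "('k, 'r) ring_scheme \<Rightarrow> ('k, 'o, 'm) gr_cat \<Rightarrow> (('o \<Rightarrow> int \<Rightarrow> 'm) \<Rightarrow> ('o \<Rightarrow> int \<Rightarrow> 'm)) \<Rightarrow>
     ('o \<Rightarrow> int \<Rightarrow> 'm) set \<Rightarrow> ('o \<Rightarrow> int \<Rightarrow> 'm) set" where
  "cocenter_map K B h C = (\<Union>f\<in>C. commutators K B +>\<^bsub>diag B\<^esub> h f)"

text \<open>The left and right actions of a homogeneous \<open>a \<in> (B\<^sup>B)\<^sub>n\<close> on \<open>\<Oplus>\<^sub>x B\<^sub>x\<^sup>x\<close>.\<close>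

definition diag_lact ::
  "('k, 'o, 'm) gr_cat \<Rightarrow> int \<Rightarrow> ('o \<Rightarrow> 'm) \<Rightarrow> ('o \<Rightarrow> int \<Rightarrow> 'm) \<Rightarrow> ('o \<Rightarrow> int \<Rightarrow> 'm)" where
  "diag_lact B n a f = (\<lambda>x\<in>GObj B. \<lambda>m. gcomp B x x x n (m - n) (a x) (f x (m - n)))"

definition diag_ract ::
  "('k, 'o, 'm) gr_cat \<Rightarrow> int \<Rightarrow> ('o \<Rightarrow> 'm) \<Rightarrow> ('o \<Rightarrow> int \<Rightarrow> 'm) \<Rightarrow> ('o \<Rightarrow> int \<Rightarrow> 'm)" where
  "diag_ract B n a f = (\<lambda>x\<in>GObj B. \<lambda>m. gcomp B x x x (m - n) n (f x (m - n)) (a x))"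

primrec gpow :: "('k, 'o, 'm) gr_cat \<Rightarrow> 'o \<Rightarrow> int \<Rightarrow> 'm \<Rightarrow> nat \<Rightarrow> 'm" where
  \<comment> \<open>the \<open>k\<close>-th power, of degree \<open>k n\<close>, of an endomorphism \<open>f\<close> of \<open>x\<close> of degree \<open>n\<close>\<close>
  "gpow B x n f 0 = gident B x"
| "gpow B x n f (Suc k) = gcomp B x x x n (int k * n) f (gpow B x n f k)"

text \<open>\<open>\<xi>\<^sub>p(\<Sum>\<^sub>n f\<^sub>n) = \<Sum>\<^sub>n f\<^sub>n\<^sup>p\<close>: as \<open>f\<^sub>n\<^sup>p\<close> has degree \<open>p n\<close>, the component of the sum in
  degree \<open>m\<close> is \<open>f\<^sub>n\<^sup>p\<close> if \<open>m = p n\<close>, and zero if \<open>p\<close> does not divide \<open>m\<close>.\<close>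

definition diag_xi :: "('k, 'o, 'm) gr_cat \<Rightarrow> nat \<Rightarrow> ('o \<Rightarrow> int \<Rightarrow> 'm) \<Rightarrow> ('o \<Rightarrow> int \<Rightarrow> 'm)" where
  "diag_xi B p f = (\<lambda>x\<in>GObj B. \<lambda>m.
     if int p dvd m then gpow B x (m div int p) (f x (m div int p)) p else \<zero>\<^bsub>GHom B x x m\<^esub>)"

definition xi :: "('k, 'r) ring_scheme \<Rightarrow> ('k, 'o, 'm) gr_cat \<Rightarrow> nat \<Rightarrow>
    ('o \<Rightarrow> int \<Rightarrow> 'm) set \<Rightarrow> ('o \<Rightarrow> int \<Rightarrow> 'm) set" where
  "xi K B p = cocenter_map K B (diag_xi B p)"

definition T_ker :: "('k, 'r) ring_scheme \<Rightarrow> ('k, 'o, 'm) gr_cat \<Rightarrow> nat \<Rightarrow> nat \<Rightarrow>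
    ('o \<Rightarrow> int \<Rightarrow> 'm) set set" where
  "T_ker K B p r = {C \<in> cocenter K B. (xi K B p ^^ r) C = cocenter_zero K B}"

definition K_deg :: "('k, 'r) ring_scheme \<Rightarrow> ('k, 'o, 'm) gr_cat \<Rightarrow> nat \<Rightarrow> nat \<Rightarrow> int \<Rightarrow> int \<Rightarrow>
    ('o \<Rightarrow> 'm) set" where
  \<comment> \<open>the degree \<open>n\<close> part \<open>(K\<^sub>r\<^sub>,\<^sub>s B)\<^sub>n\<close>\<close>
  "K_deg K B p r s n = {a \<in> gcenter_deg B n. \<forall>C \<in> T_ker K B p r \<inter> cocenter_deg K B (s - n).
     cocenter_map K B (diag_lact B n a) C = cocenter_zero K B \<and>
     cocenter_map K B (diag_ract B n a) C = cocenter_zero K B}"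

definition K_rs :: "('k, 'r) ring_scheme \<Rightarrow> ('k, 'o, 'm) gr_cat \<Rightarrow> nat \<Rightarrow> nat \<Rightarrow> int \<Rightarrow>
    (int \<Rightarrow> 'o \<Rightarrow> 'm) set" where
  "K_rs K B p r s = {a \<in> gcenter B. \<forall>n. a n \<in> K_deg K B p r s n}"

definition K_r :: "('k, 'r) ring_scheme \<Rightarrow> ('k, 'o, 'm) gr_cat \<Rightarrow> nat \<Rightarrow> nat \<Rightarrow>
    (int \<Rightarrow> 'o \<Rightarrow> 'm) set" where
  "K_r K B p r = (\<Inter>s. K_rs K B p r s)"

definition R_s :: "('k, 'r) ring_scheme \<Rightarrow> ('k, 'o, 'm) gr_cat \<Rightarrow> nat \<Rightarrow> int \<Rightarrow>
    (int \<Rightarrow> 'o \<Rightarrow> 'm) set" where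
  "R_s K B p s = (\<Inter>r. K_rs K B p r s)"

definition R_all :: "('k, 'r) ring_scheme \<Rightarrow> ('k, 'o, 'm) gr_cat \<Rightarrow> nat \<Rightarrow>
    (int \<Rightarrow> 'o \<Rightarrow> 'm) set" where
  "R_all K B p = (\<Inter>r. K_r K B p r)"


section \<open>The map of graded centers induced by an equivalence\<close>

text \<open>
  From \<open>\<upsilon> : S' F \<rightarrow> F S\<close> one gets \<open>\<upsilon>\<^sup>n : S'\<^sup>n F \<rightarrow> F S\<^sup>n\<close> by
  \<open>\<upsilon>\<^sup>n\<^sup>+\<^sup>1\<^sub>x = \<upsilon>\<^bsub>S\<^sup>n x\<^esub> S'(\<upsilon>\<^sup>n\<^sub>x)\<close>; for negative exponents the same is done with the inverses of \<open>S\<close>, \<open>S'\<close>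
  and \<open>\<upsilon>\<^sup>-\<^sup>1\<^sub>x = S'\<^sup>-\<^sup>1((\<upsilon>\<^bsub>S\<^sup>-\<^sup>1 x\<^esub>)\<^sup>-\<^sup>1) : S'\<^sup>-\<^sup>1 F x \<rightarrow> F S\<^sup>-\<^sup>1 x\<close>.
\<close>

primrec iso_npow ::
  "('k, 'o2, 'm2) lin_cat \<Rightarrow> ('o, 'm, 'o, 'm) fnctr \<Rightarrow> ('o2, 'm2, 'o2, 'm2) fnctr \<Rightarrow>
     ('o, 'm, 'o2, 'm2) fnctr \<Rightarrow> ('o \<Rightarrow> 'm2) \<Rightarrow> nat \<Rightarrow> 'o \<Rightarrow> 'm2" where
  "iso_npow A' S S' F \<upsilon> 0 x = ident A' (fobj F x)"
| "iso_npow A' S S' F \<upsilon> (Suc n) x =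
     (let y = fobj (functor_npow S n) x; z = fobj (functor_npow S' n) (fobj F x) in
      cat_comp A' (fobj S' z) (fobj S' (fobj F y)) (fobj F (fobj S y))
        (\<upsilon> y) (fmor S' z (fobj F y) (iso_npow A' S S' F \<upsilon> n x)))"

definition iso_inv ::
  "('k, 'o, 'm) lin_cat \<Rightarrow> ('k, 'o2, 'm2) lin_cat \<Rightarrow> ('o, 'm, 'o, 'm) fnctr \<Rightarrow>
     ('o2, 'm2, 'o2, 'm2) fnctr \<Rightarrow> ('o, 'm, 'o2, 'm2) fnctr \<Rightarrow> ('o \<Rightarrow> 'm2) \<Rightarrow> 'o \<Rightarrow> 'm2" where
  "iso_inv A A' S S' F \<upsilon> x =
     (let y = fobj (functor_inv A S) x in
      fmor (functor_inv A' S') (fobj F x) (fobj S' (fobj F y))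
        (inv_mor A' (fobj S' (fobj F y)) (fobj F x) (\<upsilon> y)))"

definition iso_pow ::
  "('k, 'o, 'm) lin_cat \<Rightarrow> ('k, 'o2, 'm2) lin_cat \<Rightarrow> ('o, 'm, 'o, 'm) fnctr \<Rightarrow>
     ('o2, 'm2, 'o2, 'm2) fnctr \<Rightarrow> ('o, 'm, 'o2, 'm2) fnctr \<Rightarrow> ('o \<Rightarrow> 'm2) \<Rightarrow> int \<Rightarrow> 'o \<Rightarrow> 'm2" where
  "iso_pow A A' S S' F \<upsilon> n =
     (if 0 \<le> n then iso_npow A' S S' F \<upsilon> (nat n)
      else iso_npow A' (functor_inv A S) (functor_inv A' S') F (iso_inv A A' S S' F \<upsilon>) (nat (- n)))"

definition corresponds ::
  "('k, 'o, 'm) lin_cat \<Rightarrow> ('k, 'o2, 'm2) lin_cat \<Rightarrow> ('o, 'm, 'o, 'm) fnctr \<Rightarrow>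
     ('o2, 'm2, 'o2, 'm2) fnctr \<Rightarrow> ('o, 'm, 'o2, 'm2) fnctr \<Rightarrow> ('o \<Rightarrow> 'm2) \<Rightarrow> int \<Rightarrow>
     ('o \<Rightarrow> 'm) \<Rightarrow> ('o2 \<Rightarrow> 'm2) \<Rightarrow> bool" where
  \<comment> \<open>\<open>\<theta>\<^bsub>F x\<^esub> = (\<upsilon>\<^sup>n\<^sub>x)\<^sup>-\<^sup>1 F(\<eta>\<^sub>x)\<close> for all \<open>x\<close>, where \<open>\<eta> \<in> Z\<^sup>n(A)\<close> and \<open>\<theta> \<in> Z\<^sup>n(A')\<close>\<close>
  "corresponds A A' S S' F \<upsilon> n \<eta> \<theta> \<longleftrightarrow>
     (\<forall>x\<in>Obj A.
        let v = fobj (functor_pow A' S' n) (fobj F x); w = fobj F (fobj (functor_pow A S n) x) in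
        \<theta> (fobj F x) = cat_comp A' (fobj F x) w v
          (inv_mor A' v w (iso_pow A A' S S' F \<upsilon> n x))
          (fmor F x (fobj (functor_pow A S n) x) (\<eta> x)))"

definition induced_map ::
  "('k, 'o, 'm) lin_cat \<Rightarrow> ('k, 'o2, 'm2) lin_cat \<Rightarrow> ('o, 'm, 'o, 'm) fnctr \<Rightarrow>
     ('o2, 'm2, 'o2, 'm2) fnctr \<Rightarrow> ('o, 'm, 'o2, 'm2) fnctr \<Rightarrow> ('o \<Rightarrow> 'm2) \<Rightarrow>
     (int \<Rightarrow> 'o \<Rightarrow> 'm) \<Rightarrow> int \<Rightarrow> 'o2 \<Rightarrow> 'm2" where
  "induced_map A A' S S' F \<upsilon> a =
     (\<lambda>n. THE \<theta>. \<theta> \<in> center_deg A' S' n \<and> corresponds A A' S S' F \<upsilon> n (a n) \<theta>)"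

end

theory Submission
  imports Defs
begin

text \<open>
  The family \<open>(\<eta>\<^sub>x)\<close> of a graded natural transformation is central in the orbit category \<open>B = A/\<Sigma>\<close>: iterating
  \<open>\<eta>\<^bsub>\<Sigma>x\<^esub> = (-1)\<^sup>n \<Sigma>(\<eta>\<^sub>x)\<close> along the powers of \<open>\<Sigma>\<close> yields exactly the signs of the center of \<open>B\<close>. The
  map \<open>\<xi>\<^sub>p\<close> is additive modulo \<open>[B,B]\<close> because the non-constant words in the expansion of
  \<open>(a + b)\<^sup>p\<close> form rotation orbits of size \<open>p\<close>, and \<open>\<xi>\<^sub>p(z f) = \<plusminus> z\<^sup>p \<xi>\<^sub>p(f)\<close> for central \<open>z\<close>. Hence the center
  preserves \<open>T\<^sub>r\<close>, and its annihilators are graded ideals; left and right action differ by a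
  sign only. An equivalence commuting with the shifts induces a full, faithful and dense graded
  functor \<open>f \<mapsto> (\<upsilon>\<^sup>n)\<^sup>-\<^sup>1 F(f)\<close> of orbit categories. Its push-forward to the cocenters has an
  inverse coming from a quasi-inverse functor, commutes with \<open>\<xi>\<^sub>p\<close>, and is linear over the
  isomorphism of centers.
\<close>

section \<open>Linear maps\<close>

text \<open>Signs are the recurring obstacle. Rotating a word of p letters of degree n, or turning
  (f u)^p into (u f)^p, costs a sign whose exponent differs from the wanted one by a multiple of p -
  1: for odd p this is even, and for p = 2 signs are invisible since -1 = 1. The sign in xi_p(z f),
  in contrast, stays; it is the same for all f of one degree, so it can be absorbed into z^p without
  leaving the center. Cosets are mostly avoided: computations take place on representatives in the
  direct sum, with a congruence modulo [B,B]. Composition is typed by integer degrees, so many rules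
  keep the total degree as a separate variable tied by an equation. The integer powers of Sigma and
  upsilon are given by separate recursions for n >= 0 and n < 0. Each is first brought to one form
  valid over all integers; further identities then follow by proving the cases m and m + 1
  equivalent, where going down cancels Sigma, and upsilon where it occurs. The cocycle identity for
  upsilon^n obtained in this way makes the functor of orbit categories respect composition.\<close>

lemma (in abelian_monoid) finsum_mem:
  assumes "H \<subseteq> carrier G" "\<zero> \<in> H" "\<And>x y. \<lbrakk>x \<in> H; y \<in> H\<rbrakk> \<Longrightarrow> x \<oplus> y \<in> H" "\<And>i. i \<in> I \<Longrightarrow> f i \<in> H"
  shows "finsum G f I \<in> H"
  using assms(4)
proof (induction I rule: infinite_finite_induct)
  case (insert i I)
  then have "f \<in> I \<rightarrow> carrier G" "f i \<in> carrier G" using assms(1) by auto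
  with insert show ?case by (simp add: assms(3))
qed (simp_all add: assms(2))

text \<open>Serves the exchange of summations in the associativity of the convolution product on the
  center.\<close>

lemma (in abelian_monoid) finsum_swap:
  assumes "finite I" "finite J" "\<And>i j. \<lbrakk>i \<in> I; j \<in> J\<rbrakk> \<Longrightarrow> f i j \<in> carrier G"
  shows "(\<Oplus>i\<in>I. \<Oplus>j\<in>J. f i j) = (\<Oplus>j\<in>J. \<Oplus>i\<in>I. f i j)"
  using assms(1,3)
proof (induction I)
  case (insert k I)
  have "(\<Oplus>j\<in>J. \<Oplus>i\<in>insert k I. f i j) = (\<Oplus>j\<in>J. f k j \<oplus> (\<Oplus>i\<in>I. f i j))"
    using insert.hyps insert.prems by (intro finsum_cong') (auto simp: Pi_def)
  also have "\<dots> = (\<Oplus>j\<in>J. f k j) \<oplus> (\<Oplus>j\<in>J. \<Oplus>i\<in>I. f i j)"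
    using insert.prems by (intro finsum_addf) (auto simp: Pi_def)
  finally show ?case
    using insert by (subst finsum_insert) (auto simp: Pi_def)
qed simp

lemma (in module) submodule_zero: "submodule H R M \<Longrightarrow> \<zero>\<^bsub>M\<^esub> \<in> H"
  using subgroup.one_closed[OF submodule.axioms(1)] by force

lemma (in module) submodule_finsum_mem:
  assumes "submodule H R M" "\<And>i. i \<in> I \<Longrightarrow> f i \<in> H"
  shows "finsum M f I \<in> H"
  by (rule M.finsum_mem) (use submoduleE[OF assms(1)] assms(2) submodule_zero[OF assms(1)] in auto)

lemma (in module) submodule_Inter:
  assumes "S \<noteq> {}" "\<And>N. N \<in> S \<Longrightarrow> submodule N R M"
  shows "submodule (\<Inter>S) R M"
proof (rule submoduleI)
  show "\<Inter>S \<subseteq> carrier M" using assms submoduleE(1) by blast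
  show "\<zero>\<^bsub>M\<^esub> \<in> \<Inter>S" using assms(2) submodule_zero by blast
  show "\<ominus>\<^bsub>M\<^esub> a \<in> \<Inter>S" if "a \<in> \<Inter>S" for a
    using assms(2) submoduleE(3) that by blast
  show "a \<oplus>\<^bsub>M\<^esub> b \<in> \<Inter>S" if "a \<in> \<Inter>S" "b \<in> \<Inter>S" for a b
    using assms(2) submoduleE(5) that by blast
  show "c \<odot>\<^bsub>M\<^esub> a \<in> \<Inter>S" if "c \<in> carrier R" "a \<in> \<Inter>S" for c a
    using assms(2) submoduleE(4) that by blast
qed

text \<open>Composition with a fixed morphism, evaluation and insertion of a coordinate, the actions
  of central elements and push-forward are all instances, and so share the rules for zero, signs and
  finite sums.\<close>

locale linear_map = M: module K M + N: module K N
  for K (structure) and M :: "('k, 'a) module" and N :: "('k, 'b) module" +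
  fixes h
  assumes closed [simp]: "v \<in> carrier M \<Longrightarrow> h v \<in> carrier N"
    and add: "\<lbrakk>v \<in> carrier M; w \<in> carrier M\<rbrakk> \<Longrightarrow> h (v \<oplus>\<^bsub>M\<^esub> w) = h v \<oplus>\<^bsub>N\<^esub> h w"
    and smult: "\<lbrakk>c \<in> carrier K; v \<in> carrier M\<rbrakk> \<Longrightarrow> h (c \<odot>\<^bsub>M\<^esub> v) = c \<odot>\<^bsub>N\<^esub> h v"
begin

lemma zero: "h \<zero>\<^bsub>M\<^esub> = \<zero>\<^bsub>N\<^esub>"
  using smult[of "\<zero>" "\<zero>\<^bsub>M\<^esub>"] by (simp add: M.smult_l_null)

lemma neg: "v \<in> carrier M \<Longrightarrow> h (\<ominus>\<^bsub>M\<^esub> v) = \<ominus>\<^bsub>N\<^esub> h v"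
  using smult[of "\<ominus> \<one>" v] by (simp add: M.smult_l_minus N.smult_l_minus)

lemma minus: "\<lbrakk>v \<in> carrier M; w \<in> carrier M\<rbrakk> \<Longrightarrow> h (v \<ominus>\<^bsub>M\<^esub> w) = h v \<ominus>\<^bsub>N\<^esub> h w"
  by (simp add: a_minus_def add neg)

lemma sgn: "v \<in> carrier M \<Longrightarrow> h (sgn_mult M n v) = sgn_mult N n (h v)"
  by (simp add: sgn_mult_def neg)

lemma finsum:
  "f \<in> I \<rightarrow> carrier M \<Longrightarrow> h (finsum M f I) = finsum N (\<lambda>i. h (f i)) I"
proof (induction I rule: infinite_finite_induct)
  case (insert i I)
  have "(\<lambda>i. h (f i)) \<in> I \<rightarrow> carrier N" using insert.prems by (auto simp: Pi_def)
  with insert show ?case by (auto simp: add)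
qed (simp_all add: zero)

text \<open>Combined with the minimality of [B,B], this reduces the claim that a linear map
  preserves [B,B] to the generating commutators.\<close>

lemma vimage_submodule:
  assumes "submodule H K N"
  shows "submodule {v \<in> carrier M. h v \<in> H} K M"
  using N.submoduleE[OF assms] submodule.smult_closed[OF assms]
  by (intro M.submoduleI) (auto simp: zero neg add smult N.submodule_zero[OF assms])

end

section \<open>Signs acting on a module\<close>

context
  fixes K :: "('k, 'r) ring_scheme" and M :: "('k, 'm) module"
  assumes M: "module K M"
begin

interpretation module K M by (rule M)

lemma sgn_mult_closed: "v \<in> carrier M \<Longrightarrow> sgn_mult M n v \<in> carrier M"
  by (simp add: sgn_mult_def)

lemma sgn_mult_sgn_mult: "v \<in> carrier M \<Longrightarrow> sgn_mult M m (sgn_mult M n v) = sgn_mult M (m + n) v"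
  by (auto simp: sgn_mult_def)

lemma sgn_mult_zero: "sgn_mult M n \<zero>\<^bsub>M\<^esub> = \<zero>\<^bsub>M\<^esub>"
  by (simp add: sgn_mult_def)

lemma sgn_mult_linear: "linear_map K M M (sgn_mult M n)"
  by unfold_locales (auto simp: sgn_mult_def M.minus_add smult_r_minus)

end

lemma sgn_mult_cong_parity: "even (m - n) \<Longrightarrow> sgn_mult M m v = sgn_mult M n v"
  by (auto simp: sgn_mult_def)

section \<open>Graded categories and their cocenter\<close>

text \<open>\<open>gr_cat\<close> carries only data; these are the laws. Composition itself is free
  of signs: Koszul signs enter only through the center and the commutators.\<close>

locale graded_category =
  fixes K :: "('k, 'r) ring_scheme" and B :: "('k, 'o, 'm) gr_cat"
  assumes base_cring: "cring K"
    and GHom_module: "\<lbrakk>x \<in> GObj B; y \<in> GObj B\<rbrakk> \<Longrightarrow> module K (GHom B x y n)"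
    and gcomp_closed:
      "\<lbrakk>x \<in> GObj B; y \<in> GObj B; z \<in> GObj B; g \<in> carrier (GHom B y z m); f \<in> carrier (GHom B x y n)\<rbrakk>
        \<Longrightarrow> gcomp B x y z m n g f \<in> carrier (GHom B x z (m + n))"
    and gcomp_add_left:
      "\<lbrakk>x \<in> GObj B; y \<in> GObj B; z \<in> GObj B; g \<in> carrier (GHom B y z m); h \<in> carrier (GHom B y z m);
        f \<in> carrier (GHom B x y n)\<rbrakk>
        \<Longrightarrow> gcomp B x y z m n (g \<oplus>\<^bsub>GHom B y z m\<^esub> h) f
          = gcomp B x y z m n g f \<oplus>\<^bsub>GHom B x z (m + n)\<^esub> gcomp B x y z m n h f"
    and gcomp_add_right:
      "\<lbrakk>x \<in> GObj B; y \<in> GObj B; z \<in> GObj B; g \<in> carrier (GHom B y z m); f \<in> carrier (GHom B x y n);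
        h \<in> carrier (GHom B x y n)\<rbrakk>
        \<Longrightarrow> gcomp B x y z m n g (f \<oplus>\<^bsub>GHom B x y n\<^esub> h)
          = gcomp B x y z m n g f \<oplus>\<^bsub>GHom B x z (m + n)\<^esub> gcomp B x y z m n g h"
    and gcomp_smult_left:
      "\<lbrakk>x \<in> GObj B; y \<in> GObj B; z \<in> GObj B; c \<in> carrier K; g \<in> carrier (GHom B y z m);
        f \<in> carrier (GHom B x y n)\<rbrakk>
        \<Longrightarrow> gcomp B x y z m n (c \<odot>\<^bsub>GHom B y z m\<^esub> g) f = c \<odot>\<^bsub>GHom B x z (m + n)\<^esub> gcomp B x y z m n g f"
    and gcomp_smult_right:
      "\<lbrakk>x \<in> GObj B; y \<in> GObj B; z \<in> GObj B; c \<in> carrier K; g \<in> carrier (GHom B y z m);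
        f \<in> carrier (GHom B x y n)\<rbrakk>
        \<Longrightarrow> gcomp B x y z m n g (c \<odot>\<^bsub>GHom B x y n\<^esub> f) = c \<odot>\<^bsub>GHom B x z (m + n)\<^esub> gcomp B x y z m n g f"
    and gcomp_assoc:
      "\<lbrakk>w \<in> GObj B; x \<in> GObj B; y \<in> GObj B; z \<in> GObj B; h \<in> carrier (GHom B y z l);
        g \<in> carrier (GHom B x y m); f \<in> carrier (GHom B w x n)\<rbrakk>
        \<Longrightarrow> gcomp B w x z (l + m) n (gcomp B x y z l m h g) f
          = gcomp B w y z l (m + n) h (gcomp B w x y m n g f)"
    and gident_closed: "x \<in> GObj B \<Longrightarrow> gident B x \<in> carrier (GHom B x x 0)"
    and gcomp_ident_left:
      "\<lbrakk>x \<in> GObj B; y \<in> GObj B; f \<in> carrier (GHom B x y n)\<rbrakk> \<Longrightarrow> gcomp B x y y 0 n (gident B y) f = f"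
    and gcomp_ident_right:
      "\<lbrakk>x \<in> GObj B; y \<in> GObj B; f \<in> carrier (GHom B x y n)\<rbrakk> \<Longrightarrow> gcomp B x x y n 0 f (gident B x) = f"
begin

abbreviation hom :: "'o \<Rightarrow> 'o \<Rightarrow> int \<Rightarrow> 'm set" where
  "hom x y n \<equiv> carrier (GHom B x y n)"

abbreviation D :: "('k, 'o \<Rightarrow> int \<Rightarrow> 'm) module" where
  "D \<equiv> diag B"

abbreviation single :: "'o \<Rightarrow> int \<Rightarrow> 'm \<Rightarrow> 'o \<Rightarrow> int \<Rightarrow> 'm" where
  "single \<equiv> diag_single B"

abbreviation Comm :: "('o \<Rightarrow> int \<Rightarrow> 'm) set" where
  "Comm \<equiv> commutators K B"

lemma GHom_group: "\<lbrakk>x \<in> GObj B; y \<in> GObj B\<rbrakk> \<Longrightarrow> abelian_group (GHom B x y n)"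
  using GHom_module by (rule module.axioms)

lemma GHom_monoid: "\<lbrakk>x \<in> GObj B; y \<in> GObj B\<rbrakk> \<Longrightarrow> abelian_monoid (GHom B x y n)"
  using GHom_group by (rule abelian_group.axioms)

lemmas hom_ac = abelian_monoid.a_assoc[OF GHom_monoid] abelian_monoid.a_comm[OF GHom_monoid]
  abelian_monoid.a_lcomm[OF GHom_monoid]

lemma hom_zero [simp]: "\<lbrakk>x \<in> GObj B; y \<in> GObj B\<rbrakk> \<Longrightarrow> \<zero>\<^bsub>GHom B x y n\<^esub> \<in> hom x y n"
  using GHom_monoid by (rule abelian_monoid.zero_closed)

lemma hom_add [simp]:
  "\<lbrakk>x \<in> GObj B; y \<in> GObj B; f \<in> hom x y n; g \<in> hom x y n\<rbrakk> \<Longrightarrow> f \<oplus>\<^bsub>GHom B x y n\<^esub> g \<in> hom x y n"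
  using GHom_monoid by (rule abelian_monoid.a_closed)

lemma hom_smult [simp]:
  "\<lbrakk>x \<in> GObj B; y \<in> GObj B; c \<in> carrier K; f \<in> hom x y n\<rbrakk> \<Longrightarrow> c \<odot>\<^bsub>GHom B x y n\<^esub> f \<in> hom x y n"
  using GHom_module by (rule module.smult_closed)

lemma hom_neg [simp]:
  "\<lbrakk>x \<in> GObj B; y \<in> GObj B; f \<in> hom x y n\<rbrakk> \<Longrightarrow> \<ominus>\<^bsub>GHom B x y n\<^esub> f \<in> hom x y n"
  using GHom_group by (rule abelian_group.a_inv_closed)

lemma hom_sgn [simp]:
  "\<lbrakk>x \<in> GObj B; y \<in> GObj B; f \<in> hom x y n\<rbrakk> \<Longrightarrow> sgn_mult (GHom B x y n) k f \<in> hom x y n"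
  using GHom_module by (rule sgn_mult_closed)

lemma gcomp_closed':
  "\<lbrakk>k = m + n; x \<in> GObj B; y \<in> GObj B; z \<in> GObj B; g \<in> hom y z m; f \<in> hom x y n\<rbrakk>
    \<Longrightarrow> gcomp B x y z m n g f \<in> hom x z k"
  by (simp add: gcomp_closed)

lemma gcomp_left_linear:
  assumes "k = m + n" "x \<in> GObj B" "y \<in> GObj B" "z \<in> GObj B" "f \<in> hom x y n"
  shows "linear_map K (GHom B y z m) (GHom B x z k) (\<lambda>g. gcomp B x y z m n g f)"
  using assms
  by (auto intro!: linear_map.intro linear_map_axioms.intro GHom_module gcomp_closed gcomp_add_left gcomp_smult_left)

lemma gcomp_right_linear:
  assumes "k = m + n" "x \<in> GObj B" "y \<in> GObj B" "z \<in> GObj B" "g \<in> hom y z m"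
  shows "linear_map K (GHom B x y n) (GHom B x z k) (gcomp B x y z m n g)"
  using assms
  by (auto intro!: linear_map.intro linear_map_axioms.intro GHom_module gcomp_closed gcomp_add_right gcomp_smult_right)

lemma gcomp_zero_left [simp]:
  "\<lbrakk>x \<in> GObj B; y \<in> GObj B; z \<in> GObj B; f \<in> hom x y n\<rbrakk>
    \<Longrightarrow> gcomp B x y z m n \<zero>\<^bsub>GHom B y z m\<^esub> f = \<zero>\<^bsub>GHom B x z (m + n)\<^esub>"
  by (rule linear_map.zero[OF gcomp_left_linear[OF refl]])

lemma gcomp_zero_right [simp]:
  "\<lbrakk>x \<in> GObj B; y \<in> GObj B; z \<in> GObj B; g \<in> hom y z m\<rbrakk>
    \<Longrightarrow> gcomp B x y z m n g \<zero>\<^bsub>GHom B x y n\<^esub> = \<zero>\<^bsub>GHom B x z (m + n)\<^esub>"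
  by (rule linear_map.zero[OF gcomp_right_linear[OF refl]])

lemma gcomp_sgn_left:
  "\<lbrakk>k = m + n; x \<in> GObj B; y \<in> GObj B; z \<in> GObj B; g \<in> hom y z m; f \<in> hom x y n\<rbrakk>
    \<Longrightarrow> gcomp B x y z m n (sgn_mult (GHom B y z m) e g) f = sgn_mult (GHom B x z k) e (gcomp B x y z m n g f)"
  by (rule linear_map.sgn[OF gcomp_left_linear])

lemma gcomp_sgn_right:
  "\<lbrakk>k = m + n; x \<in> GObj B; y \<in> GObj B; z \<in> GObj B; g \<in> hom y z m; f \<in> hom x y n\<rbrakk>
    \<Longrightarrow> gcomp B x y z m n g (sgn_mult (GHom B x y n) e f) = sgn_mult (GHom B x z k) e (gcomp B x y z m n g f)"
  by (rule linear_map.sgn[OF gcomp_right_linear])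

text \<open>Associativity with the total degrees as separate variables, so that it applies up to
  integer arithmetic.\<close>

lemma gcomp_assoc':
  "\<lbrakk>p = l + m; q = m + n; w \<in> GObj B; x \<in> GObj B; y \<in> GObj B; z \<in> GObj B; h \<in> hom y z l;
    g \<in> hom x y m; f \<in> hom w x n\<rbrakk>
    \<Longrightarrow> gcomp B w x z p n (gcomp B x y z l m h g) f = gcomp B w y z l q h (gcomp B w x y m n g f)"
  by (simp add: gcomp_assoc)

subsection \<open>The module of diagonal morphisms\<close>

lemma diag_memI:
  assumes "f \<in> extensional (GObj B)" "\<And>x n. x \<in> GObj B \<Longrightarrow> f x n \<in> hom x x n"
    and "finite J" "\<And>x n. \<lbrakk>x \<in> GObj B; (x, n) \<notin> J\<rbrakk> \<Longrightarrow> f x n = \<zero>\<^bsub>GHom B x x n\<^esub>"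
  shows "f \<in> carrier D"
proof -
  have "{(x, n). x \<in> GObj B \<and> f x n \<noteq> \<zero>\<^bsub>GHom B x x n\<^esub>} \<subseteq> J" using assms(4) by auto
  with assms show ?thesis by (auto simp: diag_def PiE_def Pi_def intro: finite_subset)
qed

definition supp :: "('o \<Rightarrow> int \<Rightarrow> 'm) \<Rightarrow> ('o \<times> int) set" where
  "supp f = {(x, n). x \<in> GObj B \<and> f x n \<noteq> \<zero>\<^bsub>GHom B x x n\<^esub>}"

lemma finite_supp [simp]: "f \<in> carrier D \<Longrightarrow> finite (supp f)"
  by (simp add: diag_def supp_def)

lemma diag_apply_closed [simp]: "\<lbrakk>f \<in> carrier D; x \<in> GObj B\<rbrakk> \<Longrightarrow> f x n \<in> hom x x n"
  by (auto simp: diag_def)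

lemma diag_extensional: "f \<in> carrier D \<Longrightarrow> f \<in> extensional (GObj B)"
  by (auto simp: diag_def PiE_def)

lemma diag_zero_apply: "x \<in> GObj B \<Longrightarrow> \<zero>\<^bsub>D\<^esub> x n = \<zero>\<^bsub>GHom B x x n\<^esub>"
  by (simp add: diag_def)

lemma diag_add_apply: "x \<in> GObj B \<Longrightarrow> (f \<oplus>\<^bsub>D\<^esub> g) x n = f x n \<oplus>\<^bsub>GHom B x x n\<^esub> g x n"
  by (simp add: diag_def)

lemma diag_smult_apply: "x \<in> GObj B \<Longrightarrow> (c \<odot>\<^bsub>D\<^esub> f) x n = c \<odot>\<^bsub>GHom B x x n\<^esub> f x n"
  by (simp add: diag_def)

lemmas diag_apply = diag_zero_apply diag_add_apply diag_smult_apply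

lemma diag_ext_extensional: "\<zero>\<^bsub>D\<^esub> \<in> extensional (GObj B)" "f \<oplus>\<^bsub>D\<^esub> g \<in> extensional (GObj B)"
  "c \<odot>\<^bsub>D\<^esub> f \<in> extensional (GObj B)"
  by (simp_all add: diag_def)

lemma diag_eqI:
  "\<lbrakk>f \<in> extensional (GObj B); g \<in> extensional (GObj B); \<And>x n. x \<in> GObj B \<Longrightarrow> f x n = g x n\<rbrakk> \<Longrightarrow> f = g"
  by (rule extensionalityI) auto

lemma diag_smult_closed: "\<lbrakk>c \<in> carrier K; f \<in> carrier D\<rbrakk> \<Longrightarrow> c \<odot>\<^bsub>D\<^esub> f \<in> carrier D"
proof (rule diag_memI[where J = "supp f"])
  fix x n assume that: "c \<in> carrier K" "f \<in> carrier D" and x: "x \<in> GObj B" and "(x, n) \<notin> supp f"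
  then have "f x n = \<zero>\<^bsub>GHom B x x n\<^esub>" by (auto simp: supp_def)
  with x that show "(c \<odot>\<^bsub>D\<^esub> f) x n = \<zero>\<^bsub>GHom B x x n\<^esub>"
    by (simp add: diag_apply module.smult_r_null[OF GHom_module])
qed (auto simp: diag_apply diag_ext_extensional)

lemma diag_module: "module K D"
proof (rule moduleI)
  show "cring K" by (rule base_cring)
  note [simp] = diag_apply diag_ext_extensional diag_extensional
  have add: "f \<oplus>\<^bsub>D\<^esub> g \<in> carrier D" if "f \<in> carrier D" "g \<in> carrier D" for f g
  proof (rule diag_memI[where J = "supp f \<union> supp g"])
    fix x n assume x: "x \<in> GObj B" and "(x, n) \<notin> supp f \<union> supp g"
    then have "f x n = \<zero>\<^bsub>GHom B x x n\<^esub>" "g x n = \<zero>\<^bsub>GHom B x x n\<^esub>" by (auto simp: supp_def)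
    with x show "(f \<oplus>\<^bsub>D\<^esub> g) x n = \<zero>\<^bsub>GHom B x x n\<^esub>"
      by (simp add: abelian_monoid.l_zero[OF GHom_monoid])
  qed (use that in auto)
  have zero: "\<zero>\<^bsub>D\<^esub> \<in> carrier D" by (rule diag_memI[where J = "{}"]) auto
  show "abelian_group D"
  proof (rule abelian_groupI)
    fix f assume f: "f \<in> carrier D"
    \<comment> \<open>The additive inverse is taken to be -1 times f, whose finite support is
      already known.\<close>
    define g where "g = (\<ominus>\<^bsub>K\<^esub> \<one>\<^bsub>K\<^esub>) \<odot>\<^bsub>D\<^esub> f"
    have K: "\<ominus>\<^bsub>K\<^esub> \<one>\<^bsub>K\<^esub> \<in> carrier K" "\<one>\<^bsub>K\<^esub> \<in> carrier K" using base_cring by (simp_all add: cring.cring_simprules)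
    have "g \<oplus>\<^bsub>D\<^esub> f = \<zero>\<^bsub>D\<^esub>"
    proof (rule diag_eqI)
      fix x n assume x: "x \<in> GObj B"
      interpret module K "GHom B x x n" using x x by (rule GHom_module)
      show "(g \<oplus>\<^bsub>D\<^esub> f) x n = \<zero>\<^bsub>D\<^esub> x n"
        using f x by (simp add: g_def smult_l_minus M.l_neg)
    qed auto
    then show "\<exists>g\<in>carrier D. g \<oplus>\<^bsub>D\<^esub> f = \<zero>\<^bsub>D\<^esub>" using diag_smult_closed[OF K(1) f] g_def by blast
  qed (auto intro!: add zero diag_eqI simp: hom_ac abelian_monoid.r_zero[OF GHom_monoid]
        abelian_monoid.l_zero[OF GHom_monoid])
qed (auto intro!: diag_eqI diag_smult_closed simp: diag_apply diag_ext_extensional diag_extensional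
    module.smult_l_distr[OF GHom_module] module.smult_r_distr[OF GHom_module]
    module.smult_assoc1[OF GHom_module] module.smult_one[OF GHom_module])

sublocale D: module K D by (rule diag_module)

lemma diag_eval_linear:
  "x \<in> GObj B \<Longrightarrow> linear_map K D (GHom B x x n) (\<lambda>f. f x n)"
  by (auto intro!: linear_map.intro linear_map_axioms.intro diag_module GHom_module simp: diag_apply)

lemma single_closed [simp]: "\<lbrakk>x \<in> GObj B; v \<in> hom x x n\<rbrakk> \<Longrightarrow> single x n v \<in> carrier D"
  by (rule diag_memI[where J = "{(x, n)}"]) (auto simp: diag_single_def)

lemma single_apply:
  "y \<in> GObj B \<Longrightarrow> single x n v y m = (if y = x \<and> m = n then v else \<zero>\<^bsub>GHom B y y m\<^esub>)"
  by (simp add: diag_single_def)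

lemma single_linear: "x \<in> GObj B \<Longrightarrow> linear_map K (GHom B x x n) D (single x n)"
  by (intro linear_map.intro linear_map_axioms.intro diag_module GHom_module diag_eqI diag_extensional)
    (auto simp: single_apply diag_apply module.smult_r_null[OF GHom_module]
      abelian_monoid.l_zero[OF GHom_monoid])

lemma single_zero [simp]: "x \<in> GObj B \<Longrightarrow> single x n \<zero>\<^bsub>GHom B x x n\<^esub> = \<zero>\<^bsub>D\<^esub>"
  by (rule linear_map.zero[OF single_linear])

text \<open>Elements of the direct sum have finite support, so they are built up from zero one
  homogeneous coordinate at a time. Maps that are additive, or additive modulo [B,B], can then be
  compared on single coordinates.\<close>

lemma diag_induct [consumes 1, case_names zero single]:
  assumes "f \<in> carrier D" and "P \<zero>\<^bsub>D\<^esub>"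
    and step: "\<And>f x n v. \<lbrakk>f \<in> carrier D; P f; x \<in> GObj B; v \<in> hom x x n; f x n = \<zero>\<^bsub>GHom B x x n\<^esub>\<rbrakk>
      \<Longrightarrow> P (f \<oplus>\<^bsub>D\<^esub> single x n v)"
  shows "P f"
proof -
  have "P f" if "finite J" "f \<in> carrier D" "supp f \<subseteq> J" for J f
    using that
  proof (induction J arbitrary: f)
    case empty
    then have "f = \<zero>\<^bsub>D\<^esub>"
      by (intro diag_eqI diag_extensional) (auto simp: supp_def diag_apply)
    with assms(2) show ?case by simp
  next
    case (insert j J)
    obtain x n where j: "j = (x, n)" by fastforce
    show ?case
    proof (cases "x \<in> GObj B")
      case True
      \<comment> \<open>g is f with the coordinate (x, n) erased, so that its support lies in the
        smaller set.\<close>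
      define g where "g = (\<lambda>y\<in>GObj B. \<lambda>m. if y = x \<and> m = n then \<zero>\<^bsub>GHom B y y m\<^esub> else f y m)"
      have "supp g \<subseteq> J" using insert.prems j by (auto simp: supp_def g_def split: if_splits)
      moreover have g: "g \<in> carrier D"
        using insert.prems
        by (rule_tac diag_memI[OF _ _ finite_supp[of f]]) (use True in \<open>auto simp: g_def supp_def\<close>)
      ultimately have "P g" using insert.IH by blast
      then have "P (g \<oplus>\<^bsub>D\<^esub> single x n (f x n))"
        using g True insert.prems by (intro step) (auto simp: g_def)
      moreover have "g \<oplus>\<^bsub>D\<^esub> single x n (f x n) = f"
        using True insert.prems g
        by (intro diag_eqI diag_extensional)
          (auto simp: g_def diag_apply single_apply abelian_monoid.l_zero[OF GHom_monoid]
            abelian_monoid.r_zero[OF GHom_monoid])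
      ultimately show ?thesis by simp
    next
      case False
      then have "supp f \<subseteq> J" using insert.prems j by (auto simp: supp_def)
      with insert show ?thesis by blast
    qed
  qed
  from this[OF finite_supp] assms(1) show ?thesis by blast
qed

subsection \<open>Commutators\<close>

lemma comm_submodule: "submodule Comm K D"
proof -
  let ?S = "{N. submodule N K D \<and>
     (\<forall>x\<in>GObj B. \<forall>y\<in>GObj B. \<forall>i j. \<forall>u\<in>hom x y i. \<forall>f\<in>hom y x j.
        single x (i + j) (gcomp B x y x j i f u) \<ominus>\<^bsub>D\<^esub>
        single y (i + j) (sgn_mult (GHom B y y (i + j)) (i * j) (gcomp B y x y i j u f)) \<in> N)}"
  \<comment> \<open>The whole module is one of the submodules intersected, so the intersection is
    not over the empty family.\<close>
  have "carrier D \<in> ?S"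
    by (auto intro!: D.carrier_is_submodule D.minus_closed single_closed hom_sgn gcomp_closed' simp: add.commute)
  then have "submodule (\<Inter>?S) K D"
    by (intro D.submodule_Inter) auto
  then show ?thesis by (simp add: commutators_def)
qed

lemma comm_closed: "c \<in> Comm \<Longrightarrow> c \<in> carrier D"
  using D.submoduleE(1)[OF comm_submodule] by blast

lemma comm_zero [simp]: "\<zero>\<^bsub>D\<^esub> \<in> Comm"
  by (rule D.submodule_zero[OF comm_submodule])

lemma comm_add: "\<lbrakk>a \<in> Comm; b \<in> Comm\<rbrakk> \<Longrightarrow> a \<oplus>\<^bsub>D\<^esub> b \<in> Comm"
  by (rule D.submoduleE(5)[OF comm_submodule])

lemma comm_neg: "a \<in> Comm \<Longrightarrow> \<ominus>\<^bsub>D\<^esub> a \<in> Comm"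
  by (rule D.submoduleE(3)[OF comm_submodule])

lemma comm_smult: "\<lbrakk>c \<in> carrier K; a \<in> Comm\<rbrakk> \<Longrightarrow> c \<odot>\<^bsub>D\<^esub> a \<in> Comm"
  by (rule D.submoduleE(4)[OF comm_submodule])

lemma comm_generator:
  "\<lbrakk>x \<in> GObj B; y \<in> GObj B; u \<in> hom x y i; f \<in> hom y x j\<rbrakk> \<Longrightarrow>
    single x (i + j) (gcomp B x y x j i f u) \<ominus>\<^bsub>D\<^esub>
    single y (i + j) (sgn_mult (GHom B y y (i + j)) (i * j) (gcomp B y x y i j u f)) \<in> Comm"
  unfolding commutators_def by blast

lemma comm_least:
  assumes "submodule N K D"
    and "\<And>x y u f i j. \<lbrakk>x \<in> GObj B; y \<in> GObj B; u \<in> hom x y i; f \<in> hom y x j\<rbrakk> \<Longrightarrow>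
      single x (i + j) (gcomp B x y x j i f u) \<ominus>\<^bsub>D\<^esub>
      single y (i + j) (sgn_mult (GHom B y y (i + j)) (i * j) (gcomp B y x y i j u f)) \<in> N"
  shows "Comm \<subseteq> N"
  unfolding commutators_def using assms by blast

text \<open>Equality of classes in the cocenter, without cosets. Membership of both sides in the
  direct sum is built in, so that chains of congruences carry it along.\<close>

definition cong_comm :: "('o \<Rightarrow> int \<Rightarrow> 'm) \<Rightarrow> ('o \<Rightarrow> int \<Rightarrow> 'm) \<Rightarrow> bool"  (infix \<open>\<asymp>\<close> 50) where
  "f \<asymp> g \<longleftrightarrow> f \<in> carrier D \<and> g \<in> carrier D \<and> f \<ominus>\<^bsub>D\<^esub> g \<in> Comm"

lemma cong_closed: "f \<asymp> g \<Longrightarrow> f \<in> carrier D" "f \<asymp> g \<Longrightarrow> g \<in> carrier D"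
  by (simp_all add: cong_comm_def)

lemma cong_refl [intro]: "f \<in> carrier D \<Longrightarrow> f \<asymp> f"
  by (simp add: cong_comm_def D.M.r_neg a_minus_def)

lemma cong_sym: "f \<asymp> g \<Longrightarrow> g \<asymp> f"
  using comm_neg[of "f \<ominus>\<^bsub>D\<^esub> g"]
  by (auto simp: cong_comm_def D.M.minus_add D.M.minus_minus a_minus_def D.M.a_comm)

lemma cong_add: "\<lbrakk>f \<asymp> g; f' \<asymp> g'\<rbrakk> \<Longrightarrow> f \<oplus>\<^bsub>D\<^esub> f' \<asymp> g \<oplus>\<^bsub>D\<^esub> g'"
  using comm_add[of "f \<ominus>\<^bsub>D\<^esub> g" "f' \<ominus>\<^bsub>D\<^esub> g'"]
  by (auto simp: cong_comm_def D.M.minus_add a_minus_def D.M.a_ac)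

lemma cong_trans [trans]: "\<lbrakk>f \<asymp> g; g \<asymp> h\<rbrakk> \<Longrightarrow> f \<asymp> h"
  using comm_add[of "f \<ominus>\<^bsub>D\<^esub> g" "g \<ominus>\<^bsub>D\<^esub> h"]
  by (auto simp: cong_comm_def a_minus_def D.M.a_assoc D.M.r_neg1)

lemma cong_eq_trans [trans]: "\<lbrakk>f = g; g \<asymp> h\<rbrakk> \<Longrightarrow> f \<asymp> h" "\<lbrakk>f \<asymp> g; g = h\<rbrakk> \<Longrightarrow> f \<asymp> h"
  by simp_all

lemma cong_zero_iff: "f \<asymp> \<zero>\<^bsub>D\<^esub> \<longleftrightarrow> f \<in> Comm"
proof -
  have "f \<ominus>\<^bsub>D\<^esub> \<zero>\<^bsub>D\<^esub> = f" if "f \<in> carrier D"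
    using that D.M.minus_eq D.M.r_neg[of "\<zero>\<^bsub>D\<^esub>"] by simp
  then show ?thesis by (auto simp: cong_comm_def comm_closed)
qed

lemma cong_comm_iff: "f \<asymp> g \<Longrightarrow> f \<in> Comm \<longleftrightarrow> g \<in> Comm"
  by (meson cong_zero_iff cong_sym cong_trans)

text \<open>The graded trace property: a factor may be moved cyclically at the price of its Koszul
  sign. The total degree k is left free because the two composites naturally have degrees i + j and
  j + i.\<close>

lemma cong_comm_generator:
  assumes "x \<in> GObj B" "y \<in> GObj B" "u \<in> hom x y i" "f \<in> hom y x j" "k = i + j"
  shows "single x k (gcomp B x y x j i f u) \<asymp>
    single y k (sgn_mult (GHom B y y k) (i * j) (gcomp B y x y i j u f))"
  using comm_generator[OF assms(1-4)] assms
  by (auto simp: cong_comm_def add.commute intro!: single_closed gcomp_closed' hom_sgn)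

lemma cong_linear:
  assumes "linear_map K D D h" "\<And>c. c \<in> Comm \<Longrightarrow> h c \<in> Comm" "f \<asymp> g"
  shows "h f \<asymp> h g"
  using assms(3) assms(2)[of "f \<ominus>\<^bsub>D\<^esub> g"] linear_map.minus[OF assms(1), of f g] linear_map.closed[OF assms(1)]
  by (simp add: cong_comm_def)

lemma comm_coset_eq_iff:
  assumes "f \<in> carrier D" "g \<in> carrier D"
  shows "Comm +>\<^bsub>D\<^esub> f = Comm +>\<^bsub>D\<^esub> g \<longleftrightarrow> f \<asymp> g"
proof -
  interpret abelian_subgroup Comm D
    by (rule abelian_subgroupI3)
      (auto intro!: additive_subgroup.intro D.abelian_group_axioms submodule.axioms(1)[OF comm_submodule])
  have "Comm +>\<^bsub>D\<^esub> f = Comm +>\<^bsub>D\<^esub> g \<longleftrightarrow> f \<in> Comm +>\<^bsub>D\<^esub> g"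
    using a_repr_independence' a_repr_independenceD assms by metis
  then show ?thesis
    using a_rcos_module[OF assms(2,1)] assms by (simp add: cong_comm_def a_minus_def)
qed

end

section \<open>Powers in characteristic \<open>p\<close>\<close>

text \<open>If two rotations of a word of prime length p agree, some rotation of it is fixed by a
  shift prime to p; a multiple of that shift is 1 modulo p, so all letters are equal.\<close>

lemma replicate_if_rotate_eq:
  assumes "Factorial_Ring.prime (length w)" "i < j" "j < length w" "rotate i w = rotate j w"
  shows "\<exists>c. w = replicate (length w) c"
proof -
  let ?p = "length w"
  define v where "v = rotate i w"
  have len: "length v = ?p" by (simp add: v_def)
  have "rotate (j - i) v = rotate (j - i + i) w" by (simp only: v_def rotate_rotate)
  also have "\<dots> = v" using assms(2,4) by (simp add: v_def)
  finally have "rotate (j - i) v = v" .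
  then have fixed: "rotate ((j - i) * m) v = v" for m
    by (induction m) (simp_all add: rotate_rotate[symmetric])
  have "\<not> ?p dvd j - i" using assms by (auto dest: dvd_imp_le)
  then have "coprime (j - i) ?p"
    using assms(1) by (simp add: prime_imp_coprime coprime_commute)
  \<comment> \<open>Bezout: m shifts by j - i amount to l full turns and one further step.\<close>
  then obtain m l where "(j - i) * m = ?p * l + 1"
    using bezout_nat[of "j - i" ?p] assms(2) by auto
  then have "rotate (?p * l + 1) v = v" using fixed[of m] by simp
  then have "rotate 1 v = v"
    using rotate_conv_mod[of "?p * l + 1" v] rotate_conv_mod[of 1 v] len by simp
  then have rot: "rotate k v = v" for k by (induction k) simp_all
  have nth: "v ! k = v ! 0" if "k < ?p" for k
  proof -
    have "v ! 0 = rotate k v ! 0" by (simp only: rot)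
    also have "\<dots> = v ! k" using that len by (subst nth_rotate) auto
    finally show ?thesis ..
  qed
  have "v = replicate ?p (v ! 0)"
    using nth len by (intro nth_equalityI) auto
  \<comment> \<open>v is a rotation of w, hence has the same letters.\<close>
  then have "set w \<subseteq> {v ! 0}" using v_def by (metis set_rotate set_replicate_conv_if empty_subsetI order_refl)
  then have "w = replicate ?p (v ! 0)" using replicate_eqI[of w ?p "v ! 0"] by auto
  then show ?thesis ..
qed

definition rotations :: "'a list \<Rightarrow> 'a list set" where
  "rotations w = (\<lambda>k. rotate k w) ` UNIV"

lemma rotations_eq: "rotations w = (\<lambda>k. rotate k w) ` {..<length w}" if "w \<noteq> []"
proof -
  have "rotate k w \<in> (\<lambda>k. rotate k w) ` {..<length w}" for k
    using that by (subst rotate_conv_mod) auto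
  then show ?thesis by (auto simp: rotations_def)
qed

lemma self_in_rotations: "w \<in> rotations w"
  unfolding rotations_def by (rule image_eqI[of _ _ 0]) auto

lemma rotations_eq_of_mem:
  assumes "v \<in> rotations w"
  shows "rotations v = rotations w"
proof -
  obtain k where k: "v = rotate k w" using assms by (auto simp: rotations_def)
  have "rotate l w \<in> rotations v" for l
  proof (cases "w = []")
    case False
    \<comment> \<open>Exponents are natural numbers; adding k full turns makes it possible to undo
      the rotation by k.\<close>
    have "l + k * length w = (l + k * length w - k) + k" using False by (cases w) auto
    then have "rotate (l + k * length w - k) v = rotate (l + k * length w) w"
      unfolding k rotate_rotate by simp
    also have "\<dots> = rotate l w"
      using rotate_conv_mod[of "l + k * length w" w] rotate_conv_mod[of l w] by simp
    finally show ?thesis unfolding rotations_def by (metis rangeI)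
  qed (simp add: k rotations_def)
  then show ?thesis by (auto simp: rotations_def k rotate_rotate)
qed

text \<open>The rotations of a non-constant word by 0, ..., p - 1 are pairwise distinct; this is
  where primality of the length enters the orbit count.\<close>

lemma card_rotations:
  assumes "Factorial_Ring.prime (length w)" "\<nexists>c. w = replicate (length w) c"
  shows "card (rotations w) = length w"
proof -
  have "w \<noteq> []" using assms by auto
  have "inj_on (\<lambda>k. rotate k w) {..<length w}"
  proof (rule inj_onI, rule ccontr)
    fix i j assume "i \<in> {..<length w}" "j \<in> {..<length w}" "rotate i w = rotate j w" "i \<noteq> j"
    then show False
      using replicate_if_rotate_eq[of w i j] replicate_if_rotate_eq[of w j i] assms
      by (cases i j rule: linorder_cases) auto
  qed
  then show ?thesis using rotations_eq[OF \<open>w \<noteq> []\<close>] by (simp add: card_image)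
qed

section \<open>Products of words and powers of homogeneous endomorphisms\<close>

context graded_category
begin

text \<open>All letters have the same degree n, so the degree of a product depends only on the
  length of the word. Words rather than powers are needed because a and b do not commute in the
  expansion of (a + b)^p.\<close>

primrec gprod :: "'o \<Rightarrow> int \<Rightarrow> 'm list \<Rightarrow> 'm" where
  "gprod x n [] = gident B x"
| "gprod x n (v # vs) = gcomp B x x x n (int (length vs) * n) v (gprod x n vs)"

lemma gprod_closed:
  "\<lbrakk>x \<in> GObj B; set vs \<subseteq> hom x x n; d = int (length vs) * n\<rbrakk> \<Longrightarrow> gprod x n vs \<in> hom x x d"
  by (induction vs arbitrary: d) (auto simp: gident_closed algebra_simps intro!: gcomp_closed')

lemma gprod_append:
  "\<lbrakk>x \<in> GObj B; set us \<subseteq> hom x x n; set vs \<subseteq> hom x x n; d = int (length us) * n; e = int (length vs) * n\<rbrakk> \<Longrightarrow>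
    gprod x n (us @ vs) = gcomp B x x x d e (gprod x n us) (gprod x n vs)"
proof (induction us arbitrary: d)
  case Nil
  then show ?case by (auto intro!: gcomp_ident_left[symmetric] gprod_closed)
next
  case (Cons u us)
  have "gprod x n ((u # us) @ vs) = gcomp B x x x n (int (length us) * n + e) u
      (gcomp B x x x (int (length us) * n) e (gprod x n us) (gprod x n vs))"
    using Cons by (simp add: algebra_simps)
  also have "\<dots> = gcomp B x x x d e (gprod x n (u # us)) (gprod x n vs)"
    using Cons.prems by (auto intro!: gcomp_assoc'[symmetric] gprod_closed simp: algebra_simps)
  finally show ?case .
qed

lemma gpow_eq_gprod: "gpow B x n v k = gprod x n (replicate k v)"
  by (induction k) simp_all

lemma gpow_closed:
  "\<lbrakk>x \<in> GObj B; v \<in> hom x x n; d = int k * n\<rbrakk> \<Longrightarrow> gpow B x n v k \<in> hom x x d"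
  by (auto simp: gpow_eq_gprod intro!: gprod_closed)

lemma gpow_Suc_right:
  assumes "x \<in> GObj B" "v \<in> hom x x n" "d = int k * n"
  shows "gpow B x n v (Suc k) = gcomp B x x x d n (gpow B x n v k) v"
proof -
  have "gpow B x n v (Suc k) = gprod x n (replicate k v @ [v])"
    by (simp add: gpow_eq_gprod replicate_append_same)
  also have "\<dots> = gcomp B x x x d n (gprod x n (replicate k v)) (gprod x n [v])"
    using assms by (intro gprod_append) (auto split: if_splits)
  also have "gprod x n [v] = v"
    using assms gcomp_ident_right by simp
  finally show ?thesis by (simp add: gpow_eq_gprod)
qed

lemma gpow_zero: "\<lbrakk>x \<in> GObj B; k > 0; d = int k * n\<rbrakk> \<Longrightarrow> gpow B x n \<zero>\<^bsub>GHom B x x n\<^esub> k = \<zero>\<^bsub>GHom B x x d\<^esub>"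
  by (cases k) (auto simp: gpow_closed algebra_simps)

lemma gpow_smult:
  assumes "x \<in> GObj B" "v \<in> hom x x n" "c \<in> carrier K"
  shows "d = int k * n \<Longrightarrow> gpow B x n (c \<odot>\<^bsub>GHom B x x n\<^esub> v) k = (c [^]\<^bsub>K\<^esub> k) \<odot>\<^bsub>GHom B x x d\<^esub> gpow B x n v k"
proof (induction k arbitrary: d)
  case 0
  then show ?case
    using assms by (simp add: gident_closed module.smult_one[OF GHom_module] cring.cring_simprules[OF base_cring])
next
  case (Suc k)
  interpret module K "GHom B x x d" using assms GHom_module by blast
  have d: "d = n + int k * n" using Suc.prems by (simp add: algebra_simps)
  have pow: "gpow B x n v k \<in> hom x x (int k * n)" using assms by (auto intro: gpow_closed)
  have ck: "c [^]\<^bsub>K\<^esub> k \<in> carrier K" using assms by simp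
  have "gpow B x n (c \<odot>\<^bsub>GHom B x x n\<^esub> v) (Suc k) =
      gcomp B x x x n (int k * n) (c \<odot>\<^bsub>GHom B x x n\<^esub> v) ((c [^]\<^bsub>K\<^esub> k) \<odot>\<^bsub>GHom B x x (int k * n)\<^esub> gpow B x n v k)"
    using Suc.IH by simp
  also have "\<dots> = (c [^]\<^bsub>K\<^esub> k) \<odot>\<^bsub>GHom B x x d\<^esub> (c \<odot>\<^bsub>GHom B x x d\<^esub> gpow B x n v (Suc k))"
    using assms pow ck by (simp add: gcomp_smult_left gcomp_smult_right gcomp_closed d)
  also have "\<dots> = (c [^]\<^bsub>K\<^esub> Suc k) \<odot>\<^bsub>GHom B x x d\<^esub> gpow B x n v (Suc k)"
    using assms ck gpow_closed[OF assms(1,2) Suc.prems]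
    by (simp add: smult_assoc1[symmetric] del: gpow.simps)
  finally show ?case .
qed

text \<open>The non-commutative binomial expansion. \<open>True\<close> stands for the letter a and
  \<open>False\<close> for b, so that words are boolean lists and can be rotated as such.\<close>

lemma gpow_add:
  assumes x: "x \<in> GObj B" and ab: "a \<in> hom x x n" "b \<in> hom x x n"
  shows "d = int k * n \<Longrightarrow> gpow B x n (a \<oplus>\<^bsub>GHom B x x n\<^esub> b) k =
    finsum (GHom B x x d) (\<lambda>w. gprod x n (map (\<lambda>c. if c then a else b) w)) {w. length w = k}"
proof (induction k arbitrary: d)
  case 0
  interpret module K "GHom B x x d" using x GHom_module by blast
  have "gident B x \<in> hom x x d" using 0 x gident_closed by simp
  then show ?case by simp
next
  case (Suc k)
  let ?g = "\<lambda>w. gprod x n (map (\<lambda>c. if c then a else b) w)"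
  let ?W = "\<lambda>k. {w :: bool list. length w = k}"
  let ?e = "int k * n"
  have g: "?g w \<in> hom x x (int (length w) * n)" for w
    using x ab by (intro gprod_closed) auto
  interpret module K "GHom B x x d" using x GHom_module by blast
  have d: "d = n + ?e" using Suc.prems by (simp add: algebra_simps)
  have W: "finite (?W k)" using finite_lists_length_eq[of "UNIV :: bool set" k] by simp
  have g': "?g \<in> ?W k \<rightarrow> hom x x ?e" using g by auto
  have cl: "gcomp B x x x n ?e c (?g w) \<in> hom x x d" if "c \<in> {a, b}" "w \<in> ?W k" for c w
    using that x ab g[of w] by (intro gcomp_closed'[OF d]) auto
  have WS: "?W (Suc k) = Cons True ` ?W k \<union> Cons False ` ?W k"
    by (auto simp: length_Suc_conv image_iff)
  have sub: "gcomp B x x x n ?e c (gpow B x n (a \<oplus>\<^bsub>GHom B x x n\<^esub> b) k) =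
      finsum (GHom B x x d) (\<lambda>w. gcomp B x x x n ?e c (?g w)) (?W k)" if "c \<in> {a, b}" for c
    using that x ab linear_map.finsum[OF gcomp_right_linear[OF d x x x] g', of c] by (auto simp: Suc.IH)
  have "gpow B x n (a \<oplus>\<^bsub>GHom B x x n\<^esub> b) (Suc k) =
      gcomp B x x x n ?e a (gpow B x n (a \<oplus>\<^bsub>GHom B x x n\<^esub> b) k) \<oplus>\<^bsub>GHom B x x d\<^esub>
      gcomp B x x x n ?e b (gpow B x n (a \<oplus>\<^bsub>GHom B x x n\<^esub> b) k)"
    using x ab by (simp add: gcomp_add_left gpow_closed d)
  also have "\<dots> = finsum (GHom B x x d) ?g (Cons True ` ?W k) \<oplus>\<^bsub>GHom B x x d\<^esub>
      finsum (GHom B x x d) ?g (Cons False ` ?W k)"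
  proof -
    have "finsum (GHom B x x d) (\<lambda>w. gcomp B x x x n ?e (if c then a else b) (?g w)) (?W k) =
        finsum (GHom B x x d) ?g (Cons c ` ?W k)" for c
      using cl by (subst M.finsum_reindex) (auto intro!: M.finsum_cong')
    from this[of True] this[of False] show ?thesis by (simp add: sub)
  qed
  also have "\<dots> = finsum (GHom B x x d) ?g (?W (Suc k))"
  proof -
    have "?g \<in> Cons c ` ?W k \<rightarrow> hom x x d" for c
    proof (rule Pi_I)
      fix w assume "w \<in> Cons c ` ?W k"
      then have "length w = Suc k" by auto
      with g[of w] Suc.prems show "?g w \<in> hom x x d" by simp
    qed
    then show ?thesis unfolding WS using W by (intro M.finsum_Un_disjoint[symmetric]) auto
  qed
  finally show ?case .
qed

text \<open>Regrouping of the word f u f u ... f u as f (u f)^k u. With the outer f isolated, a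
  single cyclic move turns a power of f u into a power of u f.\<close>

lemma gpow_gcomp:
  assumes "x \<in> GObj B" "y \<in> GObj B" "u \<in> hom x y i" "f \<in> hom y x j"
  shows "gpow B x (j + i) (gcomp B x y x j i f u) (Suc k) =
    gcomp B x y x j (int k * (i + j) + i) f
      (gcomp B x y y (int k * (i + j)) i (gpow B y (i + j) (gcomp B y x y i j u f) k) u)"
proof (induction k)
  case 0
  then show ?case using assms by (simp add: gcomp_ident_left gcomp_ident_right gcomp_closed)
next
  case (Suc k)
  let ?w = "gcomp B y x y i j u f" and ?s = "i + j"
  let ?P = "gpow B y ?s ?w"
  have w: "?w \<in> hom y y ?s" using assms by (intro gcomp_closed)
  have P: "?P k \<in> hom y y (int k * ?s)" using assms w by (auto intro: gpow_closed)
  have Pu: "gcomp B x y y (int k * ?s) i (?P k) u \<in> hom x y (int k * ?s + i)"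
    using assms P by (auto intro: gcomp_closed)
  have deg: "int (Suc k) * (j + i) = j + (int k * ?s + i)" by (simp add: algebra_simps)
  have "gpow B x (j + i) (gcomp B x y x j i f u) (Suc (Suc k)) =
      gcomp B x x x (j + i) (j + (int k * ?s + i)) (gcomp B x y x j i f u)
        (gcomp B x y x j (int k * ?s + i) f (gcomp B x y y (int k * ?s) i (?P k) u))"
    by (simp only: gpow.simps(2)[of B x _ _ "Suc k"] Suc.IH deg)
  also have "\<dots> = gcomp B x y x j (i + (j + (int k * ?s + i))) f
      (gcomp B x x y i (j + (int k * ?s + i)) u (gcomp B x y x j (int k * ?s + i) f (gcomp B x y y (int k * ?s) i (?P k) u)))"
    using assms Pu by (intro gcomp_assoc') (auto intro: gcomp_closed)
  also have "gcomp B x x y i (j + (int k * ?s + i)) u (gcomp B x y x j (int k * ?s + i) f (gcomp B x y y (int k * ?s) i (?P k) u))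
    = gcomp B x y y ?s (int k * ?s + i) ?w (gcomp B x y y (int k * ?s) i (?P k) u)"
    using assms Pu by (intro gcomp_assoc'[symmetric]) auto
  also have "\<dots> = gcomp B x y y (int (Suc k) * ?s) i (?P (Suc k)) u"
    unfolding gpow.simps using assms w P by (intro gcomp_assoc'[symmetric]) (auto simp: algebra_simps)
  finally show ?case by (simp add: algebra_simps)
qed

end

lemma (in module) add_pow_smult_one:
  "v \<in> carrier M \<Longrightarrow> [n] \<cdot>\<^bsub>M\<^esub> v = ([n] \<cdot>\<^bsub>R\<^esub> \<one>\<^bsub>R\<^esub>) \<odot>\<^bsub>M\<^esub> v" for n :: nat
  by (induction n) (auto simp: smult_l_null smult_l_distr)

locale graded_category_char = graded_category K B for K :: "('k, 'r) ring_scheme" and B :: "('k, 'o, 'm) gr_cat" +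
  fixes p :: nat
  assumes field: "field K" and char: "has_characteristic K p" and p_pos: "p > 0"
begin

interpretation K: field K by (rule field)

text \<open>A factorization p = a b with smaller factors gives (a 1)(b 1) = 0 in a field, hence a
  vanishing positive multiple of 1 below p.\<close>

lemma prime_char: "Factorial_Ring.prime p"
proof (rule ccontr)
  assume "\<not> Factorial_Ring.prime p"
  \<comment> \<open>p = 1 would make 1 = 0 in K.\<close>
  moreover have "p \<noteq> 1"
    using char K.one_not_zero D.R.add.nat_pow_eone[of "\<one>\<^bsub>K\<^esub>"] unfolding has_characteristic_def
    by (metis D.R.one_closed dvd_refl)
  ultimately obtain a where a: "a dvd p" "a \<noteq> 1" "a \<noteq> p"
    using p_pos unfolding prime_nat_iff by (auto dest: nat_neq_iff[THEN iffD1])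
  then obtain b where "p = a * b" by (elim dvdE)
  with a p_pos have ab: "p = a * b" "a < p" "b < p"
    by (auto simp: Suc_lessI dest: dvd_imp_le)
  have "([a] \<cdot>\<^bsub>K\<^esub> \<one>\<^bsub>K\<^esub>) \<otimes>\<^bsub>K\<^esub> ([b] \<cdot>\<^bsub>K\<^esub> \<one>\<^bsub>K\<^esub>) = [p] \<cdot>\<^bsub>K\<^esub> \<one>\<^bsub>K\<^esub>"
    by (simp add: ab(1) D.R.add_pow_ldistr D.R.add_pow_rdistr D.R.add.nat_pow_pow mult.commute)
  also have "\<dots> = \<zero>\<^bsub>K\<^esub>" using char by (simp add: has_characteristic_def)
  finally have "[a] \<cdot>\<^bsub>K\<^esub> \<one>\<^bsub>K\<^esub> = \<zero>\<^bsub>K\<^esub> \<or> [b] \<cdot>\<^bsub>K\<^esub> \<one>\<^bsub>K\<^esub> = \<zero>\<^bsub>K\<^esub>"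
    by (simp add: K.integral_iff)
  then have "p dvd a \<or> p dvd b" using char by (simp add: has_characteristic_def)
  with ab p_pos show False by (auto dest!: dvd_imp_le)
qed

lemma char_two_or_odd: "p = 2 \<or> odd p"
  using prime_odd_nat[OF prime_char] prime_ge_2_nat[OF prime_char] by linarith

text \<open>The form in which unwanted signs disappear: their exponents are multiples of p - 1, and
  in characteristic 2 every sign acts trivially.\<close>

lemma even_char_pred: "p = 2 \<or> even (int p - 1)"
  using char_two_or_odd by auto

lemma char_torsion:
  assumes "module K M" "v \<in> carrier M"
  shows "[p] \<cdot>\<^bsub>M\<^esub> v = \<zero>\<^bsub>M\<^esub>"
proof -
  interpret module K M by fact
  have "[p] \<cdot>\<^bsub>K\<^esub> \<one>\<^bsub>K\<^esub> = \<zero>\<^bsub>K\<^esub>" using char by (simp add: has_characteristic_def)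
  then show ?thesis using assms(2) by (simp add: add_pow_smult_one)
qed

text \<open>In characteristic 2 this holds because -1 = 1, otherwise because p is odd; p-th powers
  therefore commute with signs.\<close>

lemma neg_one_pow_char: "(\<ominus>\<^bsub>K\<^esub> \<one>\<^bsub>K\<^esub>) [^]\<^bsub>K\<^esub> p = \<ominus>\<^bsub>K\<^esub> \<one>\<^bsub>K\<^esub>"
proof (cases "p = 2")
  case True
  have "[(2::nat)] \<cdot>\<^bsub>K\<^esub> \<one>\<^bsub>K\<^esub> = \<zero>\<^bsub>K\<^esub>" using char True by (simp add: has_characteristic_def)
  then have "\<one>\<^bsub>K\<^esub> \<oplus>\<^bsub>K\<^esub> \<one>\<^bsub>K\<^esub> = \<zero>\<^bsub>K\<^esub>" by (simp add: numeral_2_eq_2)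
  then have "\<ominus>\<^bsub>K\<^esub> \<one>\<^bsub>K\<^esub> = \<one>\<^bsub>K\<^esub>" by (simp add: D.R.minus_equality)
  then show ?thesis by simp
next
  case False
  then have "odd p" using char_two_or_odd by blast
  then obtain k where "p = Suc (2 * k)" by (auto elim!: oddE)
  moreover have "(\<ominus>\<^bsub>K\<^esub> \<one>\<^bsub>K\<^esub>) [^]\<^bsub>K\<^esub> (2 * k) = \<one>\<^bsub>K\<^esub>"
    by (induction k) (simp_all add: D.R.l_minus)
  ultimately show ?thesis by simp
qed

lemma sgn_mult_cong:
  assumes "p = 2 \<or> even (m - n)" "module K M" "v \<in> carrier M"
  shows "sgn_mult M m v = sgn_mult M n v"
proof (cases "p = 2")
  case True
  interpret module K M by fact
  have "[(2::nat)] \<cdot>\<^bsub>M\<^esub> v = \<zero>\<^bsub>M\<^esub>" using char_torsion[OF assms(2,3)] True by simp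
  then have "v \<oplus>\<^bsub>M\<^esub> v = \<zero>\<^bsub>M\<^esub>" using assms(3) by (simp add: numeral_2_eq_2)
  then have "\<ominus>\<^bsub>M\<^esub> v = v" using assms(3) by (simp add: M.add.inv_equality)
  then show ?thesis by (simp add: sgn_mult_def)
qed (use assms in \<open>auto intro: sgn_mult_cong_parity\<close>)

text \<open>Moving the first letter to the end passes it, of degree n, across a product of degree (p
  - 1) n. The exponent of the Koszul sign is a multiple of p - 1, so the sign has no effect in
  characteristic p.\<close>

lemma gprod_rotate1:
  assumes "x \<in> GObj B" "set vs \<subseteq> hom x x n" "length vs = p" "d = int p * n"
  shows "single x d (gprod x n vs) \<asymp> single x d (gprod x n (rotate1 vs))"
proof -
  obtain v us where vs: "vs = v # us" using assms(3) p_pos by (cases vs) auto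
  let ?i = "int (length us) * n"
  have "int p = int (length us) + 1" using assms(3) vs by simp
  then have d: "d = ?i + n" using assms(4) by (simp add: algebra_simps)
  have us: "gprod x n us \<in> hom x x ?i" and v: "v \<in> hom x x n"
    using assms vs by (auto intro: gprod_closed)
  have "single x d (gprod x n vs) \<asymp>
      single x d (sgn_mult (GHom B x x d) (?i * n) (gcomp B x x x ?i n (gprod x n us) v))"
    using cong_comm_generator[OF assms(1,1) us v d] vs by simp
  also have "sgn_mult (GHom B x x d) (?i * n) (gcomp B x x x ?i n (gprod x n us) v) =
      sgn_mult (GHom B x x d) 0 (gcomp B x x x ?i n (gprod x n us) v)"
    using assms us v vs even_char_pred d
    by (intro sgn_mult_cong GHom_module gcomp_closed') auto
  also have "gcomp B x x x ?i n (gprod x n us) v = gprod x n (rotate1 vs)"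
    using assms vs v gprod_append[of x us n "[v]" ?i n] by (simp add: gcomp_ident_right)
  finally show ?thesis by (simp add: sgn_mult_def)
qed

lemma finsum_cong_comm:
  assumes "finite I" "\<And>i. i \<in> I \<Longrightarrow> f i \<asymp> g i"
  shows "finsum D f I \<asymp> finsum D g I"
  using assms
proof (induction I)
  case (insert i I)
  then have "f \<in> I \<rightarrow> carrier D" "g \<in> I \<rightarrow> carrier D" "f i \<in> carrier D" "g i \<in> carrier D"
    by (auto simp: cong_comm_def)
  with insert show ?case by (simp add: cong_add)
qed (simp add: cong_refl)

text \<open>The non-constant words of length \<open>p\<close> in the expansion of \<open>(a + b)\<^sup>p\<close> fall into orbits of
  size \<open>p\<close> under rotation, and rotating a word does not change its class modulo commutators.\<close>

lemma gpow_char_add: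
  assumes x: "x \<in> GObj B" and ab: "a \<in> hom x x n" "b \<in> hom x x n" and d: "d = int p * n"
  shows "single x d (gpow B x n (a \<oplus>\<^bsub>GHom B x x n\<^esub> b) p) \<asymp>
    single x d (gpow B x n a p) \<oplus>\<^bsub>D\<^esub> single x d (gpow B x n b p)"
proof -
  let ?l = "\<lambda>c. if c then a else b"
  define F where "F w = single x d (gprod x n (map ?l w))" for w
  let ?W = "{w :: bool list. length w = p}"
  let ?c = "{replicate p True, replicate p False}"
  \<comment> \<open>The non-constant words; the two constant ones contribute a^p and b^p.\<close>
  define N where "N = ?W - ?c"
  have fin: "finite ?W" using finite_lists_length_eq[of "UNIV :: bool set" p] by simp
  have set: "set (map ?l w) \<subseteq> hom x x n" for w using ab by auto
  have gw: "gprod x n (map ?l w) \<in> hom x x d" if "length w = p" for w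
    using x set d that by (intro gprod_closed) auto
  then have F: "F w \<in> carrier D" if "length w = p" for w
    using x that by (simp add: F_def)
  have rot: "F (rotate k w) \<asymp> F w" if "length w = p" for w k
  proof (induction k)
    case (Suc k)
    have "F (rotate k w) \<asymp> F (rotate1 (rotate k w))"
      unfolding F_def rotate1_map[symmetric] using that set x d by (intro gprod_rotate1) auto
    with Suc show ?case using cong_sym cong_trans by (metis rotate_Suc)
  qed (use F that in auto)
  have const: "w \<in> ?c" if "length w = p" "w = replicate (length w) c" for w c
    using that by (cases c) auto
  have rotN: "rotations w \<subseteq> N" if "w \<in> N" for w
  proof
    fix v assume v: "v \<in> rotations w"
    then have "length v = p" "set v = set w" using that by (auto simp: rotations_def N_def)
    have "v \<noteq> replicate p c" for c
    proof
      assume "v = replicate p c"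
      then have "set w = {c}" using \<open>set v = set w\<close> p_pos by simp
      then have "w = replicate p c" using replicate_eqI[of w p c] that by (simp add: N_def)
      then show False using that by (cases c) (simp_all add: N_def)
    qed
    with \<open>length v = p\<close> show "v \<in> N" by (simp add: N_def)
  qed
  then have N: "\<Union>(rotations ` N) = N" using self_in_rotations by blast
  have "finsum D F (rotations w) \<in> Comm" if "w \<in> N" for w
  proof -
    have len: "length w = p" using that by (simp add: N_def)
    have "card (rotations w) = p"
      using card_rotations[of w] prime_char len const[OF len] that unfolding N_def by blast
    \<comment> \<open>An orbit has p elements, so a constant sum over it is p times its value, which
      vanishes.\<close>
    then have "finsum D (\<lambda>_. F w) (rotations w) = \<zero>\<^bsub>D\<^esub>"
      using D.M.add.finprod_const[of "F w" "rotations w"] F[OF len] char_torsion[OF diag_module F[OF len]]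
      by (simp add: finsum_def)
    moreover have "finite (rotations w)"
      using rotN[OF that] fin by (auto simp: N_def intro: finite_subset)
    then have "finsum D F (rotations w) \<asymp> finsum D (\<lambda>_. F w) (rotations w)"
      using rot[OF len] by (intro finsum_cong_comm) (auto simp: rotations_def)
    ultimately show ?thesis by (simp add: cong_zero_iff)
  qed
  then have "finsum D (finsum D F) (rotations ` N) \<in> Comm"
    by (rule_tac D.submodule_finsum_mem[OF comm_submodule]) (elim imageE, simp)
  \<comment> \<open>Distinct orbits are disjoint, so the sum may be taken orbit by orbit; together
    they cover N.\<close>
  also have "finsum D (finsum D F) (rotations ` N) = finsum D F (\<Union>(rotations ` N))"
  proof (rule D.M.add.finprod_Union_disjoint[symmetric])
    show "finite (rotations ` N)" using fin by (simp add: N_def)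
    show "pairwise disjnt (rotations ` N)"
      using rotations_eq_of_mem unfolding pairwise_def disjnt_def by blast
    show "finite A \<and> (\<forall>w\<in>A. F w \<in> carrier D)" if "A \<in> rotations ` N" for A
    proof -
      have "A \<subseteq> N" using that rotN by blast
      then show ?thesis using F finite_subset[OF _ fin, of A] by (auto simp: N_def)
    qed
  qed
  finally have FN: "finsum D F N \<in> Comm" by (simp add: N)
  have "single x d (gpow B x n (a \<oplus>\<^bsub>GHom B x x n\<^esub> b) p) = finsum D F ?W"
    unfolding F_def gpow_add[OF x ab d] using gw
    by (intro linear_map.finsum[OF single_linear[OF x]]) auto
  also have "\<dots> = finsum D F (N \<union> ?c)" by (rule arg_cong[of _ _ "finsum D F"]) (auto simp: N_def)
  also have "\<dots> = finsum D F N \<oplus>\<^bsub>D\<^esub> finsum D F ?c"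
    using fin F by (intro D.M.finsum_Un_disjoint) (auto simp: N_def)
  also have "\<dots> \<asymp> \<zero>\<^bsub>D\<^esub> \<oplus>\<^bsub>D\<^esub> finsum D F ?c"
    using FN F by (intro cong_add) (auto simp: cong_zero_iff intro!: cong_refl D.M.finsum_closed)
  also have "\<zero>\<^bsub>D\<^esub> \<oplus>\<^bsub>D\<^esub> finsum D F ?c = single x d (gpow B x n a p) \<oplus>\<^bsub>D\<^esub> single x d (gpow B x n b p)"
  proof -
    have "replicate p True \<noteq> replicate p False" using p_pos by (cases p) auto
    then have "finsum D F ?c = F (replicate p True) \<oplus>\<^bsub>D\<^esub> F (replicate p False)"
      using F by simp
    with F[of "replicate p True"] F[of "replicate p False"] show ?thesis by (simp add: F_def gpow_eq_gprod)
  qed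
  finally show ?thesis .
qed

end

section \<open>The center and its action on the cocenter\<close>

context graded_category
begin

lemma gcenter_deg_closed [simp]: "\<lbrakk>a \<in> gcenter_deg B n; x \<in> GObj B\<rbrakk> \<Longrightarrow> a x \<in> hom x x n"
  unfolding gcenter_deg_def by blast

lemma gcenter_deg_extensional: "a \<in> gcenter_deg B n \<Longrightarrow> a \<in> extensional (GObj B)"
  unfolding gcenter_deg_def PiE_def by blast

lemma gcenter_deg_central:
  "\<lbrakk>a \<in> gcenter_deg B i; x \<in> GObj B; y \<in> GObj B; f \<in> hom x y j; k = i + j\<rbrakk> \<Longrightarrow>
    gcomp B x x y j i f (a x) = sgn_mult (GHom B x y k) (i * j) (gcomp B x y y i j (a y) f)"
  unfolding gcenter_deg_def by blast

text \<open>Signs are involutions, so centrality can be solved for either side.\<close>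

lemma gcenter_deg_central':
  assumes "a \<in> gcenter_deg B i" "x \<in> GObj B" "y \<in> GObj B" "f \<in> hom x y j" "k = i + j"
  shows "gcomp B x y y i j (a y) f = sgn_mult (GHom B x y k) (i * j) (gcomp B x x y j i f (a x))"
proof -
  have "gcomp B x y y i j (a y) f \<in> hom x y k" using assms by (auto intro: gcomp_closed')
  then show ?thesis
    using gcenter_deg_central[OF assms] abelian_group.minus_minus[OF GHom_group[OF assms(2,3)]]
    by (simp add: sgn_mult_def)
qed

lemma gcenter_degI:
  assumes "a \<in> extensional (GObj B)" "\<And>x. x \<in> GObj B \<Longrightarrow> a x \<in> hom x x i"
    and "\<And>x y f j. \<lbrakk>x \<in> GObj B; y \<in> GObj B; f \<in> hom x y j\<rbrakk> \<Longrightarrow>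
      gcomp B x x y j i f (a x) = sgn_mult (GHom B x y (i + j)) (i * j) (gcomp B x y y i j (a y) f)"
  shows "a \<in> gcenter_deg B i"
  unfolding gcenter_deg_def using assms by (simp add: PiE_def Pi_def)

lemma gcenter_deg_add:
  assumes "a \<in> gcenter_deg B n" "b \<in> gcenter_deg B n"
  shows "(\<lambda>x\<in>GObj B. a x \<oplus>\<^bsub>GHom B x x n\<^esub> b x) \<in> gcenter_deg B n"
proof (rule gcenter_degI)
  fix x y f j assume xy: "x \<in> GObj B" "y \<in> GObj B" and f: "f \<in> hom x y j"
  interpret linear_map K "GHom B x y (n + j)" "GHom B x y (n + j)" "sgn_mult (GHom B x y (n + j)) (n * j)"
    using xy by (intro sgn_mult_linear GHom_module)
  show "gcomp B x x y j n f ((\<lambda>x\<in>GObj B. a x \<oplus>\<^bsub>GHom B x x n\<^esub> b x) x) = sgn_mult (GHom B x y (n + j)) (n * j)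
      (gcomp B x y y n j ((\<lambda>x\<in>GObj B. a x \<oplus>\<^bsub>GHom B x x n\<^esub> b x) y) f)"
    using xy f assms
    by (simp add: gcomp_add_left gcomp_add_right gcenter_deg_central[OF assms(1) xy f refl]
        gcenter_deg_central[OF assms(2) xy f refl] add gcomp_closed add.commute[of j n])
qed (use assms in auto)

lemma gcenter_deg_smult:
  assumes "a \<in> gcenter_deg B n" "c \<in> carrier K"
  shows "(\<lambda>x\<in>GObj B. c \<odot>\<^bsub>GHom B x x n\<^esub> a x) \<in> gcenter_deg B n"
proof (rule gcenter_degI)
  fix x y f j assume xy: "x \<in> GObj B" "y \<in> GObj B" and f: "f \<in> hom x y j"
  interpret linear_map K "GHom B x y (n + j)" "GHom B x y (n + j)" "sgn_mult (GHom B x y (n + j)) (n * j)"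
    using xy by (intro sgn_mult_linear GHom_module)
  show "gcomp B x x y j n f ((\<lambda>x\<in>GObj B. c \<odot>\<^bsub>GHom B x x n\<^esub> a x) x) = sgn_mult (GHom B x y (n + j)) (n * j)
      (gcomp B x y y n j ((\<lambda>x\<in>GObj B. c \<odot>\<^bsub>GHom B x x n\<^esub> a x) y) f)"
    using xy f assms
    by (simp add: gcomp_smult_left gcomp_smult_right gcenter_deg_central[OF assms(1) xy f refl]
        smult gcomp_closed add.commute[of j n])
qed (use assms in auto)

lemma gcenter_deg_zero: "(\<lambda>x\<in>GObj B. \<zero>\<^bsub>GHom B x x n\<^esub>) \<in> gcenter_deg B n"
  by (rule gcenter_degI) (auto simp: sgn_mult_zero[OF GHom_module] add.commute)

text \<open>Needed to absorb into a central factor the sign that arises when a product with it is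
  raised to the power p. For an odd exponent the sign is multiplication by the scalar -1.\<close>

lemma gcenter_deg_sgn:
  assumes "a \<in> gcenter_deg B n"
  shows "(\<lambda>x\<in>GObj B. sgn_mult (GHom B x x n) e (a x)) \<in> gcenter_deg B n"
proof (cases "even e")
  case True
  then have "(\<lambda>x\<in>GObj B. sgn_mult (GHom B x x n) e (a x)) = a"
    using gcenter_deg_extensional[OF assms] by (auto simp: sgn_mult_def intro: extensionalityI)
  with assms show ?thesis by simp
next
  case False
  have K: "\<ominus>\<^bsub>K\<^esub> \<one>\<^bsub>K\<^esub> \<in> carrier K" "\<one>\<^bsub>K\<^esub> \<in> carrier K" using base_cring by (simp_all add: cring.cring_simprules)
  have "(\<lambda>x\<in>GObj B. sgn_mult (GHom B x x n) e (a x)) = (\<lambda>x\<in>GObj B. (\<ominus>\<^bsub>K\<^esub> \<one>\<^bsub>K\<^esub>) \<odot>\<^bsub>GHom B x x n\<^esub> a x)"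
    using False assms K
    by (auto simp: sgn_mult_def module.smult_l_minus[OF GHom_module] module.smult_one[OF GHom_module])
  with gcenter_deg_smult[OF assms K(1)] show ?thesis by simp
qed

lemma gcenter_deg_one: "(\<lambda>x\<in>GObj B. gident B x) \<in> gcenter_deg B 0"
  by (rule gcenter_degI) (auto simp: gident_closed gcomp_ident_left gcomp_ident_right sgn_mult_def)

text \<open>A morphism of degree j passes a at the cost of (-1)^(m j) and b at the cost of (-1)^(n
  j); these multiply to the sign for degree m + n.\<close>

lemma gcenter_deg_mult:
  assumes a: "a \<in> gcenter_deg B m" and b: "b \<in> gcenter_deg B n" and d: "d = m + n"
  shows "(\<lambda>x\<in>GObj B. gcomp B x x x m n (a x) (b x)) \<in> gcenter_deg B d"
proof (rule gcenter_degI)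
  fix x assume "x \<in> GObj B"
  then show "(\<lambda>x\<in>GObj B. gcomp B x x x m n (a x) (b x)) x \<in> hom x x d"
    using a b d by (auto intro: gcomp_closed')
next
  fix x y f j assume x: "x \<in> GObj B" and y: "y \<in> GObj B" and f: "f \<in> hom x y j"
  let ?k = "d + j"
  have "gcomp B x x y j d f (gcomp B x x x m n (a x) (b x)) =
      gcomp B x x y (m + j) n (gcomp B x x y j m f (a x)) (b x)"
    using x y f a b d by (intro gcomp_assoc'[symmetric]) auto
  also have "\<dots> = sgn_mult (GHom B x y ?k) (m * j) (gcomp B x x y (m + j) n (gcomp B x y y m j (a y) f) (b x))"
    using x y f a b d
    by (subst gcenter_deg_central[OF a x y f refl], intro gcomp_sgn_left) (auto intro: gcomp_closed)
  also have "gcomp B x x y (m + j) n (gcomp B x y y m j (a y) f) (b x) =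
      gcomp B x y y m (n + j) (a y) (gcomp B x x y j n f (b x))"
    using x y f a b d by (intro gcomp_assoc') auto
  also have "\<dots> = sgn_mult (GHom B x y ?k) (n * j) (gcomp B x y y m (n + j) (a y) (gcomp B x y y n j (b y) f))"
    using x y f a b d
    by (subst gcenter_deg_central[OF b x y f refl], intro gcomp_sgn_right) (auto intro: gcomp_closed)
  also have "gcomp B x y y m (n + j) (a y) (gcomp B x y y n j (b y) f) =
      gcomp B x y y d j (gcomp B y y y m n (a y) (b y)) f"
    using x y f a b d by (intro gcomp_assoc'[symmetric]) auto
  also have "sgn_mult (GHom B x y ?k) (m * j) (sgn_mult (GHom B x y ?k) (n * j) \<dots>) = sgn_mult (GHom B x y ?k) (d * j) \<dots>"
    using x y f a b d
    by (subst sgn_mult_sgn_mult[OF GHom_module[OF x y]]) (auto intro!: gcomp_closed' simp: algebra_simps)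
  finally show "gcomp B x x y j d f ((\<lambda>x\<in>GObj B. gcomp B x x x m n (a x) (b x)) x) =
      sgn_mult (GHom B x y ?k) (d * j) (gcomp B x y y d j ((\<lambda>x\<in>GObj B. gcomp B x x x m n (a x) (b x)) y) f)"
    using x y by simp
qed auto

lemma gcenter_deg_pow:
  "a \<in> gcenter_deg B n \<Longrightarrow> d = int k * n \<Longrightarrow> (\<lambda>x\<in>GObj B. gpow B x n (a x) k) \<in> gcenter_deg B d"
proof (induction k arbitrary: d)
  case 0
  then show ?case using gcenter_deg_one by (simp add: restrict_def)
next
  case (Suc k)
  have "(\<lambda>x\<in>GObj B. gcomp B x x x n (int k * n) (a x) ((\<lambda>x\<in>GObj B. gpow B x n (a x) k) x)) \<in> gcenter_deg B d"
    using Suc by (intro gcenter_deg_mult) (auto simp: algebra_simps)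
  then show ?case by (simp add: restrict_def cong: if_cong)
qed

section \<open>The two actions of the center on the diagonal morphisms\<close>

lemma diag_homogeneous_closed: "f \<in> diag_homogeneous B n \<Longrightarrow> f \<in> carrier D"
  by (simp add: diag_homogeneous_def)

lemma diag_homogeneous_apply:
  "\<lbrakk>f \<in> diag_homogeneous B n; x \<in> GObj B; m \<noteq> n\<rbrakk> \<Longrightarrow> f x m = \<zero>\<^bsub>GHom B x x m\<^esub>"
  by (simp add: diag_homogeneous_def)

lemma diag_homogeneous_zero: "\<zero>\<^bsub>D\<^esub> \<in> diag_homogeneous B n"
  by (simp add: diag_homogeneous_def diag_zero_apply)

lemma diag_homogeneous_add:
  "\<lbrakk>f \<in> diag_homogeneous B n; g \<in> diag_homogeneous B n\<rbrakk> \<Longrightarrow> f \<oplus>\<^bsub>D\<^esub> g \<in> diag_homogeneous B n"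
  by (auto simp: diag_homogeneous_def diag_add_apply abelian_monoid.l_zero[OF GHom_monoid])

lemma single_homogeneous: "\<lbrakk>x \<in> GObj B; v \<in> hom x x n\<rbrakk> \<Longrightarrow> single x n v \<in> diag_homogeneous B n"
  by (auto simp: diag_homogeneous_def single_apply)

lemma diag_lact_apply:
  "\<lbrakk>x \<in> GObj B; d = n + m\<rbrakk> \<Longrightarrow> diag_lact B n a f x d = gcomp B x x x n m (a x) (f x m)"
  by (simp add: diag_lact_def)

lemma diag_act_closed:
  assumes "\<And>x. x \<in> GObj B \<Longrightarrow> a x \<in> hom x x n" "f \<in> carrier D"
  shows "diag_lact B n a f \<in> carrier D" "diag_ract B n a f \<in> carrier D"
proof -
  \<comment> \<open>Multiplication by an element of degree n shifts the support by n.\<close>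
  let ?J = "(\<lambda>(x, m). (x, n + m)) ` supp f"
  have J: "finite ?J" using assms(2) by simp
  have z: "f x (d - n) = \<zero>\<^bsub>GHom B x x (d - n)\<^esub>" if "x \<in> GObj B" "(x, d) \<notin> ?J" for x d
  proof (rule ccontr)
    assume "\<not> ?thesis"
    then have "(x, d - n) \<in> supp f" using that by (simp add: supp_def)
    then have "(\<lambda>(x, m). (x, n + m)) (x, d - n) \<in> ?J" by (rule imageI)
    with that show False by simp
  qed
  show "diag_lact B n a f \<in> carrier D"
    by (rule diag_memI[OF _ _ J])
      (use assms z in \<open>auto simp: diag_lact_def intro!: gcomp_closed'\<close>)
  show "diag_ract B n a f \<in> carrier D"
    by (rule diag_memI[OF _ _ J])
      (use assms z in \<open>auto simp: diag_ract_def intro!: gcomp_closed'\<close>)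
qed

lemma diag_lact_linear:
  assumes "a \<in> gcenter_deg B n"
  shows "linear_map K D D (diag_lact B n a)"
proof (intro linear_map.intro linear_map_axioms.intro diag_module)
  note closed = diag_act_closed(1)[OF gcenter_deg_closed[OF assms]]
  show "diag_lact B n a v \<in> carrier D" if "v \<in> carrier D" for v using closed that by blast
  show "diag_lact B n a (v \<oplus>\<^bsub>D\<^esub> w) = diag_lact B n a v \<oplus>\<^bsub>D\<^esub> diag_lact B n a w"
    if "v \<in> carrier D" "w \<in> carrier D" for v w
    using that assms
    by (intro diag_eqI) (auto simp: diag_ext_extensional diag_lact_def diag_add_apply gcomp_add_right)
  show "diag_lact B n a (c \<odot>\<^bsub>D\<^esub> v) = c \<odot>\<^bsub>D\<^esub> diag_lact B n a v"
    if "c \<in> carrier K" "v \<in> carrier D" for v c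
    using that assms
    by (intro diag_eqI) (auto simp: diag_ext_extensional diag_lact_def diag_smult_apply gcomp_smult_right)
qed

lemma diag_ract_linear:
  assumes "a \<in> gcenter_deg B n"
  shows "linear_map K D D (diag_ract B n a)"
proof (intro linear_map.intro linear_map_axioms.intro diag_module)
  note closed = diag_act_closed(2)[OF gcenter_deg_closed[OF assms]]
  show "diag_ract B n a v \<in> carrier D" if "v \<in> carrier D" for v using closed that by blast
  show "diag_ract B n a (v \<oplus>\<^bsub>D\<^esub> w) = diag_ract B n a v \<oplus>\<^bsub>D\<^esub> diag_ract B n a w"
    if "v \<in> carrier D" "w \<in> carrier D" for v w
    using that assms
    by (intro diag_eqI) (auto simp: diag_ext_extensional diag_ract_def diag_add_apply gcomp_add_left)
  show "diag_ract B n a (c \<odot>\<^bsub>D\<^esub> v) = c \<odot>\<^bsub>D\<^esub> diag_ract B n a v"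
    if "c \<in> carrier K" "v \<in> carrier D" for v c
    using that assms
    by (intro diag_eqI) (auto simp: diag_ext_extensional diag_ract_def diag_smult_apply gcomp_smult_left)
qed

lemma diag_lact_single:
  assumes "a \<in> gcenter_deg B n" "x \<in> GObj B" "v \<in> hom x x m" "d = n + m"
  shows "diag_lact B n a (single x m v) = single x d (gcomp B x x x n m (a x) v)"
  using assms
  by (intro diag_eqI[OF _ diag_extensional[OF single_closed]])
    (auto simp: diag_lact_def single_apply gcomp_closed)

lemma diag_lact_homogeneous:
  assumes "a \<in> gcenter_deg B n" "f \<in> diag_homogeneous B m" "d = n + m"
  shows "diag_lact B n a f \<in> diag_homogeneous B d"
  using assms diag_act_closed(1)[OF gcenter_deg_closed[OF assms(1)] diag_homogeneous_closed[OF assms(2)]]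
    diag_homogeneous_apply[OF assms(2)]
  by (auto simp: diag_homogeneous_def diag_lact_def)

text \<open>Centrality of a against an endomorphism of degree m produces the same sign at every
  object; this is why f is homogeneous. Annihilation from the right is thereby reduced to
  annihilation from the left.\<close>

lemma diag_ract_eq:
  assumes a: "a \<in> gcenter_deg B n" and f: "f \<in> diag_homogeneous B m"
  shows "diag_ract B n a f = sgn_mult D (n * m) (diag_lact B n a f)"
proof (rule diag_eqI)
  have l: "diag_lact B n a f \<in> carrier D"
    using diag_act_closed(1)[OF gcenter_deg_closed[OF a] diag_homogeneous_closed[OF f]] .
  then show "sgn_mult D (n * m) (diag_lact B n a f) \<in> extensional (GObj B)"
    by (intro diag_extensional sgn_mult_closed[OF diag_module])
  show "diag_ract B n a f \<in> extensional (GObj B)"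
    by (simp add: diag_ract_def)
  fix x d assume x: "x \<in> GObj B"
  have s: "sgn_mult D (n * m) (diag_lact B n a f) x d = sgn_mult (GHom B x x d) (n * m) (diag_lact B n a f x d)"
    by (rule linear_map.sgn[OF diag_eval_linear[OF x] l])
  show "diag_ract B n a f x d = sgn_mult D (n * m) (diag_lact B n a f) x d"
  proof (cases "d = n + m")
    case True
    then show ?thesis
      unfolding s using gcenter_deg_central[OF a x x diag_apply_closed[OF diag_homogeneous_closed[OF f] x] True] x
      by (simp add: diag_ract_def diag_lact_def)
  next
    case False
    then have "f x (d - n) = \<zero>\<^bsub>GHom B x x (d - n)\<^esub>" using diag_homogeneous_apply[OF f x] by auto
    then show ?thesis
      unfolding s using x a by (simp add: diag_ract_def diag_lact_def sgn_mult_zero[OF GHom_module])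
  qed
qed

text \<open>Moving a past u turns a times the commutator of u and f into the commutator of u and a
  f: the sign (-1)^(n i) of the move and the sign (-1)^(i j) combine to the one for degrees i and n
  + j.\<close>

lemma diag_lact_comm:
  assumes a: "a \<in> gcenter_deg B n" and c: "c \<in> Comm"
  shows "diag_lact B n a c \<in> Comm"
proof -
  interpret lact: linear_map K D D "diag_lact B n a" by (rule diag_lact_linear[OF a])
  have "Comm \<subseteq> {f \<in> carrier D. diag_lact B n a f \<in> Comm}"
  proof (rule comm_least[OF lact.vimage_submodule[OF comm_submodule]])
    fix x y u f i j assume x: "x \<in> GObj B" and y: "y \<in> GObj B" and u: "u \<in> hom x y i" and f: "f \<in> hom y x j"
    let ?k = "i + j" and ?d = "i + (n + j)"
    let ?f = "gcomp B y x x n j (a x) f"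
    let ?v = "gcomp B x y x j i f u" and ?w = "gcomp B y x y i j u f"
    have v: "?v \<in> hom x x ?k" and w: "?w \<in> hom y y ?k" and af: "?f \<in> hom y x (n + j)"
      and ua: "gcomp B x x y i n u (a x) \<in> hom x y (n + i)"
      using x y u f a by (auto intro!: gcomp_closed')
    have s: "sgn_mult (GHom B y y ?k) (i * j) ?w \<in> hom y y ?k" using y w by simp
    have "gcomp B y y y n ?k (a y) ?w = gcomp B y x y (n + i) j (gcomp B x y y n i (a y) u) f"
      using x y u f a by (intro gcomp_assoc'[symmetric]) auto
    also have "\<dots> = sgn_mult (GHom B y y ?d) (n * i) (gcomp B y x y (n + i) j (gcomp B x x y i n u (a x)) f)"
      using x y u f a ua
      by (subst gcenter_deg_central'[OF a x y u refl], intro gcomp_sgn_left) auto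
    also have "gcomp B y x y (n + i) j (gcomp B x x y i n u (a x)) f = gcomp B y x y i (n + j) u ?f"
      using x y u f a by (intro gcomp_assoc') auto
    finally have 1: "gcomp B y y y n ?k (a y) (sgn_mult (GHom B y y ?k) (i * j) ?w) =
        sgn_mult (GHom B y y ?d) (i * (n + j)) (gcomp B y x y i (n + j) u ?f)"
      using x y u af a w
      by (subst gcomp_sgn_right[of ?d])
        (auto simp: sgn_mult_sgn_mult[OF GHom_module] gcomp_closed algebra_simps)
    have 2: "gcomp B x x x n ?k (a x) ?v = gcomp B x y x (n + j) i ?f u"
      using x y u f a by (intro gcomp_assoc'[symmetric]) auto
    have d: "?d = n + ?k" by simp
    have "diag_lact B n a (single x ?k ?v \<ominus>\<^bsub>D\<^esub> single y ?k (sgn_mult (GHom B y y ?k) (i * j) ?w)) \<in> Comm"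
      using comm_generator[OF x y u af] x y v w
      by (simp add: lact.minus diag_lact_single[OF a x v d] diag_lact_single[OF a y s d] 1 2)
    then show "single x ?k ?v \<ominus>\<^bsub>D\<^esub> single y ?k (sgn_mult (GHom B y y ?k) (i * j) ?w) \<in>
        {f \<in> carrier D. diag_lact B n a f \<in> Comm}"
      using x y v w by auto
  qed
  with c show ?thesis by blast
qed

lemma sgn_mult_comm: "c \<in> Comm \<Longrightarrow> sgn_mult D e c \<in> Comm"
  by (simp add: sgn_mult_def comm_neg)

lemma sgn_mult_comm_iff: "c \<in> carrier D \<Longrightarrow> sgn_mult D e c \<in> Comm \<longleftrightarrow> c \<in> Comm"
  using comm_neg[of "\<ominus>\<^bsub>D\<^esub> c"] by (auto simp: sgn_mult_def comm_neg D.M.minus_minus)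

text \<open>Generating commutators are homogeneous of degree i + j, and there the right action
  agrees with the left one up to sign.\<close>

lemma diag_ract_comm:
  assumes a: "a \<in> gcenter_deg B n" and c: "c \<in> Comm"
  shows "diag_ract B n a c \<in> Comm"
proof -
  interpret ract: linear_map K D D "diag_ract B n a" by (rule diag_ract_linear[OF a])
  have "Comm \<subseteq> {f \<in> carrier D. diag_ract B n a f \<in> Comm}"
  proof (rule comm_least[OF ract.vimage_submodule[OF comm_submodule]])
    fix x y u f i j assume *: "x \<in> GObj B" "y \<in> GObj B" "u \<in> hom x y i" "f \<in> hom y x j"
    let ?c = "single x (i + j) (gcomp B x y x j i f u) \<ominus>\<^bsub>D\<^esub>
      single y (i + j) (sgn_mult (GHom B y y (i + j)) (i * j) (gcomp B y x y i j u f))"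
    have v: "gcomp B x y x j i f u \<in> hom x x (i + j)" and w: "gcomp B y x y i j u f \<in> hom y y (i + j)"
      using * by (auto intro!: gcomp_closed')
    have "?c = single x (i + j) (gcomp B x y x j i f u) \<oplus>\<^bsub>D\<^esub>
      single y (i + j) (\<ominus>\<^bsub>GHom B y y (i + j)\<^esub> sgn_mult (GHom B y y (i + j)) (i * j) (gcomp B y x y i j u f))"
      using * w by (simp add: a_minus_def linear_map.neg[OF single_linear])
    then have c: "?c \<in> diag_homogeneous B (i + j)"
      using * v w by (simp add: diag_homogeneous_add single_homogeneous)
    with comm_generator[OF *] show "?c \<in> {f \<in> carrier D. diag_ract B n a f \<in> Comm}"
      by (simp add: diag_ract_eq[OF a c] sgn_mult_comm diag_lact_comm[OF a] comm_closed)
  qed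
  with c show ?thesis by blast
qed

lemma diag_lact_mult:
  assumes "a \<in> gcenter_deg B m" "b \<in> gcenter_deg B n" "f \<in> carrier D" "d = m + n"
  shows "diag_lact B d (\<lambda>x\<in>GObj B. gcomp B x x x m n (a x) (b x)) f = diag_lact B m a (diag_lact B n b f)"
  using assms
  by (intro diag_eqI) (auto simp: diag_lact_def diff_diff_eq intro!: gcomp_assoc')

text \<open>Raising \<open>a v\<close> to a power permutes the factors, so only a sign depending on the degrees appears.\<close>

lemma gpow_gcenter_mult:
  assumes a: "a \<in> gcenter_deg B n"
  shows "\<exists>e. \<forall>x\<in>GObj B. \<forall>v\<in>hom x x m. gpow B x (n + m) (gcomp B x x x n m (a x) v) k =
    sgn_mult (GHom B x x (int k * (n + m))) e
      (gcomp B x x x (int k * n) (int k * m) (gpow B x n (a x) k) (gpow B x m v k))"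
proof (induction k)
  case 0
  show ?case
    by (intro exI[of _ 0] ballI) (simp add: sgn_mult_def gcomp_ident_left gident_closed)
next
  case (Suc k)
  then obtain e where e: "\<And>x v. \<lbrakk>x \<in> GObj B; v \<in> hom x x m\<rbrakk> \<Longrightarrow>
    gpow B x (n + m) (gcomp B x x x n m (a x) v) k =
    sgn_mult (GHom B x x (int k * (n + m))) e
      (gcomp B x x x (int k * n) (int k * m) (gpow B x n (a x) k) (gpow B x m v k))" by blast
  show ?case
  \<comment> \<open>The new factor v has to pass a^k, which is central of degree k n; this adds k n
    m to the sign exponent. The exponent must not depend on x or v, so it is fixed before they
    are.\<close>
  proof (intro exI[of _ "e + int k * n * m"] ballI)
    fix x v assume x: "x \<in> GObj B" and v: "v \<in> hom x x m"
    let ?D = "int (Suc k) * (n + m)" and ?kn = "int k * n" and ?km = "int k * m"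
    let ?A = "gpow B x n (a x) k" and ?V = "gpow B x m v k"
    let ?av = "gcomp B x x x n m (a x) v"
    have ax: "a x \<in> hom x x n" using a x by simp
    have A: "?A \<in> hom x x ?kn" and V: "?V \<in> hom x x ?km" using x v ax by (auto intro: gpow_closed)
    have AV: "gcomp B x x x ?kn ?km ?A ?V \<in> hom x x (int k * (n + m))"
      using x A V by (intro gcomp_closed') (auto simp: algebra_simps)
    have av: "?av \<in> hom x x (n + m)" using x ax v by (intro gcomp_closed)
    have pw: "(\<lambda>x\<in>GObj B. gpow B x n (a x) k) \<in> gcenter_deg B ?kn"
      using a by (intro gcenter_deg_pow) auto
    have vA: "gcomp B x x x m ?kn v ?A = sgn_mult (GHom B x x (?kn + m)) (?kn * m) (gcomp B x x x ?kn m ?A v)"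
      using gcenter_deg_central[OF pw x x v refl] x by simp
    have "gpow B x (n + m) ?av (Suc k) = sgn_mult (GHom B x x ?D) e
        (gcomp B x x x (n + m) (int k * (n + m)) ?av (gcomp B x x x ?kn ?km ?A ?V))"
      unfolding gpow.simps e[OF x v] using x av AV
      by (intro gcomp_sgn_right) (auto simp: algebra_simps)
    also have "gcomp B x x x (n + m) (int k * (n + m)) ?av (gcomp B x x x ?kn ?km ?A ?V) =
        gcomp B x x x n (m + int k * (n + m)) (a x) (gcomp B x x x m (int k * (n + m)) v (gcomp B x x x ?kn ?km ?A ?V))"
      using x ax v AV by (intro gcomp_assoc') auto
    also have "gcomp B x x x m (int k * (n + m)) v (gcomp B x x x ?kn ?km ?A ?V) =
        gcomp B x x x (?kn + m) ?km (gcomp B x x x m ?kn v ?A) ?V"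
      using x v A V by (intro gcomp_assoc'[symmetric]) (auto simp: algebra_simps)
    also have "\<dots> = sgn_mult (GHom B x x (m + int k * (n + m))) (?kn * m) (gcomp B x x x (?kn + m) ?km (gcomp B x x x ?kn m ?A v) ?V)"
      unfolding vA using x v A V by (intro gcomp_sgn_left) (auto simp: algebra_simps intro: gcomp_closed')
    also have "gcomp B x x x (?kn + m) ?km (gcomp B x x x ?kn m ?A v) ?V =
        gcomp B x x x ?kn (m + ?km) ?A (gcomp B x x x m ?km v ?V)"
      using x v A V by (intro gcomp_assoc') auto
    also have "gcomp B x x x n (m + int k * (n + m)) (a x)
          (sgn_mult (GHom B x x (m + int k * (n + m))) (?kn * m) (gcomp B x x x ?kn (m + ?km) ?A (gcomp B x x x m ?km v ?V))) =
        sgn_mult (GHom B x x ?D) (?kn * m)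
          (gcomp B x x x n (m + int k * (n + m)) (a x) (gcomp B x x x ?kn (m + ?km) ?A (gcomp B x x x m ?km v ?V)))"
      using x ax v A V by (intro gcomp_sgn_right) (auto simp: algebra_simps intro!: gcomp_closed')
    also have "gcomp B x x x n (m + int k * (n + m)) (a x) (gcomp B x x x ?kn (m + ?km) ?A (gcomp B x x x m ?km v ?V)) =
        gcomp B x x x (int (Suc k) * n) (m + ?km) (gcomp B x x x n ?kn (a x) ?A) (gcomp B x x x m ?km v ?V)"
      using x ax v A V by (intro gcomp_assoc'[symmetric]) (auto simp: algebra_simps intro!: gcomp_closed')
    also have "\<dots> = gcomp B x x x (int (Suc k) * n) (int (Suc k) * m) (gpow B x n (a x) (Suc k)) (gpow B x m v (Suc k))"
      by (simp add: algebra_simps)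
    also have "sgn_mult (GHom B x x ?D) e (sgn_mult (GHom B x x ?D) (?kn * m) \<dots>) = sgn_mult (GHom B x x ?D) (e + ?kn * m) \<dots>"
      using x ax v
      by (intro sgn_mult_sgn_mult[OF GHom_module[OF x x]] gcomp_closed' gpow_closed) (auto simp: algebra_simps)
    finally show "gpow B x (n + m) ?av (Suc k) = sgn_mult (GHom B x x ?D) (e + ?kn * m)
      (gcomp B x x x (int (Suc k) * n) (int (Suc k) * m) (gpow B x n (a x) (Suc k)) (gpow B x m v (Suc k)))" .
  qed
qed

section \<open>Cosets and induced maps on the cocenter\<close>

lemma coset_mem_iff: "f \<in> carrier D \<Longrightarrow> g \<in> Comm +>\<^bsub>D\<^esub> f \<longleftrightarrow> g \<asymp> f"
proof -
  assume f: "f \<in> carrier D"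
  interpret abelian_subgroup Comm D
    by (rule abelian_subgroupI3)
      (auto intro!: additive_subgroup.intro D.abelian_group_axioms submodule.axioms(1)[OF comm_submodule])
  show ?thesis
    using a_rcos_module[OF f, of g] a_elemrcos_carrier[OF f, of g] f
    by (auto simp: cong_comm_def a_minus_def)
qed

lemma coset_zero: "cocenter_zero K B = Comm +>\<^bsub>D\<^esub> \<zero>\<^bsub>D\<^esub>"
  by (simp add: cocenter_zero_def)

lemma coset_eq_zero_iff: "f \<in> carrier D \<Longrightarrow> Comm +>\<^bsub>D\<^esub> f = cocenter_zero K B \<longleftrightarrow> f \<in> Comm"
  by (simp add: coset_zero comm_coset_eq_iff cong_zero_iff)

text \<open>Once h respects the congruence, the union defining \<open>cocenter_map\<close> runs over
  equal cosets.\<close>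

lemma cocenter_map_coset:
  assumes f: "f \<in> carrier D" and h: "\<And>g. g \<asymp> f \<Longrightarrow> h g \<asymp> h f"
  shows "cocenter_map K B h (Comm +>\<^bsub>D\<^esub> f) = Comm +>\<^bsub>D\<^esub> h f"
proof -
  have "Comm +>\<^bsub>D\<^esub> h g = Comm +>\<^bsub>D\<^esub> h f" if "g \<in> Comm +>\<^bsub>D\<^esub> f" for g
    using that h[of g] coset_mem_iff[OF f] comm_coset_eq_iff cong_closed by metis
  moreover have "f \<in> Comm +>\<^bsub>D\<^esub> f" using f coset_mem_iff by blast
  ultimately show ?thesis unfolding cocenter_map_def by blast
qed

end

section \<open>The ideals \<open>K\<^sub>r\<close>\<close>

context graded_category_char
begin

abbreviation xi_rep :: "('o \<Rightarrow> int \<Rightarrow> 'm) \<Rightarrow> 'o \<Rightarrow> int \<Rightarrow> 'm" where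
  "xi_rep \<equiv> diag_xi B p"

lemma xi_rep_mult: "x \<in> GObj B \<Longrightarrow> xi_rep f x (int p * n) = gpow B x n (f x n) p"
  using p_pos by (simp add: diag_xi_def)

lemma xi_rep_not_dvd: "\<lbrakk>x \<in> GObj B; \<not> int p dvd m\<rbrakk> \<Longrightarrow> xi_rep f x m = \<zero>\<^bsub>GHom B x x m\<^esub>"
  by (simp add: diag_xi_def)

lemma xi_rep_extensional [simp]: "xi_rep f \<in> extensional (GObj B)"
  by (simp add: diag_xi_def)

lemma xi_rep_zero_coord:
  assumes "x \<in> GObj B" "\<And>n. m = int p * n \<Longrightarrow> f x n = \<zero>\<^bsub>GHom B x x n\<^esub>"
  shows "xi_rep f x m = \<zero>\<^bsub>GHom B x x m\<^esub>"
proof (cases "int p dvd m")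
  case True
  then obtain n where m: "m = int p * n" by (elim dvdE)
  with assms p_pos show ?thesis unfolding m by (subst xi_rep_mult) (auto intro: gpow_zero)
qed (use assms xi_rep_not_dvd in blast)

lemma xi_rep_closed [simp]:
  assumes "f \<in> carrier D"
  shows "xi_rep f \<in> carrier D"
proof (rule diag_memI[where J = "(\<lambda>(x, n). (x, int p * n)) ` supp f"])
  fix x m assume x: "x \<in> GObj B"
  show "xi_rep f x m \<in> hom x x m"
  proof (cases "int p dvd m")
    case True
    then obtain n where m: "m = int p * n" by (elim dvdE)
    with x assms show ?thesis unfolding m by (subst xi_rep_mult) (auto intro: gpow_closed)
  qed (use x xi_rep_not_dvd in simp)
  assume m: "(x, m) \<notin> (\<lambda>(x, n). (x, int p * n)) ` supp f"
  show "xi_rep f x m = \<zero>\<^bsub>GHom B x x m\<^esub>"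
  proof (rule xi_rep_zero_coord[OF x], rule ccontr)
    fix n assume "m = int p * n" "f x n \<noteq> \<zero>\<^bsub>GHom B x x n\<^esub>"
    with x have "(\<lambda>(x, n). (x, int p * n)) (x, n) \<in> (\<lambda>(x, n). (x, int p * n)) ` supp f"
      by (intro imageI) (simp add: supp_def)
    with m \<open>m = int p * n\<close> show False by simp
  qed
qed (use assms in simp_all)

lemma xi_rep_eqI:
  assumes "f \<in> carrier D" "g \<in> carrier D"
    and "\<And>x n. x \<in> GObj B \<Longrightarrow> gpow B x n (f x n) p = g x (int p * n)"
    and "\<And>x m. \<lbrakk>x \<in> GObj B; \<not> int p dvd m\<rbrakk> \<Longrightarrow> g x m = \<zero>\<^bsub>GHom B x x m\<^esub>"
  shows "xi_rep f = g"
proof (rule diag_eqI)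
  fix x m assume x: "x \<in> GObj B"
  show "xi_rep f x m = g x m"
  proof (cases "int p dvd m")
    case True
    then obtain n where m: "m = int p * n" by (elim dvdE)
    with x assms show ?thesis unfolding m by (subst xi_rep_mult) auto
  qed (use x assms xi_rep_not_dvd in simp)
qed (use assms diag_extensional in auto)

lemma xi_rep_zero: "xi_rep \<zero>\<^bsub>D\<^esub> = \<zero>\<^bsub>D\<^esub>"
  using p_pos by (intro xi_rep_eqI) (auto simp: diag_zero_apply gpow_zero)

lemma xi_rep_single:
  assumes "x \<in> GObj B" "v \<in> hom x x n" "d = int p * n"
  shows "xi_rep (single x n v) = single x d (gpow B x n v p)"
  using assms p_pos
  by (intro xi_rep_eqI single_closed gpow_closed) (auto simp: single_apply gpow_zero)

lemma xi_rep_smult: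
  assumes "c \<in> carrier K" "f \<in> carrier D"
  shows "xi_rep (c \<odot>\<^bsub>D\<^esub> f) = (c [^]\<^bsub>K\<^esub> p) \<odot>\<^bsub>D\<^esub> xi_rep f"
  using assms
  by (intro xi_rep_eqI)
    (auto simp: diag_smult_apply gpow_smult xi_rep_mult xi_rep_not_dvd module.smult_r_null[OF GHom_module])

lemma xi_rep_neg:
  assumes "f \<in> carrier D"
  shows "xi_rep (\<ominus>\<^bsub>D\<^esub> f) = \<ominus>\<^bsub>D\<^esub> xi_rep f"
  using xi_rep_smult[OF _ assms, of "\<ominus>\<^bsub>K\<^esub> \<one>\<^bsub>K\<^esub>"] assms
  by (simp add: neg_one_pow_char D.smult_l_minus)

text \<open>Only one coordinate of xi changes, from u^p to (u + v)^p. The correction w = (u + v)^p -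
  u^p is congruent to v^p by \<open>gpow_char_add\<close>.\<close>

lemma xi_rep_add_single:
  assumes f: "f \<in> carrier D" and x: "x \<in> GObj B" and v: "v \<in> hom x x n"
  shows "xi_rep (f \<oplus>\<^bsub>D\<^esub> single x n v) \<asymp> xi_rep f \<oplus>\<^bsub>D\<^esub> xi_rep (single x n v)"
proof -
  let ?d = "int p * n" and ?u = "f x n"
  interpret M: module K "GHom B x x ?d" using x by (intro GHom_module)
  have u: "?u \<in> hom x x n" using f x by simp
  have uv: "?u \<oplus>\<^bsub>GHom B x x n\<^esub> v \<in> hom x x n" using x u v by simp
  have c: "gpow B x n ?u p \<in> hom x x ?d" "gpow B x n v p \<in> hom x x ?d"
    "gpow B x n (?u \<oplus>\<^bsub>GHom B x x n\<^esub> v) p \<in> hom x x ?d"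
    using x u v uv by (auto intro: gpow_closed)
  define w where "w = gpow B x n (?u \<oplus>\<^bsub>GHom B x x n\<^esub> v) p \<ominus>\<^bsub>GHom B x x ?d\<^esub> gpow B x n ?u p"
  have w: "w \<in> hom x x ?d" using c by (simp add: w_def)
  have uw: "gpow B x n ?u p \<oplus>\<^bsub>GHom B x x ?d\<^esub> w = gpow B x n (?u \<oplus>\<^bsub>GHom B x x n\<^esub> v) p"
    using c M.M.a_lcomm[OF c(1,3) M.M.a_inv_closed[OF c(1)]] by (simp add: w_def a_minus_def M.M.r_neg)
  have eq: "xi_rep (f \<oplus>\<^bsub>D\<^esub> single x n v) = xi_rep f \<oplus>\<^bsub>D\<^esub> single x ?d w"
    using f x v w p_pos uw
    by (intro xi_rep_eqI)
      (auto simp: diag_add_apply single_apply xi_rep_mult xi_rep_not_dvd abelian_monoid.r_zero[OF GHom_monoid]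
        gpow_closed)
  have "single x ?d w = single x ?d (gpow B x n (?u \<oplus>\<^bsub>GHom B x x n\<^esub> v) p) \<ominus>\<^bsub>D\<^esub> single x ?d (gpow B x n ?u p)"
    unfolding w_def by (rule linear_map.minus[OF single_linear[OF x] c(3,1)])
  also have "\<dots> \<asymp> (single x ?d (gpow B x n ?u p) \<oplus>\<^bsub>D\<^esub> single x ?d (gpow B x n v p)) \<ominus>\<^bsub>D\<^esub> single x ?d (gpow B x n ?u p)"
    unfolding a_minus_def using c x by (intro cong_add gpow_char_add x u v refl cong_refl) simp
  also have "\<dots> = single x ?d (gpow B x n v p)"
    using c x by (simp add: a_minus_def D.M.a_ac D.M.r_neg)
  finally have "single x ?d w \<asymp> xi_rep (single x n v)"
    using xi_rep_single[OF x v refl] by simp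
  then show ?thesis unfolding eq using f by (intro cong_add cong_refl) auto
qed

text \<open>Both elements may have nonzero components in the same coordinate, where additivity holds
  only modulo commutators; the second element is therefore added one coordinate at a time.\<close>

lemma xi_rep_add:
  assumes f: "f \<in> carrier D" and g: "g \<in> carrier D"
  shows "xi_rep (f \<oplus>\<^bsub>D\<^esub> g) \<asymp> xi_rep f \<oplus>\<^bsub>D\<^esub> xi_rep g"
  using g
proof (induction rule: diag_induct)
  case zero
  then show ?case using f by (simp add: xi_rep_zero cong_refl)
next
  case (single g x n v)
  let ?s = "single x n v"
  have s: "?s \<in> carrier D" using single by simp
  have "xi_rep (f \<oplus>\<^bsub>D\<^esub> (g \<oplus>\<^bsub>D\<^esub> ?s)) = xi_rep ((f \<oplus>\<^bsub>D\<^esub> g) \<oplus>\<^bsub>D\<^esub> ?s)"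
    using f single s by (simp add: D.M.a_assoc)
  also have "\<dots> \<asymp> xi_rep (f \<oplus>\<^bsub>D\<^esub> g) \<oplus>\<^bsub>D\<^esub> xi_rep ?s"
    using f single by (intro xi_rep_add_single) auto
  also have "\<dots> \<asymp> (xi_rep f \<oplus>\<^bsub>D\<^esub> xi_rep g) \<oplus>\<^bsub>D\<^esub> xi_rep ?s"
    using single s by (intro cong_add cong_refl) auto
  also have "\<dots> = xi_rep f \<oplus>\<^bsub>D\<^esub> (xi_rep g \<oplus>\<^bsub>D\<^esub> xi_rep ?s)"
    using f single s by (simp add: D.M.a_assoc)
  also have "\<dots> \<asymp> xi_rep f \<oplus>\<^bsub>D\<^esub> xi_rep (g \<oplus>\<^bsub>D\<^esub> ?s)"
    using f single by (intro cong_add cong_refl cong_sym[OF xi_rep_add_single]) auto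
  finally show ?case .
qed

lemma gpow_sgn:
  assumes "x \<in> GObj B" "v \<in> hom x x n" "d = int p * n"
  shows "gpow B x n (sgn_mult (GHom B x x n) e v) p = sgn_mult (GHom B x x d) e (gpow B x n v p)"
proof -
  have "gpow B x n (\<ominus>\<^bsub>GHom B x x n\<^esub> v) p = \<ominus>\<^bsub>GHom B x x d\<^esub> gpow B x n v p"
    using assms gpow_smult[OF assms(1,2), of "\<ominus>\<^bsub>K\<^esub> \<one>\<^bsub>K\<^esub>" d p] gpow_closed[OF assms]
    by (simp add: neg_one_pow_char module.smult_l_minus[OF GHom_module] module.smult_one[OF GHom_module])
  then show ?thesis by (simp add: sgn_mult_def)
qed

text \<open>With p = q + 1 and t = (u f)^q u one has (f u)^p = f t and t f = (u f)^p, so the trace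
  property for t and f applies. Its sign exponent (q (i + j) + i) j differs from i j by a multiple
  of p - 1.\<close>

lemma xi_rep_generator:
  assumes x: "x \<in> GObj B" and y: "y \<in> GObj B" and u: "u \<in> hom x y i" and f: "f \<in> hom y x j"
  shows "single x (int p * (i + j)) (gpow B x (i + j) (gcomp B x y x j i f u) p) \<asymp>
    single y (int p * (i + j)) (gpow B y (i + j) (sgn_mult (GHom B y y (i + j)) (i * j) (gcomp B y x y i j u f)) p)"
proof -
  let ?k = "i + j" and ?d = "int p * (i + j)"
  let ?w = "gcomp B y x y i j u f"
  obtain q where q: "p = Suc q" using p_pos by (cases p) auto
  let ?P = "gpow B y ?k ?w q"
  let ?t = "gcomp B x y y (int q * ?k) i ?P u"
  have w: "?w \<in> hom y y ?k" using x y u f by (intro gcomp_closed)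
  have P: "?P \<in> hom y y (int q * ?k)" using y w by (auto intro: gpow_closed)
  have t: "?t \<in> hom x y (int q * ?k + i)" using x y P u by (intro gcomp_closed)
  have d: "?d = int q * ?k + i + j" by (simp add: q algebra_simps)
  have wp: "gpow B y ?k ?w p \<in> hom y y ?d" using y w by (auto intro: gpow_closed)
  have 1: "gpow B x ?k (gcomp B x y x j i f u) p = gcomp B x y x j (int q * ?k + i) f ?t"
    using gpow_gcomp[OF x y u f, of q] by (simp add: q add.commute[of j i])
  have "gcomp B y x y (int q * ?k + i) j ?t f = gcomp B y y y (int q * ?k) ?k ?P ?w"
    using x y u f P by (intro gcomp_assoc') auto
  also have "\<dots> = gpow B y ?k ?w p"
    unfolding q using y w by (intro gpow_Suc_right[symmetric]) auto
  finally have 2: "gcomp B y x y (int q * ?k + i) j ?t f = gpow B y ?k ?w p" .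
  have "p = 2 \<or> even ((int q * ?k + i) * j - i * j)"
    using even_char_pred by (auto simp: q algebra_simps)
  then have "sgn_mult (GHom B y y ?d) ((int q * ?k + i) * j) (gpow B y ?k ?w p) =
      sgn_mult (GHom B y y ?d) (i * j) (gpow B y ?k ?w p)"
    using GHom_module[OF y y] wp by (rule sgn_mult_cong)
  then show ?thesis
    using cong_comm_generator[OF x y t f d] unfolding 1 2 gpow_sgn[OF y w refl] by simp
qed

text \<open>Modulo [B,B], xi is additive and turns a scalar c into c^p, so the elements that it
  sends into [B,B] form a submodule. The generators belong to it by
  \<open>xi_rep_generator\<close>.\<close>

lemma xi_rep_comm:
  assumes "c \<in> Comm"
  shows "xi_rep c \<in> Comm"
proof -
  let ?N = "{f \<in> carrier D. xi_rep f \<in> Comm}"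
  have "submodule ?N K D"
  proof (rule D.submoduleI)
    fix f g assume "f \<in> ?N" "g \<in> ?N"
    then show "f \<oplus>\<^bsub>D\<^esub> g \<in> ?N"
      using cong_comm_iff[OF xi_rep_add[of f g]] comm_add by auto
  qed (auto simp: xi_rep_zero xi_rep_neg comm_neg xi_rep_smult comm_smult)
  then have "Comm \<subseteq> ?N"
  proof (rule comm_least)
    fix x y u f i j assume x: "x \<in> GObj B" and y: "y \<in> GObj B" and u: "u \<in> hom x y i" and f: "f \<in> hom y x j"
    let ?v = "gcomp B x y x j i f u" and ?w = "sgn_mult (GHom B y y (i + j)) (i * j) (gcomp B y x y i j u f)"
    have v: "?v \<in> hom x x (i + j)" and w: "?w \<in> hom y y (i + j)"
      using x y u f by (auto intro!: hom_sgn gcomp_closed')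
    let ?a = "single x (i + j) ?v" and ?b = "single y (i + j) ?w"
    have ab: "?a \<in> carrier D" "?b \<in> carrier D" using x y v w by auto
    have "xi_rep (?a \<ominus>\<^bsub>D\<^esub> ?b) \<asymp> xi_rep ?a \<oplus>\<^bsub>D\<^esub> xi_rep (\<ominus>\<^bsub>D\<^esub> ?b)"
      unfolding a_minus_def using ab by (intro xi_rep_add) auto
    also have "\<dots> = xi_rep ?a \<ominus>\<^bsub>D\<^esub> xi_rep ?b"
      using ab by (simp add: xi_rep_neg a_minus_def)
    finally have "xi_rep (?a \<ominus>\<^bsub>D\<^esub> ?b) \<asymp> xi_rep ?a \<ominus>\<^bsub>D\<^esub> xi_rep ?b" .
    moreover have "xi_rep ?a \<ominus>\<^bsub>D\<^esub> xi_rep ?b \<in> Comm"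
      using xi_rep_generator[OF x y u f]
      unfolding cong_comm_def xi_rep_single[OF x v refl] xi_rep_single[OF y w refl] by blast
    ultimately show "?a \<ominus>\<^bsub>D\<^esub> ?b \<in> ?N"
      using ab cong_comm_iff by auto
  qed
  with assms show ?thesis by blast
qed

text \<open>Well-definedness of xi on the cocenter: additivity is applied to f = g + (f -
  g).\<close>

lemma xi_rep_cong:
  assumes "f \<asymp> g"
  shows "xi_rep f \<asymp> xi_rep g"
proof -
  have fg: "f \<in> carrier D" "g \<in> carrier D" "f \<ominus>\<^bsub>D\<^esub> g \<in> Comm" using assms by (auto simp: cong_comm_def)
  have "f = g \<oplus>\<^bsub>D\<^esub> (f \<ominus>\<^bsub>D\<^esub> g)" using fg by (simp add: a_minus_def D.M.a_lcomm D.M.r_neg)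
  then have "xi_rep f \<asymp> xi_rep g \<oplus>\<^bsub>D\<^esub> xi_rep (f \<ominus>\<^bsub>D\<^esub> g)"
    using xi_rep_add[of g "f \<ominus>\<^bsub>D\<^esub> g"] fg by simp
  also have "\<dots> \<asymp> xi_rep g \<oplus>\<^bsub>D\<^esub> \<zero>\<^bsub>D\<^esub>"
    using xi_rep_comm[OF fg(3)] fg by (intro cong_add cong_refl) (auto simp: cong_zero_iff)
  finally show ?thesis using fg by simp
qed

section \<open>Iterates of xi, and annihilators of their kernels\<close>

lemma xi_rep_pow_closed [simp]: "f \<in> carrier D \<Longrightarrow> (xi_rep ^^ r) f \<in> carrier D"
  by (induction r) auto

lemma xi_pow_coset:
  "f \<in> carrier D \<Longrightarrow> (xi K B p ^^ r) (Comm +>\<^bsub>D\<^esub> f) = Comm +>\<^bsub>D\<^esub> (xi_rep ^^ r) f"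
  by (induction r) (auto simp: xi_def cocenter_map_coset xi_rep_cong)

lemma xi_rep_homogeneous:
  assumes "f \<in> diag_homogeneous B n" "d = int p * n"
  shows "xi_rep f \<in> diag_homogeneous B d"
proof -
  have "xi_rep f x m = \<zero>\<^bsub>GHom B x x m\<^esub>" if "x \<in> GObj B" "m \<noteq> d" for x m
    using that diag_homogeneous_apply[OF assms(1)] assms(2) by (intro xi_rep_zero_coord) auto
  then show ?thesis
    using diag_homogeneous_closed[OF assms(1)] by (simp add: diag_homogeneous_def)
qed

text \<open>The new central element is a^p up to a sign. Homogeneity of f makes this sign the same
  at all objects, so that it can be absorbed.\<close>

lemma xi_rep_lact:
  assumes a: "a \<in> gcenter_deg B n" and f: "f \<in> diag_homogeneous B m"
  shows "\<exists>b\<in>gcenter_deg B (int p * n). xi_rep (diag_lact B n a f) = diag_lact B (int p * n) b (xi_rep f)"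
proof -
  let ?pn = "int p * n"
  obtain e where e: "\<And>x v. \<lbrakk>x \<in> GObj B; v \<in> hom x x m\<rbrakk> \<Longrightarrow>
    gpow B x (n + m) (gcomp B x x x n m (a x) v) p =
    sgn_mult (GHom B x x (int p * (n + m))) e (gcomp B x x x ?pn (int p * m) (gpow B x n (a x) p) (gpow B x m v p))"
    using gpow_gcenter_mult[OF a, of m p] by blast
  define b where "b = (\<lambda>x\<in>GObj B. sgn_mult (GHom B x x ?pn) e ((\<lambda>x\<in>GObj B. gpow B x n (a x) p) x))"
  have b: "b \<in> gcenter_deg B ?pn"
    unfolding b_def using a by (intro gcenter_deg_sgn gcenter_deg_pow) auto
  have fD: "f \<in> carrier D" using f by (rule diag_homogeneous_closed)
  have af: "diag_lact B n a f \<in> diag_homogeneous B (n + m)" using a f by (intro diag_lact_homogeneous) auto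
  have "xi_rep (diag_lact B n a f) = diag_lact B ?pn b (xi_rep f)"
  proof (rule diag_eqI)
    fix x d assume x: "x \<in> GObj B"
    have h: "xi_rep (diag_lact B n a f) \<in> diag_homogeneous B (int p * (n + m))"
      "diag_lact B ?pn b (xi_rep f) \<in> diag_homogeneous B (int p * (n + m))"
      using xi_rep_homogeneous[OF af refl] diag_lact_homogeneous[OF b xi_rep_homogeneous[OF f refl]]
      by (simp_all add: algebra_simps)
    show "xi_rep (diag_lact B n a f) x d = diag_lact B ?pn b (xi_rep f) x d"
    proof (cases "d = int p * (n + m)")
      case True
      have v: "f x m \<in> hom x x m" using fD x by simp
      have ax: "a x \<in> hom x x n" using a x by simp
      have "xi_rep (diag_lact B n a f) x d = sgn_mult (GHom B x x d) e
          (gcomp B x x x ?pn (int p * m) (gpow B x n (a x) p) (gpow B x m (f x m) p))"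
        unfolding True using x by (simp add: xi_rep_mult diag_lact_apply[OF x refl] e[OF x v])
      also have "\<dots> = gcomp B x x x ?pn (int p * m) (b x) (gpow B x m (f x m) p)"
        using x v ax True by (simp add: b_def) (intro gcomp_sgn_left[symmetric] gpow_closed, auto simp: algebra_simps)
      also have "\<dots> = diag_lact B ?pn b (xi_rep f) x d"
        using x True diag_lact_apply[of x d ?pn "int p * m" b "xi_rep f"]
        by (simp add: xi_rep_mult distrib_left)
      finally show ?thesis .
    qed (simp add: diag_homogeneous_apply[OF h(1) x] diag_homogeneous_apply[OF h(2) x])
  qed (auto simp: diag_lact_def)
  with b show ?thesis by blast
qed

text \<open>This says that the center preserves T_r. Each application of xi replaces a by another
  central element, of degree p n, and f by an element of degree p m; hence the generalization over
  all four.\<close>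

lemma xi_rep_pow_lact:
  "\<lbrakk>a \<in> gcenter_deg B n; f \<in> diag_homogeneous B m; (xi_rep ^^ r) f \<in> Comm\<rbrakk> \<Longrightarrow> (xi_rep ^^ r) (diag_lact B n a f) \<in> Comm"
proof (induction r arbitrary: a n f m)
  case 0
  then show ?case by (simp add: diag_lact_comm)
next
  case (Suc r)
  obtain b where "b \<in> gcenter_deg B (int p * n)" "xi_rep (diag_lact B n a f) = diag_lact B (int p * n) b (xi_rep f)"
    using xi_rep_lact[OF Suc.prems(1,2)] by blast
  with Suc.IH[of b _ "xi_rep f"] Suc.prems xi_rep_homogeneous[OF Suc.prems(2) refl] show ?case
    by (simp add: funpow_swap1)
qed

text \<open>Passage from cosets to representatives. Every coset in degree s - n has a homogeneous
  representative, on which the right action is the left one up to sign, so a single condition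
  remains.\<close>

lemma K_deg_iff:
  "a \<in> K_deg K B p r s n \<longleftrightarrow> a \<in> gcenter_deg B n \<and>
    (\<forall>f\<in>diag_homogeneous B (s - n). (xi_rep ^^ r) f \<in> Comm \<longrightarrow> diag_lact B n a f \<in> Comm)"
proof (cases "a \<in> gcenter_deg B n")
  case a: True
  have coset: "Comm +>\<^bsub>D\<^esub> f \<in> T_ker K B p r \<longleftrightarrow> (xi_rep ^^ r) f \<in> Comm" if "f \<in> carrier D" for f
    using that by (auto simp: T_ker_def xi_pow_coset coset_eq_zero_iff cocenter_def
        intro: D.M.a_rcosetsI[OF D.submoduleE(1)[OF comm_submodule]])
  have lact: "cocenter_map K B (diag_lact B n a) (Comm +>\<^bsub>D\<^esub> f) = cocenter_zero K B \<longleftrightarrow> diag_lact B n a f \<in> Comm"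
    if "f \<in> carrier D" for f
    using that diag_act_closed(1)[OF gcenter_deg_closed[OF a] that]
    by (simp add: cocenter_map_coset cong_linear[OF diag_lact_linear[OF a]] diag_lact_comm[OF a] coset_eq_zero_iff)
  have ract: "cocenter_map K B (diag_ract B n a) (Comm +>\<^bsub>D\<^esub> f) = cocenter_zero K B \<longleftrightarrow> diag_lact B n a f \<in> Comm"
    if f: "f \<in> diag_homogeneous B (s - n)" for f
    using diag_act_closed[OF gcenter_deg_closed[OF a] diag_homogeneous_closed[OF f]] diag_homogeneous_closed[OF f]
    by (simp add: cocenter_map_coset cong_linear[OF diag_ract_linear[OF a]] diag_ract_comm[OF a] coset_eq_zero_iff)
      (simp add: diag_ract_eq[OF a f] sgn_mult_comm_iff)
  show ?thesis
  proof -
    have "(\<forall>C\<in>T_ker K B p r \<inter> cocenter_deg K B (s - n). Q C) \<longleftrightarrow>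
        (\<forall>f\<in>diag_homogeneous B (s - n). (xi_rep ^^ r) f \<in> Comm \<longrightarrow> Q (Comm +>\<^bsub>D\<^esub> f))" for Q
      by (auto simp: cocenter_deg_def coset diag_homogeneous_closed)
    moreover have "(\<forall>f\<in>diag_homogeneous B (s - n). (xi_rep ^^ r) f \<in> Comm \<longrightarrow>
          cocenter_map K B (diag_lact B n a) (Comm +>\<^bsub>D\<^esub> f) = cocenter_zero K B \<and>
          cocenter_map K B (diag_ract B n a) (Comm +>\<^bsub>D\<^esub> f) = cocenter_zero K B) \<longleftrightarrow>
        (\<forall>f\<in>diag_homogeneous B (s - n). (xi_rep ^^ r) f \<in> Comm \<longrightarrow> diag_lact B n a f \<in> Comm)"
      by (intro ball_cong refl imp_cong) (simp add: lact ract diag_homogeneous_closed)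
    ultimately show ?thesis using a unfolding K_deg_def by simp
  qed
qed (simp add: K_deg_def)

text \<open>T_0 is the kernel of the identity, so the annihilation condition only asks that [B,B] be
  stable under a.\<close>

lemma K_deg_zero: "K_deg K B p 0 s n = gcenter_deg B n"
  using diag_lact_comm by (auto simp: K_deg_iff)

text \<open>xi preserves [B,B], so T_r grows with r and its annihilators shrink.\<close>

lemma K_deg_Suc: "K_deg K B p (Suc r) s n \<subseteq> K_deg K B p r s n"
  using xi_rep_comm by (auto simp: K_deg_iff)

lemma K_deg_subset: "K_deg K B p r s n \<subseteq> gcenter_deg B n"
  by (auto simp: K_deg_iff)

lemma K_deg_zero_mem: "(\<lambda>x\<in>GObj B. \<zero>\<^bsub>GHom B x x n\<^esub>) \<in> K_deg K B p r s n"
proof -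
  have "diag_lact B n (\<lambda>x\<in>GObj B. \<zero>\<^bsub>GHom B x x n\<^esub>) f = \<zero>\<^bsub>D\<^esub>" if "f \<in> diag_homogeneous B (s - n)" for f
    using diag_homogeneous_closed[OF that]
    by (intro diag_eqI) (auto simp: diag_lact_def diag_ext_extensional diag_zero_apply)
  then show ?thesis by (simp add: K_deg_iff gcenter_deg_zero)
qed

lemma K_deg_add:
  assumes "a \<in> K_deg K B p r s n" "b \<in> K_deg K B p r s n"
  shows "(\<lambda>x\<in>GObj B. a x \<oplus>\<^bsub>GHom B x x n\<^esub> b x) \<in> K_deg K B p r s n"
proof -
  have ab: "a \<in> gcenter_deg B n" "b \<in> gcenter_deg B n" using assms by (auto simp: K_deg_iff)
  have "diag_lact B n (\<lambda>x\<in>GObj B. a x \<oplus>\<^bsub>GHom B x x n\<^esub> b x) f = diag_lact B n a f \<oplus>\<^bsub>D\<^esub> diag_lact B n b f"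
    if "f \<in> diag_homogeneous B (s - n)" for f
    using diag_homogeneous_closed[OF that] ab
    by (intro diag_eqI) (auto simp: diag_lact_def diag_ext_extensional diag_add_apply gcomp_add_left)
  then show ?thesis using assms by (auto simp: K_deg_iff gcenter_deg_add comm_add)
qed

lemma K_deg_smult:
  assumes "a \<in> K_deg K B p r s n" "c \<in> carrier K"
  shows "(\<lambda>x\<in>GObj B. c \<odot>\<^bsub>GHom B x x n\<^esub> a x) \<in> K_deg K B p r s n"
proof -
  have a: "a \<in> gcenter_deg B n" using assms by (auto simp: K_deg_iff)
  have "diag_lact B n (\<lambda>x\<in>GObj B. c \<odot>\<^bsub>GHom B x x n\<^esub> a x) f = c \<odot>\<^bsub>D\<^esub> diag_lact B n a f"
    if "f \<in> diag_homogeneous B (s - n)" for f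
    using diag_homogeneous_closed[OF that] a assms(2)
    by (intro diag_eqI) (auto simp: diag_lact_def diag_ext_extensional diag_smult_apply gcomp_smult_left)
  then show ?thesis using assms by (auto simp: K_deg_iff gcenter_deg_smult comm_smult)
qed

text \<open>The product acts on f as a does on b f. Since b preserves T_r and moves degree s - (m +
  n) to s - m, the element b f is one that a kills.\<close>

lemma K_deg_mult_right:
  assumes "a \<in> K_deg K B p r s m" "b \<in> gcenter_deg B n" "d = m + n"
  shows "(\<lambda>x\<in>GObj B. gcomp B x x x m n (a x) (b x)) \<in> K_deg K B p r s d"
proof -
  have a: "a \<in> gcenter_deg B m" using assms by (auto simp: K_deg_iff)
  have "diag_lact B d (\<lambda>x\<in>GObj B. gcomp B x x x m n (a x) (b x)) f \<in> Comm"
    if f: "f \<in> diag_homogeneous B (s - d)" and "(xi_rep ^^ r) f \<in> Comm" for f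
  proof -
    have "diag_lact B n b f \<in> diag_homogeneous B (s - m)"
      using assms f by (intro diag_lact_homogeneous) auto
    moreover have "(xi_rep ^^ r) (diag_lact B n b f) \<in> Comm"
      using assms(2) that by (rule xi_rep_pow_lact)
    ultimately show ?thesis
      using assms(1) diag_lact_mult[OF a assms(2) diag_homogeneous_closed[OF f] assms(3)] by (simp add: K_deg_iff)
  qed
  then show ?thesis using a assms by (simp add: K_deg_iff gcenter_deg_mult)
qed

text \<open>Graded commutativity of the center turns this into right multiplication up to a sign,
  and an annihilator is stable under the scalar -1.\<close>

lemma K_deg_mult_left:
  assumes b: "b \<in> gcenter_deg B n" and a: "a \<in> K_deg K B p r s m" and d: "d = n + m"
  shows "(\<lambda>x\<in>GObj B. gcomp B x x x n m (b x) (a x)) \<in> K_deg K B p r s d"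
proof -
  have a': "a \<in> gcenter_deg B m" using a by (auto simp: K_deg_iff)
  let ?ab = "\<lambda>x\<in>GObj B. gcomp B x x x m n (a x) (b x)" and ?ba = "\<lambda>x\<in>GObj B. gcomp B x x x n m (b x) (a x)"
  have ab: "?ab \<in> K_deg K B p r s d" using a b d by (intro K_deg_mult_right) auto
  have eq: "?ba = (\<lambda>x\<in>GObj B. sgn_mult (GHom B x x d) (m * n) (?ab x))"
    using gcenter_deg_central[OF a' _ _ gcenter_deg_closed[OF b], of _ d] d by (intro restrict_ext) simp
  show ?thesis
  proof (cases "even (m * n)")
    case True
    then have "?ba = ?ab" unfolding eq by (simp add: sgn_mult_def cong: restrict_cong)
    with ab show ?thesis by simp
  next
    case False
    have "?ba = (\<lambda>x\<in>GObj B. (\<ominus>\<^bsub>K\<^esub> \<one>\<^bsub>K\<^esub>) \<odot>\<^bsub>GHom B x x d\<^esub> ?ab x)"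
      unfolding eq using False gcenter_deg_closed[OF subsetD[OF K_deg_subset ab]]
      by (intro restrict_ext) (auto simp: sgn_mult_def module.smult_l_minus[OF GHom_module] module.smult_one[OF GHom_module])
    then show ?thesis using K_deg_smult[OF ab, of "\<ominus>\<^bsub>K\<^esub> \<one>\<^bsub>K\<^esub>"] by simp
  qed
qed

end

section \<open>The center as a graded ring\<close>

definition gcenter_zero :: "('k, 'o, 'm) gr_cat \<Rightarrow> int \<Rightarrow> 'o \<Rightarrow> 'm" where
  "gcenter_zero B n = (\<lambda>x\<in>GObj B. \<zero>\<^bsub>GHom B x x n\<^esub>)"

definition gcenter_prod :: "('k, 'o, 'm) gr_cat \<Rightarrow> int \<Rightarrow> int \<Rightarrow> ('o \<Rightarrow> 'm) \<Rightarrow> ('o \<Rightarrow> 'm) \<Rightarrow> 'o \<Rightarrow> 'm" where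
  "gcenter_prod B m n a b = (\<lambda>x\<in>GObj B. gcomp B x x x m n (a x) (b x))"

text \<open>The center of an arbitrary graded category as a graded algebra, in the encoding of
  \<open>graded_center\<close>; for an orbit category the two records will turn out to be
  equal.\<close>

definition gcenter_ring :: "('k, 'o, 'm) gr_cat \<Rightarrow> ('k, int \<Rightarrow> 'o \<Rightarrow> 'm) module" where
  "gcenter_ring B = \<lparr>carrier = gcenter B,
    monoid.mult = (\<lambda>a b n. \<lambda>x\<in>GObj B.
      finsum (GHom B x x n) (\<lambda>i. gcomp B x x x i (n - i) (a i x) (b (n - i) x)) {i. a i \<noteq> gcenter_zero B i}),
    one = (\<lambda>n. if n = 0 then (\<lambda>x\<in>GObj B. gident B x) else gcenter_zero B n),
    ring.zero = gcenter_zero B,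
    ring.add = (\<lambda>a b n. \<lambda>x\<in>GObj B. a n x \<oplus>\<^bsub>GHom B x x n\<^esub> b n x),
    module.smult = (\<lambda>c a n. \<lambda>x\<in>GObj B. c \<odot>\<^bsub>GHom B x x n\<^esub> a n x)\<rparr>"

context graded_category
begin

abbreviation Z :: "('k, int \<Rightarrow> 'o \<Rightarrow> 'm) module" where
  "Z \<equiv> gcenter_ring B"

lemma gcenter_iff: "a \<in> gcenter B \<longleftrightarrow> (\<forall>n. a n \<in> gcenter_deg B n) \<and> finite {n. a n \<noteq> gcenter_zero B n}"
  by (simp add: gcenter_def gcenter_zero_def)

lemma carrier_Z [simp]: "carrier Z = gcenter B"
  by (simp add: gcenter_ring_def)

lemma gcenter_apply_closed [simp]: "\<lbrakk>a \<in> gcenter B; x \<in> GObj B\<rbrakk> \<Longrightarrow> a n x \<in> hom x x n"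
  by (simp add: gcenter_iff)

lemma gcenter_eqI:
  assumes "\<And>n. a n \<in> extensional (GObj B)" "\<And>n. b n \<in> extensional (GObj B)"
    and "\<And>n x. x \<in> GObj B \<Longrightarrow> a n x = b n x"
  shows "a = b"
  by (rule ext, rule extensionalityI[OF assms])

lemma gcenter_extensional: "a \<in> gcenter B \<Longrightarrow> a n \<in> extensional (GObj B)"
  using gcenter_deg_extensional[of "a n" n] by (simp add: gcenter_iff)

lemma gcenter_zero_apply [simp]: "x \<in> GObj B \<Longrightarrow> gcenter_zero B n x = \<zero>\<^bsub>GHom B x x n\<^esub>"
  by (simp add: gcenter_zero_def)

lemma zero_Z: "\<zero>\<^bsub>Z\<^esub> = gcenter_zero B"
  by (simp add: gcenter_ring_def)

lemma add_Z: "a \<oplus>\<^bsub>Z\<^esub> b = (\<lambda>n. \<lambda>x\<in>GObj B. a n x \<oplus>\<^bsub>GHom B x x n\<^esub> b n x)"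
  by (simp add: gcenter_ring_def)

lemma smult_Z: "c \<odot>\<^bsub>Z\<^esub> a = (\<lambda>n. \<lambda>x\<in>GObj B. c \<odot>\<^bsub>GHom B x x n\<^esub> a n x)"
  by (simp add: gcenter_ring_def)

lemma one_Z: "\<one>\<^bsub>Z\<^esub> = (\<lambda>n. if n = 0 then (\<lambda>x\<in>GObj B. gident B x) else gcenter_zero B n)"
  by (simp add: gcenter_ring_def)

lemma mult_Z_extensional: "(a \<otimes>\<^bsub>Z\<^esub> b) n \<in> extensional (GObj B)"
  by (simp add: gcenter_ring_def)

lemma gcenter_memI:
  assumes "\<And>n. a n \<in> gcenter_deg B n" "finite I" "\<And>n x. \<lbrakk>n \<notin> I; x \<in> GObj B\<rbrakk> \<Longrightarrow> a n x = \<zero>\<^bsub>GHom B x x n\<^esub>"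
  shows "a \<in> gcenter B"
proof -
  have "a n = gcenter_zero B n" if "n \<notin> I" for n
    by (rule extensionalityI[OF gcenter_deg_extensional[OF assms(1)]])
      (use assms(3)[OF that] in \<open>simp_all add: gcenter_zero_def\<close>)
  then have "{n. a n \<noteq> gcenter_zero B n} \<subseteq> I" by blast
  with assms show ?thesis by (auto simp: gcenter_iff intro: finite_subset)
qed

lemma gcenter_zero_outside:
  "\<lbrakk>n \<notin> {n. a n \<noteq> gcenter_zero B n}; x \<in> GObj B\<rbrakk> \<Longrightarrow> a n x = \<zero>\<^bsub>GHom B x x n\<^esub>"
  by simp

lemma gcenter_support:
  assumes "a \<in> gcenter B"
  shows "\<exists>I. finite I \<and> (\<forall>n x. n \<notin> I \<longrightarrow> x \<in> GObj B \<longrightarrow> a n x = \<zero>\<^bsub>GHom B x x n\<^esub>)"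
  using assms by (intro exI[of _ "{n. a n \<noteq> gcenter_zero B n}"]) (auto simp: gcenter_iff)

lemma mult_term_closed [simp]:
  "\<lbrakk>a \<in> gcenter B; b \<in> gcenter B; x \<in> GObj B\<rbrakk> \<Longrightarrow> gcomp B x x x i (n - i) (a i x) (b (n - i) x) \<in> hom x x n"
  by (intro gcomp_closed') auto

text \<open>The convolution may be summed over any finite set of degrees outside which a vanishes at
  x, so that different products can be written over a common index set.\<close>

lemma mult_Z_apply:
  assumes a: "a \<in> gcenter B" and b: "b \<in> gcenter B" and x: "x \<in> GObj B"
    and I: "finite I" "\<And>i. i \<notin> I \<Longrightarrow> a i x = \<zero>\<^bsub>GHom B x x i\<^esub>"
  shows "(a \<otimes>\<^bsub>Z\<^esub> b) n x = finsum (GHom B x x n) (\<lambda>i. gcomp B x x x i (n - i) (a i x) (b (n - i) x)) I"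
proof -
  interpret M: abelian_group "GHom B x x n" using x by (intro GHom_group)
  let ?S = "{i. a i \<noteq> gcenter_zero B i}" and ?g = "\<lambda>i. gcomp B x x x i (n - i) (a i x) (b (n - i) x)"
  have S: "finite ?S" using a by (simp add: gcenter_iff)
  have z: "?g i = \<zero>\<^bsub>GHom B x x n\<^esub>" if "a i x = \<zero>\<^bsub>GHom B x x i\<^esub>" for i
    using that x b gcomp_zero_left[of x x x "b (n - i) x" "n - i" i] by simp
  have "finsum (GHom B x x n) ?g ?S = finsum (GHom B x x n) ?g (?S \<union> I)"
    using S I(1) a b x z gcenter_zero_outside[of _ a x] by (intro M.add.finprod_mono_neutral_cong_left) auto
  also have "\<dots> = finsum (GHom B x x n) ?g I"
    using S I a b x z by (intro M.add.finprod_mono_neutral_cong_right) auto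
  finally show ?thesis using x by (simp add: gcenter_ring_def)
qed

lemma family_finsum_mem:
  assumes N: "N \<subseteq> gcenter_deg B n" "gcenter_zero B n \<in> N"
    and add: "\<And>a b. \<lbrakk>a \<in> N; b \<in> N\<rbrakk> \<Longrightarrow> (\<lambda>x\<in>GObj B. a x \<oplus>\<^bsub>GHom B x x n\<^esub> b x) \<in> N"
    and "finite I" and g: "\<And>i. i \<in> I \<Longrightarrow> (\<lambda>x\<in>GObj B. g i x) \<in> N"
  shows "(\<lambda>x\<in>GObj B. finsum (GHom B x x n) (\<lambda>i. g i x) I) \<in> N"
  using assms(4) g
proof (induction I)
  case empty
  have "(\<lambda>x\<in>GObj B. finsum (GHom B x x n) (\<lambda>i. g i x) {}) = gcenter_zero B n"
    by (auto simp: gcenter_zero_def abelian_monoid.finsum_empty[OF GHom_monoid])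
  then show ?case using N by simp
next
  case (insert i I)
  have cl: "g j x \<in> hom x x n" if "j \<in> insert i I" "x \<in> GObj B" for j x
    using gcenter_deg_closed[OF subsetD[OF N(1) insert.prems[OF that(1)]] that(2)] that by simp
  have "(\<lambda>x\<in>GObj B. finsum (GHom B x x n) (\<lambda>i. g i x) (insert i I)) =
    (\<lambda>x\<in>GObj B. (\<lambda>x\<in>GObj B. g i x) x \<oplus>\<^bsub>GHom B x x n\<^esub> (\<lambda>x\<in>GObj B. finsum (GHom B x x n) (\<lambda>i. g i x) I) x)"
    using insert.hyps cl by (intro restrict_ext) (simp add: abelian_monoid.finsum_insert[OF GHom_monoid])
  also have "\<dots> \<in> N" using insert by (intro add) auto
  finally show ?case .
qed

text \<open>N is any set of central elements of degree n that contains zero and is closed under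
  sums: all of them give closure of the center under products, the component of an ideal gives
  absorption.\<close>

lemma mult_Z_mem:
  assumes N: "N \<subseteq> gcenter_deg B n" "gcenter_zero B n \<in> N"
    and add: "\<And>a b. \<lbrakk>a \<in> N; b \<in> N\<rbrakk> \<Longrightarrow> (\<lambda>x\<in>GObj B. a x \<oplus>\<^bsub>GHom B x x n\<^esub> b x) \<in> N"
    and ab: "a \<in> gcenter B" "b \<in> gcenter B" and g: "\<And>i. gcenter_prod B i (n - i) (a i) (b (n - i)) \<in> N"
  shows "(a \<otimes>\<^bsub>Z\<^esub> b) n \<in> N"
proof -
  have "(\<lambda>x\<in>GObj B. finsum (GHom B x x n) (\<lambda>i. gcomp B x x x i (n - i) (a i x) (b (n - i) x))
      {i. a i \<noteq> gcenter_zero B i}) \<in> N"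
  proof (rule family_finsum_mem[OF N add])
    show "finite {i. a i \<noteq> gcenter_zero B i}" using ab by (simp add: gcenter_iff)
    show "(\<lambda>x\<in>GObj B. gcomp B x x x i (n - i) (a i x) (b (n - i) x)) \<in> N" for i
      using g[of i] by (simp add: gcenter_prod_def)
  qed
  then show ?thesis by (simp add: gcenter_ring_def)
qed

lemma mult_Z_closed:
  assumes a: "a \<in> gcenter B" and b: "b \<in> gcenter B"
  shows "a \<otimes>\<^bsub>Z\<^esub> b \<in> gcenter B"
proof -
  obtain I where I: "finite I" "\<And>n x. \<lbrakk>n \<notin> I; x \<in> GObj B\<rbrakk> \<Longrightarrow> a n x = \<zero>\<^bsub>GHom B x x n\<^esub>"
    using gcenter_support[OF a] by metis
  obtain J where J: "finite J" "\<And>n x. \<lbrakk>n \<notin> J; x \<in> GObj B\<rbrakk> \<Longrightarrow> b n x = \<zero>\<^bsub>GHom B x x n\<^esub>"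
    using gcenter_support[OF b] by metis
  show ?thesis
  proof (rule gcenter_memI[where I = "(\<lambda>(i, j). i + j) ` (I \<times> J)"])
    show "(a \<otimes>\<^bsub>Z\<^esub> b) n \<in> gcenter_deg B n" for n
    proof (rule mult_Z_mem[OF order_refl _ _ a b])
      show "gcenter_zero B n \<in> gcenter_deg B n" unfolding gcenter_zero_def by (rule gcenter_deg_zero)
      show "gcenter_prod B i (n - i) (a i) (b (n - i)) \<in> gcenter_deg B n" for i
        unfolding gcenter_prod_def using a b by (intro gcenter_deg_mult) (auto simp: gcenter_iff)
    qed (rule gcenter_deg_add)
    show "(a \<otimes>\<^bsub>Z\<^esub> b) n x = \<zero>\<^bsub>GHom B x x n\<^esub>" if n: "n \<notin> (\<lambda>(i, j). i + j) ` (I \<times> J)" and x: "x \<in> GObj B" for n x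
    proof -
      interpret M: abelian_group "GHom B x x n" using x by (intro GHom_group)
      have "gcomp B x x x i (n - i) (a i x) (b (n - i) x) = \<zero>\<^bsub>GHom B x x n\<^esub>" if i: "i \<in> I" for i
      proof -
        have "n - i \<notin> J"
        proof
          assume "n - i \<in> J"
          with i have "(\<lambda>(i, j). i + j) (i, n - i) \<in> (\<lambda>(i, j). i + j) ` (I \<times> J)" by blast
          with n show False by simp
        qed
        then show ?thesis using J(2) x a gcomp_zero_right[of x x x "a i x" i "n - i"] by simp
      qed
      then have "finsum (GHom B x x n) (\<lambda>i. gcomp B x x x i (n - i) (a i x) (b (n - i) x)) I = \<zero>\<^bsub>GHom B x x n\<^esub>"
        by (intro M.add.finprod_one_eqI)
      then show ?thesis using mult_Z_apply[OF a b x I(1)] I(2) x by simp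
    qed
  qed (use I J in auto)
qed

lemma zero_Z_closed: "gcenter_zero B \<in> gcenter B"
  using gcenter_deg_zero by (auto simp: gcenter_iff gcenter_zero_def)

lemma one_Z_closed: "\<one>\<^bsub>Z\<^esub> \<in> gcenter B"
  by (rule gcenter_memI[where I = "{0}"])
    (use gcenter_deg_one gcenter_deg_zero in \<open>auto simp: one_Z gcenter_zero_def\<close>)

lemma add_Z_closed: "\<lbrakk>a \<in> gcenter B; b \<in> gcenter B\<rbrakk> \<Longrightarrow> a \<oplus>\<^bsub>Z\<^esub> b \<in> gcenter B"
  by (rule gcenter_memI[where I = "{n. a n \<noteq> gcenter_zero B n} \<union> {n. b n \<noteq> gcenter_zero B n}"])
    (auto simp: add_Z gcenter_iff gcenter_deg_add abelian_monoid.l_zero[OF GHom_monoid])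

lemma smult_Z_closed: "\<lbrakk>c \<in> carrier K; a \<in> gcenter B\<rbrakk> \<Longrightarrow> c \<odot>\<^bsub>Z\<^esub> a \<in> gcenter B"
  by (rule gcenter_memI[where I = "{n. a n \<noteq> gcenter_zero B n}"])
    (auto simp: smult_Z gcenter_iff gcenter_deg_smult module.smult_r_null[OF GHom_module])

lemma Z_abelian_group: "abelian_group Z"
proof (rule abelian_groupI)
  fix a assume a: "a \<in> carrier Z"
  have "((\<ominus>\<^bsub>K\<^esub> \<one>\<^bsub>K\<^esub>) \<odot>\<^bsub>Z\<^esub> a) \<oplus>\<^bsub>Z\<^esub> a = \<zero>\<^bsub>Z\<^esub>"
    using a
    by (intro gcenter_eqI) (auto simp: add_Z smult_Z zero_Z gcenter_zero_def module.smult_l_minus[OF GHom_module]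
        module.smult_one[OF GHom_module] abelian_group.l_neg[OF GHom_group])
  then show "\<exists>b\<in>carrier Z. b \<oplus>\<^bsub>Z\<^esub> a = \<zero>\<^bsub>Z\<^esub>"
    using smult_Z_closed[of "\<ominus>\<^bsub>K\<^esub> \<one>\<^bsub>K\<^esub>" a] a by auto
next
  fix a assume "a \<in> carrier Z"
  then show "\<zero>\<^bsub>Z\<^esub> \<oplus>\<^bsub>Z\<^esub> a = a"
    by (intro gcenter_eqI) (auto simp: add_Z zero_Z gcenter_extensional abelian_monoid.l_zero[OF GHom_monoid])
qed (auto simp: zero_Z zero_Z_closed add_Z_closed, auto simp: add_Z hom_ac intro!: ext restrict_ext)

text \<open>Both bracketings are double sums of the same triple composites \<open>?t i k\<close>,
  where i is the degree taken from a and k the total degree taken from a and b; the summations are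
  exchanged and k = i + j is substituted.\<close>

lemma mult_Z_assoc:
  assumes a: "a \<in> gcenter B" and b: "b \<in> gcenter B" and c: "c \<in> gcenter B"
  shows "(a \<otimes>\<^bsub>Z\<^esub> b) \<otimes>\<^bsub>Z\<^esub> c = a \<otimes>\<^bsub>Z\<^esub> (b \<otimes>\<^bsub>Z\<^esub> c)"
proof (rule gcenter_eqI)
  fix n x assume x: "x \<in> GObj B"
  interpret M: abelian_group "GHom B x x n" using x by (intro GHom_group)
  let ?M = "GHom B x x n"
  obtain I where I: "finite I" "\<And>n x. \<lbrakk>n \<notin> I; x \<in> GObj B\<rbrakk> \<Longrightarrow> a n x = \<zero>\<^bsub>GHom B x x n\<^esub>"
    using gcenter_support[OF a] by metis
  obtain J where J: "finite J" "\<And>n x. \<lbrakk>n \<notin> J; x \<in> GObj B\<rbrakk> \<Longrightarrow> b n x = \<zero>\<^bsub>GHom B x x n\<^esub>"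
    using gcenter_support[OF b] by metis
  obtain L where L: "finite L" "\<And>n x. \<lbrakk>n \<notin> L; x \<in> GObj B\<rbrakk> \<Longrightarrow> (a \<otimes>\<^bsub>Z\<^esub> b) n x = \<zero>\<^bsub>GHom B x x n\<^esub>"
    using gcenter_support[OF mult_Z_closed[OF a b]] by metis
  \<comment> \<open>Large enough for the support of the product of a and b and for every i + j, so
    both double sums can use it.\<close>
  let ?L = "L \<union> (\<lambda>(i, j). i + j) ` (I \<times> J)"
  have fin: "finite ?L" using I J L by auto
  let ?t = "\<lambda>i k. gcomp B x x x i (n - i) (a i x) (gcomp B x x x (k - i) (n - k) (b (k - i) x) (c (n - k) x))"
  have t: "?t i k \<in> hom x x n" for i k using a b c x by (auto intro!: gcomp_closed')
  have "((a \<otimes>\<^bsub>Z\<^esub> b) \<otimes>\<^bsub>Z\<^esub> c) n x = finsum ?M (\<lambda>k. gcomp B x x x k (n - k) ((a \<otimes>\<^bsub>Z\<^esub> b) k x) (c (n - k) x)) ?L"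
    using mult_Z_apply[OF mult_Z_closed[OF a b] c x fin] L x by auto
  also have "\<dots> = finsum ?M (\<lambda>k. finsum ?M (\<lambda>i. ?t i k) I) ?L"
  proof (rule M.add.finprod_cong')
    fix k
    have "gcomp B x x x k (n - k) ((a \<otimes>\<^bsub>Z\<^esub> b) k x) (c (n - k) x) =
        gcomp B x x x k (n - k) (finsum (GHom B x x k) (\<lambda>i. gcomp B x x x i (k - i) (a i x) (b (k - i) x)) I) (c (n - k) x)"
      using mult_Z_apply[OF a b x I(1)] I(2) x by simp
    also have "\<dots> = finsum ?M (\<lambda>i. gcomp B x x x k (n - k) (gcomp B x x x i (k - i) (a i x) (b (k - i) x)) (c (n - k) x)) I"
      using a b c x by (intro linear_map.finsum[OF gcomp_left_linear]) auto
    also have "\<dots> = finsum ?M (\<lambda>i. ?t i k) I"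
      using a b c x t by (intro M.add.finprod_cong' gcomp_assoc') auto
    finally show "gcomp B x x x k (n - k) ((a \<otimes>\<^bsub>Z\<^esub> b) k x) (c (n - k) x) = finsum ?M (\<lambda>i. ?t i k) I" .
  qed (use t in auto)
  also have "\<dots> = finsum ?M (\<lambda>i. finsum ?M (?t i) ?L) I"
    using t by (intro M.finsum_swap fin I)
  also have "\<dots> = finsum ?M (\<lambda>i. gcomp B x x x i (n - i) (a i x) ((b \<otimes>\<^bsub>Z\<^esub> c) (n - i) x)) I"
  proof (rule M.add.finprod_cong')
    fix i assume i: "i \<in> I"
    have "gcomp B x x x i (n - i) (a i x) ((b \<otimes>\<^bsub>Z\<^esub> c) (n - i) x) = gcomp B x x x i (n - i) (a i x)
        (finsum (GHom B x x (n - i)) (\<lambda>j. gcomp B x x x j (n - i - j) (b j x) (c (n - i - j) x)) J)"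
      using mult_Z_apply[OF b c x J(1)] J(2) x by simp
    also have "\<dots> = finsum ?M (\<lambda>j. gcomp B x x x i (n - i) (a i x) (gcomp B x x x j (n - i - j) (b j x) (c (n - i - j) x))) J"
      using a b c x by (intro linear_map.finsum[OF gcomp_right_linear]) auto
    also have "\<dots> = finsum ?M (\<lambda>j. ?t i (i + j)) J"
      by (simp add: diff_diff_eq)
    also have "\<dots> = finsum ?M (?t i) ((+) i ` J)"
      using t by (subst M.finsum_reindex) auto
    also have "\<dots> = finsum ?M (?t i) ?L"
    proof (rule M.add.finprod_mono_neutral_cong_left)
      fix k assume k: "k \<in> ?L - (+) i ` J"
      have "k - i \<notin> J"
      proof
        assume "k - i \<in> J"
        then have "i + (k - i) \<in> (+) i ` J" by blast
        with k show False by simp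
      qed
      then show "?t i k = \<zero>\<^bsub>?M\<^esub>"
        using a c x J(2)[of "k - i" x] gcomp_zero_left[of x x x "c (n - k) x" "n - k" "k - i"]
          gcomp_zero_right[of x x x "a i x" i "n - i"] by simp
    qed (use t i fin in auto)
    finally show "finsum ?M (?t i) ?L = gcomp B x x x i (n - i) (a i x) ((b \<otimes>\<^bsub>Z\<^esub> c) (n - i) x)" ..
  qed (use a b c x mult_Z_closed[OF b c] in auto)
  also have "\<dots> = (a \<otimes>\<^bsub>Z\<^esub> (b \<otimes>\<^bsub>Z\<^esub> c)) n x"
    using mult_Z_apply[OF a mult_Z_closed[OF b c] x I(1)] I(2) x by simp
  finally show "((a \<otimes>\<^bsub>Z\<^esub> b) \<otimes>\<^bsub>Z\<^esub> c) n x = (a \<otimes>\<^bsub>Z\<^esub> (b \<otimes>\<^bsub>Z\<^esub> c)) n x" .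
qed (rule mult_Z_extensional)+

lemma Z_ring: "ring Z"
proof (rule ringI[OF Z_abelian_group])
  show "Group.monoid Z"
  proof (rule monoidI)
    fix a assume "a \<in> carrier Z"
    then have a: "a \<in> gcenter B" by simp
    obtain I where I: "finite I" "\<And>n x. \<lbrakk>n \<notin> I; x \<in> GObj B\<rbrakk> \<Longrightarrow> a n x = \<zero>\<^bsub>GHom B x x n\<^esub>"
      using gcenter_support[OF a] by metis
    show "\<one>\<^bsub>Z\<^esub> \<otimes>\<^bsub>Z\<^esub> a = a"
    proof (rule gcenter_eqI)
      fix n x assume x: "x \<in> GObj B"
      interpret M: abelian_group "GHom B x x n" using x by (intro GHom_group)
      have "(\<one>\<^bsub>Z\<^esub> \<otimes>\<^bsub>Z\<^esub> a) n x = finsum (GHom B x x n) (\<lambda>i. gcomp B x x x i (n - i) (\<one>\<^bsub>Z\<^esub> i x) (a (n - i) x)) {0}"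
        using x by (intro mult_Z_apply one_Z_closed a) (auto simp: one_Z)
      also have "\<dots> = a n x"
        using x a by (simp add: one_Z gcomp_ident_left)
      finally show "(\<one>\<^bsub>Z\<^esub> \<otimes>\<^bsub>Z\<^esub> a) n x = a n x" .
    qed (use a gcenter_extensional mult_Z_extensional in auto)
    show "a \<otimes>\<^bsub>Z\<^esub> \<one>\<^bsub>Z\<^esub> = a"
    proof (rule gcenter_eqI)
      fix n x assume x: "x \<in> GObj B"
      interpret M: abelian_group "GHom B x x n" using x by (intro GHom_group)
      let ?g = "\<lambda>i. gcomp B x x x i (n - i) (a i x) (\<one>\<^bsub>Z\<^esub> (n - i) x)"
      \<comment> \<open>Only the term with i = n meets the degree 0 component of the unit; n is
        inserted because it may lie outside I.\<close>
      have "(a \<otimes>\<^bsub>Z\<^esub> \<one>\<^bsub>Z\<^esub>) n x = finsum (GHom B x x n) ?g (insert n I)"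
        using x I by (intro mult_Z_apply one_Z_closed a) auto
      also have "\<dots> = finsum (GHom B x x n) ?g {n}"
      proof (rule M.add.finprod_mono_neutral_cong_right)
        fix i assume "i \<in> insert n I - {n}"
        then show "?g i = \<zero>\<^bsub>GHom B x x n\<^esub>"
          using x a gcomp_zero_right[of x x x "a i x" i "n - i"] by (simp add: one_Z)
      qed (use x a I one_Z_closed in \<open>auto intro!: gcomp_closed'\<close>)
      also have "\<dots> = a n x"
        using x a by (simp add: one_Z gcomp_ident_right)
      finally show "(a \<otimes>\<^bsub>Z\<^esub> \<one>\<^bsub>Z\<^esub>) n x = a n x" .
    qed (use a gcenter_extensional mult_Z_extensional in auto)
  qed (auto simp: mult_Z_closed one_Z_closed mult_Z_assoc)
next
  fix a b c assume "a \<in> carrier Z" "b \<in> carrier Z" "c \<in> carrier Z"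
  then have abc: "a \<in> gcenter B" "b \<in> gcenter B" "c \<in> gcenter B" by simp_all
  obtain I where I: "finite I" "\<And>n x. \<lbrakk>n \<notin> I; x \<in> GObj B\<rbrakk> \<Longrightarrow> a n x = \<zero>\<^bsub>GHom B x x n\<^esub>"
    using gcenter_support[OF abc(1)] by metis
  obtain J where J: "finite J" "\<And>n x. \<lbrakk>n \<notin> J; x \<in> GObj B\<rbrakk> \<Longrightarrow> b n x = \<zero>\<^bsub>GHom B x x n\<^esub>"
    using gcenter_support[OF abc(2)] by metis
  obtain L where L: "finite L" "\<And>n x. \<lbrakk>n \<notin> L; x \<in> GObj B\<rbrakk> \<Longrightarrow> c n x = \<zero>\<^bsub>GHom B x x n\<^esub>"
    using gcenter_support[OF abc(3)] by metis
  have IJ: "finite (I \<union> J)" using I J by simp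
  show "(a \<oplus>\<^bsub>Z\<^esub> b) \<otimes>\<^bsub>Z\<^esub> c = (a \<otimes>\<^bsub>Z\<^esub> c) \<oplus>\<^bsub>Z\<^esub> (b \<otimes>\<^bsub>Z\<^esub> c)"
  proof (rule gcenter_eqI)
    fix n x assume x: "x \<in> GObj B"
    interpret M: abelian_group "GHom B x x n" using x by (intro GHom_group)
    have ab: "(a \<oplus>\<^bsub>Z\<^esub> b) i x = \<zero>\<^bsub>GHom B x x i\<^esub>" if "i \<notin> I \<union> J" for i
      using that I J x by (simp add: add_Z abelian_monoid.l_zero[OF GHom_monoid])
    have 1: "(a \<oplus>\<^bsub>Z\<^esub> b) i x = a i x \<oplus>\<^bsub>GHom B x x i\<^esub> b i x" for i using x by (simp add: add_Z)
    have 2: "((a \<otimes>\<^bsub>Z\<^esub> c) \<oplus>\<^bsub>Z\<^esub> (b \<otimes>\<^bsub>Z\<^esub> c)) n x = (a \<otimes>\<^bsub>Z\<^esub> c) n x \<oplus>\<^bsub>GHom B x x n\<^esub> (b \<otimes>\<^bsub>Z\<^esub> c) n x"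
      using x by (simp add: add_Z)
    have "gcomp B x x x i (n - i) (a i x \<oplus>\<^bsub>GHom B x x i\<^esub> b i x) (c (n - i) x) =
        gcomp B x x x i (n - i) (a i x) (c (n - i) x) \<oplus>\<^bsub>GHom B x x n\<^esub> gcomp B x x x i (n - i) (b i x) (c (n - i) x)" for i
      using x abc by (intro linear_map.add[OF gcomp_left_linear]) auto
    then show "((a \<oplus>\<^bsub>Z\<^esub> b) \<otimes>\<^bsub>Z\<^esub> c) n x = ((a \<otimes>\<^bsub>Z\<^esub> c) \<oplus>\<^bsub>Z\<^esub> (b \<otimes>\<^bsub>Z\<^esub> c)) n x"
      using mult_Z_apply[OF add_Z_closed[OF abc(1,2)] abc(3) x IJ ab]
        mult_Z_apply[OF abc(1,3) x IJ] mult_Z_apply[OF abc(2,3) x IJ] I(2) J(2) x abc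
      unfolding 2 by (simp add: 1 M.finsum_addf)
  qed (use mult_Z_extensional in \<open>auto simp: add_Z\<close>)
  show "c \<otimes>\<^bsub>Z\<^esub> (a \<oplus>\<^bsub>Z\<^esub> b) = (c \<otimes>\<^bsub>Z\<^esub> a) \<oplus>\<^bsub>Z\<^esub> (c \<otimes>\<^bsub>Z\<^esub> b)"
  proof (rule gcenter_eqI)
    fix n x assume x: "x \<in> GObj B"
    interpret M: abelian_group "GHom B x x n" using x by (intro GHom_group)
    have 1: "(a \<oplus>\<^bsub>Z\<^esub> b) i x = a i x \<oplus>\<^bsub>GHom B x x i\<^esub> b i x" for i using x by (simp add: add_Z)
    have 2: "((c \<otimes>\<^bsub>Z\<^esub> a) \<oplus>\<^bsub>Z\<^esub> (c \<otimes>\<^bsub>Z\<^esub> b)) n x = (c \<otimes>\<^bsub>Z\<^esub> a) n x \<oplus>\<^bsub>GHom B x x n\<^esub> (c \<otimes>\<^bsub>Z\<^esub> b) n x"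
      using x by (simp add: add_Z)
    have "gcomp B x x x i (n - i) (c i x) (a (n - i) x \<oplus>\<^bsub>GHom B x x (n - i)\<^esub> b (n - i) x) =
        gcomp B x x x i (n - i) (c i x) (a (n - i) x) \<oplus>\<^bsub>GHom B x x n\<^esub> gcomp B x x x i (n - i) (c i x) (b (n - i) x)" for i
      using x abc by (intro linear_map.add[OF gcomp_right_linear]) auto
    then show "(c \<otimes>\<^bsub>Z\<^esub> (a \<oplus>\<^bsub>Z\<^esub> b)) n x = ((c \<otimes>\<^bsub>Z\<^esub> a) \<oplus>\<^bsub>Z\<^esub> (c \<otimes>\<^bsub>Z\<^esub> b)) n x"
      using mult_Z_apply[OF abc(3) add_Z_closed[OF abc(1,2)] x L(1)]
        mult_Z_apply[OF abc(3,1) x L(1)] mult_Z_apply[OF abc(3,2) x L(1)] L(2) x abc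
      unfolding 2 by (simp add: 1 M.finsum_addf)
  qed (use mult_Z_extensional in \<open>auto simp: add_Z\<close>)
qed

text \<open>The homogeneous components of a graded ideal. In this form intersections are taken
  degree by degree; closure under scalars also supplies additive inverses.\<close>

definition ideal_family :: "(int \<Rightarrow> ('o \<Rightarrow> 'm) set) \<Rightarrow> bool" where
  "ideal_family N \<longleftrightarrow> (\<forall>n. N n \<subseteq> gcenter_deg B n \<and> gcenter_zero B n \<in> N n \<and>
    (\<forall>a\<in>N n. \<forall>b\<in>N n. (\<lambda>x\<in>GObj B. a x \<oplus>\<^bsub>GHom B x x n\<^esub> b x) \<in> N n) \<and>
    (\<forall>c\<in>carrier K. \<forall>a\<in>N n. (\<lambda>x\<in>GObj B. c \<odot>\<^bsub>GHom B x x n\<^esub> a x) \<in> N n)) \<and>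
    (\<forall>m n. \<forall>a\<in>N m. \<forall>b\<in>gcenter_deg B n.
      gcenter_prod B m n a b \<in> N (m + n) \<and> gcenter_prod B n m b a \<in> N (n + m))"

lemma ideal_familyI:
  assumes "\<And>n. N n \<subseteq> gcenter_deg B n" "\<And>n. gcenter_zero B n \<in> N n"
    and "\<And>n a b. \<lbrakk>a \<in> N n; b \<in> N n\<rbrakk> \<Longrightarrow> (\<lambda>x\<in>GObj B. a x \<oplus>\<^bsub>GHom B x x n\<^esub> b x) \<in> N n"
    and "\<And>n a c. \<lbrakk>c \<in> carrier K; a \<in> N n\<rbrakk> \<Longrightarrow> (\<lambda>x\<in>GObj B. c \<odot>\<^bsub>GHom B x x n\<^esub> a x) \<in> N n"
    and "\<And>m n a b. \<lbrakk>a \<in> N m; b \<in> gcenter_deg B n\<rbrakk> \<Longrightarrow> gcenter_prod B m n a b \<in> N (m + n)"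
    and "\<And>m n a b. \<lbrakk>a \<in> N m; b \<in> gcenter_deg B n\<rbrakk> \<Longrightarrow> gcenter_prod B n m b a \<in> N (n + m)"
  shows "ideal_family N"
  unfolding ideal_family_def by (intro conjI allI ballI assms)

lemma ideal_familyD:
  assumes "ideal_family N"
  shows "N n \<subseteq> gcenter_deg B n" "gcenter_zero B n \<in> N n"
    and "\<lbrakk>a \<in> N n; b \<in> N n\<rbrakk> \<Longrightarrow> (\<lambda>x\<in>GObj B. a x \<oplus>\<^bsub>GHom B x x n\<^esub> b x) \<in> N n"
    and "\<lbrakk>c \<in> carrier K; a \<in> N n\<rbrakk> \<Longrightarrow> (\<lambda>x\<in>GObj B. c \<odot>\<^bsub>GHom B x x n\<^esub> a x) \<in> N n"
    and "\<lbrakk>a \<in> N m; b \<in> gcenter_deg B n\<rbrakk> \<Longrightarrow> gcenter_prod B m n a b \<in> N (m + n)"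
    and "\<lbrakk>a \<in> N m; b \<in> gcenter_deg B n\<rbrakk> \<Longrightarrow> gcenter_prod B n m b a \<in> N (n + m)"
  using assms unfolding ideal_family_def by simp_all

lemma ideal_family_Inter:
  assumes "\<And>i. i \<in> I \<Longrightarrow> ideal_family (N i)" "I \<noteq> {}"
  shows "ideal_family (\<lambda>n. \<Inter>i\<in>I. N i n)"
proof (rule ideal_familyI)
  show "(\<Inter>i\<in>I. N i n) \<subseteq> gcenter_deg B n" for n
    using assms ideal_familyD(1) by blast
qed (auto intro: ideal_familyD[OF assms(1)])

lemma ideal_family_graded_ideal:
  assumes N: "ideal_family N"
  shows "graded_ideal {a \<in> gcenter B. \<forall>n. a n \<in> N n} Z"
proof -
  let ?I = "{a \<in> gcenter B. \<forall>n. a n \<in> N n}"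
  note sub = ideal_familyD(1)[OF N] and zero = ideal_familyD(2)[OF N] and add = ideal_familyD(3)[OF N]
    and smult = ideal_familyD(4)[OF N] and prod = ideal_familyD(5,6)[OF N]
  interpret Z: ring Z by (rule Z_ring)
  have "ideal ?I Z"
  proof (rule idealI[OF Z_ring])
    show "subgroup ?I (add_monoid Z)"
    proof (rule Z.add.subgroupI)
      fix a assume a: "a \<in> ?I"
      have "((\<ominus>\<^bsub>K\<^esub> \<one>\<^bsub>K\<^esub>) \<odot>\<^bsub>Z\<^esub> a) \<oplus>\<^bsub>Z\<^esub> a = \<zero>\<^bsub>Z\<^esub>"
        using a
        by (intro gcenter_eqI) (auto simp: add_Z smult_Z zero_Z gcenter_zero_def module.smult_l_minus[OF GHom_module]
            module.smult_one[OF GHom_module] abelian_group.l_neg[OF GHom_group])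
      then have "\<ominus>\<^bsub>Z\<^esub> a = (\<ominus>\<^bsub>K\<^esub> \<one>\<^bsub>K\<^esub>) \<odot>\<^bsub>Z\<^esub> a"
        using a smult_Z_closed[of "\<ominus>\<^bsub>K\<^esub> \<one>\<^bsub>K\<^esub>" a] by (intro Z.minus_equality) auto
      moreover have "(\<ominus>\<^bsub>K\<^esub> \<one>\<^bsub>K\<^esub>) \<odot>\<^bsub>Z\<^esub> a \<in> ?I"
        using a smult_Z_closed[of "\<ominus>\<^bsub>K\<^esub> \<one>\<^bsub>K\<^esub>" a] smult[of "\<ominus>\<^bsub>K\<^esub> \<one>\<^bsub>K\<^esub>"] by (auto simp: smult_Z)
      ultimately show "\<ominus>\<^bsub>Z\<^esub> a \<in> ?I" by simp
    next
      show "?I \<noteq> {}" using zero zero_Z_closed by blast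
      show "a \<oplus>\<^bsub>Z\<^esub> b \<in> ?I" if "a \<in> ?I" "b \<in> ?I" for a b
        using that add add_Z_closed by (auto simp: add_Z)
    qed auto
  next
    fix a z assume a: "a \<in> ?I" and z: "z \<in> carrier Z"
    have "(z \<otimes>\<^bsub>Z\<^esub> a) n \<in> N n" for n
    proof (rule mult_Z_mem[OF sub zero add])
      show "gcenter_prod B i (n - i) (z i) (a (n - i)) \<in> N n" for i
        using prod(2)[of "a (n - i)" "n - i" "z i" i] a z by (simp add: gcenter_iff)
    qed (use a z in auto)
    then show "z \<otimes>\<^bsub>Z\<^esub> a \<in> ?I" using a z mult_Z_closed by auto
    have "(a \<otimes>\<^bsub>Z\<^esub> z) n \<in> N n" for n
    proof (rule mult_Z_mem[OF sub zero add])
      show "gcenter_prod B i (n - i) (a i) (z (n - i)) \<in> N n" for i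
        using prod(1)[of "a i" i "z (n - i)" "n - i"] a z by (simp add: gcenter_iff)
    qed (use a z in auto)
    then show "a \<otimes>\<^bsub>Z\<^esub> z \<in> ?I" using a z mult_Z_closed by auto
  qed
  moreover have "\<zero>\<^bsub>Z\<^esub>(n := a n) \<in> ?I" if a: "a \<in> ?I" for a n
  proof -
    have "\<zero>\<^bsub>Z\<^esub>(n := a n) \<in> gcenter B"
      using a sub zero by (intro gcenter_memI[where I = "{n}"]) (auto simp: zero_Z)
    then show ?thesis using a zero by (auto simp: zero_Z)
  qed
  ultimately show ?thesis by (simp add: graded_ideal_def)
qed

end

section \<open>The annihilators and their intersections as graded ideals\<close>

context graded_category_char
begin

lemma K_deg_ideal_family: "ideal_family (K_deg K B p r s)"
  unfolding gcenter_prod_def gcenter_zero_def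
  by (rule ideal_familyI)
    (simp_all add: gcenter_prod_def gcenter_zero_def K_deg_subset K_deg_zero_mem K_deg_add K_deg_smult
      K_deg_mult_left K_deg_mult_right)

lemma K_rs_graded_ideal: "graded_ideal (K_rs K B p r s) Z"
  unfolding K_rs_def by (intro ideal_family_graded_ideal K_deg_ideal_family)

lemma K_r_eq: "K_r K B p r = {a \<in> gcenter B. \<forall>n. a n \<in> (\<Inter>s. K_deg K B p r s n)}"
  by (auto simp: K_r_def K_rs_def)

lemma R_s_eq: "R_s K B p s = {a \<in> gcenter B. \<forall>n. a n \<in> (\<Inter>r. K_deg K B p r s n)}"
  by (auto simp: R_s_def K_rs_def)

lemma R_all_eq: "R_all K B p = {a \<in> gcenter B. \<forall>n. a n \<in> (\<Inter>r. \<Inter>s. K_deg K B p r s n)}"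
  by (auto simp: R_all_def K_r_def K_rs_def)

lemma K_r_graded_ideal: "graded_ideal (K_r K B p r) Z"
  unfolding K_r_eq by (intro ideal_family_graded_ideal ideal_family_Inter K_deg_ideal_family) simp_all

lemma R_s_graded_ideal: "graded_ideal (R_s K B p s) Z"
  unfolding R_s_eq by (intro ideal_family_graded_ideal ideal_family_Inter K_deg_ideal_family) simp_all

lemma R_all_graded_ideal: "graded_ideal (R_all K B p) Z"
  unfolding R_all_eq by (intro ideal_family_graded_ideal ideal_family_Inter K_deg_ideal_family) simp_all

lemma K_rs_zero: "K_rs K B p 0 s = gcenter B"
  by (auto simp: K_rs_def K_deg_zero gcenter_iff)

lemma K_rs_Suc: "K_rs K B p (Suc r) s \<subseteq> K_rs K B p r s"
  using subsetD[OF K_deg_Suc] by (auto simp: K_rs_def)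

end

section \<open>Graded functors\<close>

text \<open>One has e = u' (u e), and v = (u e) u' because u e = v u, so e and v differ by a cyclic
  move of u'. As u' has degree 0, no sign arises.\<close>

lemma (in graded_category) cong_single_conj:
  assumes xy: "x \<in> GObj B" "y \<in> GObj B" and u: "u \<in> hom x y 0" "u' \<in> hom y x 0"
    and inv: "gcomp B x y x 0 0 u' u = gident B x" "gcomp B y x y 0 0 u u' = gident B y"
    and e: "e \<in> hom x x n" and v: "v \<in> hom y y n"
    and eq: "gcomp B x x y 0 n u e = gcomp B x y y n 0 v u"
  shows "single x n e \<asymp> single y n v"
proof -
  have ue: "gcomp B x x y 0 n u e \<in> hom x y n" using xy u e by (auto intro: gcomp_closed')
  have "e = gcomp B x x x 0 n (gcomp B x y x 0 0 u' u) e"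
    unfolding inv using xy e by (simp add: gcomp_ident_left)
  also have "\<dots> = gcomp B x y x 0 n u' (gcomp B x x y 0 n u e)"
    using xy u e by (intro gcomp_assoc') auto
  finally have "single x n e = single x n (gcomp B x y x 0 n u' (gcomp B x x y 0 n u e))" by simp
  also have "\<dots> \<asymp> single y n (sgn_mult (GHom B y y n) (n * 0) (gcomp B y x y n 0 (gcomp B x x y 0 n u e) u'))"
    using xy u ue by (intro cong_comm_generator) auto
  also have "gcomp B y x y n 0 (gcomp B x x y 0 n u e) u' = gcomp B y y y n 0 v (gcomp B y x y 0 0 u u')"
    unfolding eq using xy u v by (intro gcomp_assoc') auto
  also have "\<dots> = v" unfolding inv using xy v by (simp add: gcomp_ident_right)
  finally show ?thesis by (simp add: sgn_mult_def)
qed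

lemma image_eq_of_iff:
  assumes "f ` A = B" "\<And>a. a \<in> A \<Longrightarrow> f a \<in> B' \<longleftrightarrow> a \<in> A'" "A' \<subseteq> A" "B' \<subseteq> B"
  shows "f ` A' = B'"
  using assms by blast

locale graded_functor = src: graded_category K B + tgt: graded_category K B'
  for K :: "('k, 'r) ring_scheme" and B :: "('k, 'o, 'm) gr_cat" and B' :: "('k, 'o2, 'm2) gr_cat" +
  fixes Fo :: "'o \<Rightarrow> 'o2" and Fm :: "'o \<Rightarrow> 'o \<Rightarrow> int \<Rightarrow> 'm \<Rightarrow> 'm2"
  assumes Fo_closed [simp]: "x \<in> GObj B \<Longrightarrow> Fo x \<in> GObj B'"
    and Fm_closed [simp]: "\<lbrakk>x \<in> GObj B; y \<in> GObj B; f \<in> carrier (GHom B x y n)\<rbrakk> \<Longrightarrow>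
      Fm x y n f \<in> carrier (GHom B' (Fo x) (Fo y) n)"
    and Fm_add: "\<lbrakk>x \<in> GObj B; y \<in> GObj B; f \<in> carrier (GHom B x y n); g \<in> carrier (GHom B x y n)\<rbrakk> \<Longrightarrow>
      Fm x y n (f \<oplus>\<^bsub>GHom B x y n\<^esub> g) = Fm x y n f \<oplus>\<^bsub>GHom B' (Fo x) (Fo y) n\<^esub> Fm x y n g"
    and Fm_smult: "\<lbrakk>x \<in> GObj B; y \<in> GObj B; c \<in> carrier K; f \<in> carrier (GHom B x y n)\<rbrakk> \<Longrightarrow>
      Fm x y n (c \<odot>\<^bsub>GHom B x y n\<^esub> f) = c \<odot>\<^bsub>GHom B' (Fo x) (Fo y) n\<^esub> Fm x y n f"
    and Fm_comp: "\<lbrakk>x \<in> GObj B; y \<in> GObj B; z \<in> GObj B; g \<in> carrier (GHom B y z m); f \<in> carrier (GHom B x y n)\<rbrakk> \<Longrightarrow>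
      Fm x z (m + n) (gcomp B x y z m n g f) = gcomp B' (Fo x) (Fo y) (Fo z) m n (Fm y z m g) (Fm x y n f)"
    and Fm_ident: "x \<in> GObj B \<Longrightarrow> Fm x x 0 (gident B x) = gident B' (Fo x)"
begin

lemma Fm_linear:
  "\<lbrakk>x \<in> GObj B; y \<in> GObj B\<rbrakk> \<Longrightarrow> linear_map K (GHom B x y n) (GHom B' (Fo x) (Fo y) n) (Fm x y n)"
  by (intro linear_map.intro linear_map_axioms.intro src.GHom_module tgt.GHom_module) (auto simp: Fm_add Fm_smult)

lemmas Fm_zero = linear_map.zero[OF Fm_linear]

lemma Fm_comp':
  "\<lbrakk>k = m + n; x \<in> GObj B; y \<in> GObj B; z \<in> GObj B; g \<in> src.hom y z m; f \<in> src.hom x y n\<rbrakk> \<Longrightarrow>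
    Fm x z k (gcomp B x y z m n g f) = gcomp B' (Fo x) (Fo y) (Fo z) m n (Fm y z m g) (Fm x y n f)"
  by (simp add: Fm_comp)

lemma Fm_gpow:
  "\<lbrakk>x \<in> GObj B; v \<in> src.hom x x n; d = int k * n\<rbrakk> \<Longrightarrow> Fm x x d (gpow B x n v k) = gpow B' (Fo x) n (Fm x x n v) k"
proof (induction k arbitrary: d)
  case (Suc k)
  have "Fm x x d (gpow B x n v (Suc k)) = gcomp B' (Fo x) (Fo x) (Fo x) n (int k * n) (Fm x x n v) (Fm x x (int k * n) (gpow B x n v k))"
    unfolding gpow.simps using Suc.prems
    by (intro Fm_comp') (auto simp: algebra_simps intro: src.gpow_closed)
  with Suc show ?case by simp
qed (simp add: Fm_ident)

text \<open>Distinct objects may have the same image, where their contributions have to be added up;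
  hence a sum of single coordinates and not a reindexing.\<close>

definition push :: "('o \<Rightarrow> int \<Rightarrow> 'm) \<Rightarrow> 'o2 \<Rightarrow> int \<Rightarrow> 'm2" where
  "push f = finsum tgt.D (\<lambda>(x, n). tgt.single (Fo x) n (Fm x x n (f x n))) (src.supp f)"

lemma push_eq:
  assumes f: "f \<in> carrier src.D" and J: "finite J" "src.supp f \<subseteq> J" "J \<subseteq> GObj B \<times> UNIV"
  shows "push f = finsum tgt.D (\<lambda>(x, n). tgt.single (Fo x) n (Fm x x n (f x n))) J"
  unfolding push_def
proof (rule tgt.D.M.add.finprod_mono_neutral_cong_left[OF J(1,2)])
  fix j assume j: "j \<in> J - src.supp f"
  obtain x n where xn: "j = (x, n)" by fastforce
  then have x: "x \<in> GObj B" using j J by auto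
  then have "f x n = \<zero>\<^bsub>GHom B x x n\<^esub>" using j xn by (auto simp: src.supp_def)
  then show "(case j of (x, n) \<Rightarrow> tgt.single (Fo x) n (Fm x x n (f x n))) = \<zero>\<^bsub>tgt.D\<^esub>"
    using x by (simp add: xn Fm_zero)
qed (use f J in \<open>auto intro!: tgt.single_closed\<close>)

lemma push_terms_closed:
  assumes "f \<in> carrier src.D" "J \<subseteq> GObj B \<times> UNIV"
  shows "(\<lambda>(x, n). tgt.single (Fo x) n (Fm x x n (f x n))) \<in> J \<rightarrow> carrier tgt.D"
  using assms by (auto intro!: tgt.single_closed)

lemma supp_subset: "src.supp f \<subseteq> GObj B \<times> UNIV"
  by (auto simp: src.supp_def)

lemma push_linear: "linear_map K src.D tgt.D push"
proof (intro linear_map.intro linear_map_axioms.intro src.diag_module tgt.diag_module)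
  fix f assume f: "f \<in> carrier src.D"
  show "push f \<in> carrier tgt.D"
    unfolding push_def using push_terms_closed[OF f supp_subset] by (rule tgt.D.M.finsum_closed)
  fix c assume c: "c \<in> carrier K"
  have "src.supp (c \<odot>\<^bsub>src.D\<^esub> f) \<subseteq> src.supp f"
    using c f by (auto simp: src.supp_def src.diag_smult_apply module.smult_r_null[OF src.GHom_module])
  then have "push (c \<odot>\<^bsub>src.D\<^esub> f) =
      finsum tgt.D (\<lambda>(x, n). tgt.single (Fo x) n (Fm x x n ((c \<odot>\<^bsub>src.D\<^esub> f) x n))) (src.supp f)"
    using c f supp_subset by (intro push_eq) auto
  also have "\<dots> = finsum tgt.D (\<lambda>j. c \<odot>\<^bsub>tgt.D\<^esub> (case j of (x, n) \<Rightarrow> tgt.single (Fo x) n (Fm x x n (f x n)))) (src.supp f)"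
  proof (rule tgt.D.M.add.finprod_cong')
    show "(\<lambda>j. c \<odot>\<^bsub>tgt.D\<^esub> (case j of (x, n) \<Rightarrow> tgt.single (Fo x) n (Fm x x n (f x n)))) \<in> src.supp f \<rightarrow> carrier tgt.D"
      by (rule Pi_I, rule tgt.D.smult_closed[OF c], rule funcset_mem[OF push_terms_closed[OF f supp_subset]])
    fix j assume "j \<in> src.supp f"
    then obtain x n where "j = (x, n)" "x \<in> GObj B" by (auto simp: src.supp_def)
    then show "(case j of (x, n) \<Rightarrow> tgt.single (Fo x) n (Fm x x n ((c \<odot>\<^bsub>src.D\<^esub> f) x n))) =
        c \<odot>\<^bsub>tgt.D\<^esub> (case j of (x, n) \<Rightarrow> tgt.single (Fo x) n (Fm x x n (f x n)))"
      using c f by (simp add: src.diag_smult_apply Fm_smult linear_map.smult[OF tgt.single_linear])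
  qed simp
  also have "\<dots> = c \<odot>\<^bsub>tgt.D\<^esub> push f"
    unfolding push_def using f c push_terms_closed[OF f supp_subset] by (intro tgt.D.finsum_smult_ldistr[symmetric]) auto
  finally show "push (c \<odot>\<^bsub>src.D\<^esub> f) = c \<odot>\<^bsub>tgt.D\<^esub> push f" .
next
  fix f g assume f: "f \<in> carrier src.D" and g: "g \<in> carrier src.D"
  let ?J = "src.supp f \<union> src.supp g"
  let ?t = "\<lambda>f (x, n). tgt.single (Fo x) n (Fm x x n (f x n))"
  have J: "finite ?J" "?J \<subseteq> GObj B \<times> UNIV" using f g supp_subset by auto
  have "src.supp (f \<oplus>\<^bsub>src.D\<^esub> g) \<subseteq> ?J"
    using f g by (auto simp: src.supp_def src.diag_add_apply abelian_monoid.l_zero[OF src.GHom_monoid])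
  then have "push (f \<oplus>\<^bsub>src.D\<^esub> g) = finsum tgt.D (?t (f \<oplus>\<^bsub>src.D\<^esub> g)) ?J"
    using f g J by (intro push_eq) auto
  also have "\<dots> = finsum tgt.D (\<lambda>j. ?t f j \<oplus>\<^bsub>tgt.D\<^esub> ?t g j) ?J"
  proof (rule tgt.D.M.add.finprod_cong')
    show "(\<lambda>j. ?t f j \<oplus>\<^bsub>tgt.D\<^esub> ?t g j) \<in> ?J \<rightarrow> carrier tgt.D"
      by (rule Pi_I, rule tgt.D.M.a_closed)
        (erule funcset_mem[OF push_terms_closed[OF f J(2)]], erule funcset_mem[OF push_terms_closed[OF g J(2)]])
    fix j assume "j \<in> ?J"
    then obtain x n where "j = (x, n)" "x \<in> GObj B" by (auto simp: src.supp_def)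
    then show "?t (f \<oplus>\<^bsub>src.D\<^esub> g) j = ?t f j \<oplus>\<^bsub>tgt.D\<^esub> ?t g j"
      using f g by (simp add: src.diag_add_apply Fm_add linear_map.add[OF tgt.single_linear])
  qed simp
  also have "\<dots> = finsum tgt.D (?t f) ?J \<oplus>\<^bsub>tgt.D\<^esub> finsum tgt.D (?t g) ?J"
    using push_terms_closed[OF f J(2)] push_terms_closed[OF g J(2)] by (rule tgt.D.M.finsum_addf)
  also have "\<dots> = push f \<oplus>\<^bsub>tgt.D\<^esub> push g"
    using push_eq[OF f J(1) _ J(2)] push_eq[OF g J(1) _ J(2)] by simp
  finally show "push (f \<oplus>\<^bsub>src.D\<^esub> g) = push f \<oplus>\<^bsub>tgt.D\<^esub> push g" .
qed

sublocale push: linear_map K src.D tgt.D push by (rule push_linear)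

lemma push_single:
  assumes "x \<in> GObj B" "v \<in> src.hom x x n"
  shows "push (src.single x n v) = tgt.single (Fo x) n (Fm x x n v)"
proof -
  have "push (src.single x n v) =
      finsum tgt.D (\<lambda>(y, m). tgt.single (Fo y) m (Fm y y m (src.single x n v y m))) {(x, n)}"
    using assms by (intro push_eq) (auto simp: src.supp_def src.single_apply split: if_splits)
  also have "\<dots> = tgt.single (Fo x) n (Fm x x n v)"
    using assms by (simp add: src.single_apply)
  finally show ?thesis .
qed

text \<open>A graded functor preserves degrees, so it sends the commutator of u and f to the one of
  their images, with the same sign.\<close>

lemma push_comm:
  assumes "c \<in> src.Comm"
  shows "push c \<in> tgt.Comm"
proof -
  have "src.Comm \<subseteq> {f \<in> carrier src.D. push f \<in> tgt.Comm}"
  proof (rule src.comm_least[OF push.vimage_submodule[OF tgt.comm_submodule]])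
    fix x y u f i j assume *: "x \<in> GObj B" "y \<in> GObj B" "u \<in> src.hom x y i" "f \<in> src.hom y x j"
    let ?v = "gcomp B x y x j i f u" and ?w = "gcomp B y x y i j u f" and ?k = "i + j"
    have v: "?v \<in> src.hom x x ?k" and w: "?w \<in> src.hom y y ?k"
      using * by (auto intro!: src.gcomp_closed')
    have "Fm x x ?k ?v = gcomp B' (Fo x) (Fo y) (Fo x) j i (Fm y x j f) (Fm x y i u)"
      "Fm y y ?k ?w = gcomp B' (Fo y) (Fo x) (Fo y) i j (Fm x y i u) (Fm y x j f)"
      using * by (auto intro!: Fm_comp')
    then have "push (src.single x ?k ?v \<ominus>\<^bsub>src.D\<^esub> src.single y ?k (sgn_mult (GHom B y y ?k) (i * j) ?w)) \<in> tgt.Comm"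
      using tgt.comm_generator[of "Fo x" "Fo y" "Fm x y i u" i "Fm y x j f" j] * v w
      by (simp add: push.minus push_single linear_map.sgn[OF Fm_linear])
    then show "src.single x ?k ?v \<ominus>\<^bsub>src.D\<^esub> src.single y ?k (sgn_mult (GHom B y y ?k) (i * j) ?w) \<in>
        {f \<in> carrier src.D. push f \<in> tgt.Comm}"
      using * v w by auto
  qed
  with assms show ?thesis by blast
qed

lemma push_cong: "src.cong_comm f g \<Longrightarrow> tgt.cong_comm (push f) (push g)"
  using push_comm by (auto simp: src.cong_comm_def tgt.cong_comm_def push.minus[symmetric])

lemma push_homogeneous:
  assumes "f \<in> diag_homogeneous B n"
  shows "push f \<in> diag_homogeneous B' n"
  unfolding push_def
proof (rule tgt.D.M.finsum_mem)
  show "diag_homogeneous B' n \<subseteq> carrier tgt.D" using tgt.diag_homogeneous_closed by blast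
  fix j assume "j \<in> src.supp f"
  then obtain x where "j = (x, n)" "x \<in> GObj B"
    using src.diag_homogeneous_apply[OF assms] by (auto simp: src.supp_def)
  then show "(case j of (x, n) \<Rightarrow> tgt.single (Fo x) n (Fm x x n (f x n))) \<in> diag_homogeneous B' n"
    using src.diag_homogeneous_closed[OF assms] by (simp add: tgt.single_homogeneous)
qed (auto simp: tgt.diag_homogeneous_zero tgt.diag_homogeneous_add)

text \<open>Prescribes b only on the objects in the image of the functor. For a dense functor this
  determines a central b.\<close>

definition corresp :: "int \<Rightarrow> ('o \<Rightarrow> 'm) \<Rightarrow> ('o2 \<Rightarrow> 'm2) \<Rightarrow> bool" where
  "corresp n a b \<longleftrightarrow> (\<forall>x\<in>GObj B. b (Fo x) = Fm x x n (a x))"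

text \<open>Push-forward is compatible with the module structures over the two centers; on a single
  coordinate this is functoriality.\<close>

lemma push_lact:
  assumes a: "a \<in> gcenter_deg B n" and b: "b \<in> gcenter_deg B' n" and ab: "corresp n a b" and f: "f \<in> carrier src.D"
  shows "push (diag_lact B n a f) = diag_lact B' n b (push f)"
proof -
  interpret lact: linear_map K src.D src.D "diag_lact B n a" by (rule src.diag_lact_linear[OF a])
  interpret lact': linear_map K tgt.D tgt.D "diag_lact B' n b" by (rule tgt.diag_lact_linear[OF b])
  show ?thesis
    using f
  proof (induction rule: src.diag_induct)
    case zero
    then show ?case by (simp add: lact.zero push.zero lact'.zero)
  next
    case (single f x m v)
    have "Fm x x (n + m) (gcomp B x x x n m (a x) v) = gcomp B' (Fo x) (Fo x) (Fo x) n m (b (Fo x)) (Fm x x m v)"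
      using single a ab by (simp add: Fm_comp corresp_def)
    with single a b show ?case
      by (simp add: lact.add push.add lact'.add push_single src.diag_lact_single[OF a _ _ refl]
          tgt.diag_lact_single[OF b _ _ refl] src.gcomp_closed)
  qed
qed

end

section \<open>Push-forward and the p-th power map\<close>

locale graded_functor_char = graded_functor K B B' Fo Fm + src: graded_category_char K B p + tgt: graded_category_char K B' p
  for K :: "('k, 'r) ring_scheme" and B :: "('k, 'o, 'm) gr_cat" and B' :: "('k, 'o2, 'm2) gr_cat"
    and Fo :: "'o \<Rightarrow> 'o2" and Fm :: "'o \<Rightarrow> 'o \<Rightarrow> int \<Rightarrow> 'm \<Rightarrow> 'm2" and p :: nat
begin

text \<open>Only a congruence: different coordinates of f can be pushed into the same coordinate of
  the target, where xi is additive just modulo commutators.\<close>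

lemma push_xi_rep:
  assumes "f \<in> carrier src.D"
  shows "tgt.cong_comm (push (src.xi_rep f)) (tgt.xi_rep (push f))"
  using assms
proof (induction rule: src.diag_induct)
  case zero
  then show ?case by (simp add: src.xi_rep_zero push.zero tgt.xi_rep_zero tgt.cong_refl)
next
  case (single f x n v)
  let ?s = "src.single x n v"
  have s: "?s \<in> carrier src.D" using single by simp
  have "tgt.cong_comm (push (src.xi_rep (f \<oplus>\<^bsub>src.D\<^esub> ?s))) (push (src.xi_rep f \<oplus>\<^bsub>src.D\<^esub> src.xi_rep ?s))"
    using single s by (intro push_cong src.xi_rep_add) auto
  also have "push (src.xi_rep f \<oplus>\<^bsub>src.D\<^esub> src.xi_rep ?s) = push (src.xi_rep f) \<oplus>\<^bsub>tgt.D\<^esub> push (src.xi_rep ?s)"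
    using single s by (intro push.add) auto
  also have "push (src.xi_rep ?s) = tgt.xi_rep (push ?s)"
    using single
    by (simp add: src.xi_rep_single[OF _ _ refl] push_single src.gpow_closed tgt.xi_rep_single[OF _ _ refl] Fm_gpow)
  also have "tgt.cong_comm (push (src.xi_rep f) \<oplus>\<^bsub>tgt.D\<^esub> tgt.xi_rep (push ?s)) (tgt.xi_rep (push f) \<oplus>\<^bsub>tgt.D\<^esub> tgt.xi_rep (push ?s))"
    using single s by (intro tgt.cong_add tgt.cong_refl) auto
  also have "tgt.cong_comm \<dots> (tgt.xi_rep (push f \<oplus>\<^bsub>tgt.D\<^esub> push ?s))"
    using single s by (intro tgt.cong_sym[OF tgt.xi_rep_add]) auto
  also have "push f \<oplus>\<^bsub>tgt.D\<^esub> push ?s = push (f \<oplus>\<^bsub>src.D\<^esub> ?s)"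
    using single s by (simp add: push.add)
  finally show ?case .
qed

lemma push_xi_rep_pow:
  assumes "f \<in> carrier src.D"
  shows "tgt.cong_comm (push ((src.xi_rep ^^ r) f)) ((tgt.xi_rep ^^ r) (push f))"
proof (induction r)
  case (Suc r)
  have "tgt.cong_comm (push ((src.xi_rep ^^ Suc r) f)) (tgt.xi_rep (push ((src.xi_rep ^^ r) f)))"
    using push_xi_rep[OF src.xi_rep_pow_closed[OF assms]] by simp
  also have "tgt.cong_comm \<dots> ((tgt.xi_rep ^^ Suc r) (push f))"
    using tgt.xi_rep_cong[OF Suc] by simp
  finally show ?case .
qed (use assms in \<open>simp add: tgt.cong_refl\<close>)

end

section \<open>Graded equivalences\<close>

text \<open>Density is required through isomorphisms of degree 0, so that conjugating by them
  creates no signs.\<close>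

locale graded_equivalence = graded_functor K B B' Fo Fm
  for K :: "('k, 'r) ring_scheme" and B :: "('k, 'o, 'm) gr_cat" and B' :: "('k, 'o2, 'm2) gr_cat"
    and Fo :: "'o \<Rightarrow> 'o2" and Fm :: "'o \<Rightarrow> 'o \<Rightarrow> int \<Rightarrow> 'm \<Rightarrow> 'm2" +
  assumes full_faithful: "\<lbrakk>x \<in> GObj B; y \<in> GObj B\<rbrakk> \<Longrightarrow>
      bij_betw (Fm x y n) (carrier (GHom B x y n)) (carrier (GHom B' (Fo x) (Fo y) n))"
    and dense: "z \<in> GObj B' \<Longrightarrow> \<exists>x\<in>GObj B. \<exists>w\<in>carrier (GHom B' (Fo x) z 0). \<exists>w'\<in>carrier (GHom B' z (Fo x) 0).
      gcomp B' (Fo x) z (Fo x) 0 0 w' w = gident B' (Fo x) \<and> gcomp B' z (Fo x) z 0 0 w w' = gident B' z"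
begin

lemma Fm_inj: "\<lbrakk>x \<in> GObj B; y \<in> GObj B; f \<in> src.hom x y n; g \<in> src.hom x y n; Fm x y n f = Fm x y n g\<rbrakk> \<Longrightarrow> f = g"
  using full_faithful[of x y n] by (auto simp: bij_betw_def dest: inj_onD)

lemma Fm_surj:
  assumes "x \<in> GObj B" "y \<in> GObj B" "g \<in> tgt.hom (Fo x) (Fo y) n"
  shows "\<exists>f\<in>src.hom x y n. Fm x y n f = g"
proof -
  have "g \<in> Fm x y n ` src.hom x y n"
    using bij_betw_imp_surj_on[OF full_faithful[OF assms(1,2)]] assms(3) by simp
  then show ?thesis by blast
qed

text \<open>The preimage and the two mutually inverse isomorphisms are bundled into one triple, so
  that a single choice yields matching data.\<close>

definition iso_witness :: "'o2 \<Rightarrow> 'o \<times> 'm2 \<times> 'm2 \<Rightarrow> bool" where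
  "iso_witness y t \<longleftrightarrow> (case t of (x, w, w') \<Rightarrow> x \<in> GObj B \<and> w \<in> tgt.hom (Fo x) y 0 \<and> w' \<in> tgt.hom y (Fo x) 0 \<and>
    gcomp B' (Fo x) y (Fo x) 0 0 w' w = gident B' (Fo x) \<and> gcomp B' y (Fo x) y 0 0 w w' = gident B' y)"

definition Go :: "'o2 \<Rightarrow> 'o" where
  "Go y = fst (SOME t. iso_witness y t)"

definition ct :: "'o2 \<Rightarrow> 'm2" where
  "ct y = fst (snd (SOME t. iso_witness y t))"

definition ct' :: "'o2 \<Rightarrow> 'm2" where
  "ct' y = snd (snd (SOME t. iso_witness y t))"

lemma iso_witness_some: "y \<in> GObj B' \<Longrightarrow> iso_witness y (Go y, ct y, ct' y)"
proof -
  assume "y \<in> GObj B'"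
  then have "\<exists>t. iso_witness y t" using dense[of y] by (fastforce simp: iso_witness_def)
  then have "iso_witness y (SOME t. iso_witness y t)" by (rule someI_ex)
  then show ?thesis by (simp add: Go_def ct_def ct'_def)
qed

lemma Go_closed [simp]: "y \<in> GObj B' \<Longrightarrow> Go y \<in> GObj B"
  and ct_closed [simp]: "y \<in> GObj B' \<Longrightarrow> ct y \<in> tgt.hom (Fo (Go y)) y 0"
  and ct'_closed [simp]: "y \<in> GObj B' \<Longrightarrow> ct' y \<in> tgt.hom y (Fo (Go y)) 0"
  and ct'_ct: "y \<in> GObj B' \<Longrightarrow> gcomp B' (Fo (Go y)) y (Fo (Go y)) 0 0 (ct' y) (ct y) = gident B' (Fo (Go y))"
  and ct_ct': "y \<in> GObj B' \<Longrightarrow> gcomp B' y (Fo (Go y)) y 0 0 (ct y) (ct' y) = gident B' y"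
  using iso_witness_some[of y] by (auto simp: iso_witness_def)

lemma ct_cancel_right:
  assumes "y \<in> GObj B'" "z \<in> GObj B'" "f \<in> tgt.hom y z n" "g \<in> tgt.hom y z n"
    and eq: "gcomp B' (Fo (Go y)) y z n 0 f (ct y) = gcomp B' (Fo (Go y)) y z n 0 g (ct y)"
  shows "f = g"
proof -
  have "gcomp B' y (Fo (Go y)) z n 0 (gcomp B' (Fo (Go y)) y z n 0 h (ct y)) (ct' y) = h" if "h \<in> tgt.hom y z n" for h
  proof -
    have "gcomp B' y (Fo (Go y)) z n 0 (gcomp B' (Fo (Go y)) y z n 0 h (ct y)) (ct' y) =
        gcomp B' y y z n 0 h (gcomp B' y (Fo (Go y)) y 0 0 (ct y) (ct' y))"
      using assms(1,2) that by (intro tgt.gcomp_assoc') auto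
    then show ?thesis using assms(1,2) that by (simp add: ct_ct' tgt.gcomp_ident_right)
  qed
  from this[OF assms(3)] this[OF assms(4)] show ?thesis unfolding eq by (rule trans[OF sym])
qed

lemma ct_cancel_left:
  assumes "y \<in> GObj B'" "z \<in> GObj B'" "f \<in> tgt.hom z (Fo (Go y)) n" "g \<in> tgt.hom z (Fo (Go y)) n"
    and eq: "gcomp B' z (Fo (Go y)) y 0 n (ct y) f = gcomp B' z (Fo (Go y)) y 0 n (ct y) g"
  shows "f = g"
proof -
  have "gcomp B' z y (Fo (Go y)) 0 n (ct' y) (gcomp B' z (Fo (Go y)) y 0 n (ct y) h) = h"
    if "h \<in> tgt.hom z (Fo (Go y)) n" for h
  proof -
    have "gcomp B' z y (Fo (Go y)) 0 n (ct' y) (gcomp B' z (Fo (Go y)) y 0 n (ct y) h) =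
        gcomp B' z (Fo (Go y)) (Fo (Go y)) 0 n (gcomp B' (Fo (Go y)) y (Fo (Go y)) 0 0 (ct' y) (ct y)) h"
      using assms(1,2) that by (intro tgt.gcomp_assoc'[symmetric]) auto
    then show ?thesis using assms(1,2) that by (simp add: ct'_ct tgt.gcomp_ident_left)
  qed
  from this[OF assms(3)] this[OF assms(4)] show ?thesis unfolding eq by (rule trans[OF sym])
qed

text \<open>The equation says that \<open>ct\<close> is natural from the composite of the functors
  to the identity. A solution exists by fullness, as \<open>ct\<close> is invertible, and
  faithfulness makes it unique.\<close>

definition Gm :: "'o2 \<Rightarrow> 'o2 \<Rightarrow> int \<Rightarrow> 'm2 \<Rightarrow> 'm" where
  "Gm y z n g = (SOME f. f \<in> src.hom (Go y) (Go z) n \<and>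
    gcomp B' (Fo (Go y)) (Fo (Go z)) z 0 n (ct z) (Fm (Go y) (Go z) n f) = gcomp B' (Fo (Go y)) y z n 0 g (ct y))"

lemma Gm_spec:
  assumes yz: "y \<in> GObj B'" "z \<in> GObj B'" and g: "g \<in> tgt.hom y z n"
  shows "Gm y z n g \<in> src.hom (Go y) (Go z) n"
    and "gcomp B' (Fo (Go y)) (Fo (Go z)) z 0 n (ct z) (Fm (Go y) (Go z) n (Gm y z n g)) = gcomp B' (Fo (Go y)) y z n 0 g (ct y)"
proof -
  let ?y = "Fo (Go y)" and ?z = "Fo (Go z)"
  have gw: "gcomp B' ?y y z n 0 g (ct y) \<in> tgt.hom ?y z n" using yz g by (intro tgt.gcomp_closed') auto
  then have cgw: "gcomp B' ?y z ?z 0 n (ct' z) (gcomp B' ?y y z n 0 g (ct y)) \<in> tgt.hom ?y ?z n"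
    using yz by (rule_tac tgt.gcomp_closed') auto
  obtain f where f: "f \<in> src.hom (Go y) (Go z) n"
    "Fm (Go y) (Go z) n f = gcomp B' ?y z ?z 0 n (ct' z) (gcomp B' ?y y z n 0 g (ct y))"
    using Fm_surj[OF Go_closed[OF yz(1)] Go_closed[OF yz(2)] cgw] by blast
  have "gcomp B' ?y ?z z 0 n (ct z) (Fm (Go y) (Go z) n f) =
      gcomp B' ?y z z 0 n (gcomp B' z ?z z 0 0 (ct z) (ct' z)) (gcomp B' ?y y z n 0 g (ct y))"
    unfolding f(2) using yz gw g by (intro tgt.gcomp_assoc'[symmetric]) auto
  also have "\<dots> = gcomp B' ?y y z n 0 g (ct y)"
    using yz gw by (simp only: ct_ct' tgt.gcomp_ident_left Fo_closed Go_closed)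
  finally have "\<exists>f. f \<in> src.hom (Go y) (Go z) n \<and>
      gcomp B' ?y ?z z 0 n (ct z) (Fm (Go y) (Go z) n f) = gcomp B' ?y y z n 0 g (ct y)"
    using f(1) by blast
  from someI_ex[OF this] show "Gm y z n g \<in> src.hom (Go y) (Go z) n"
    "gcomp B' ?y ?z z 0 n (ct z) (Fm (Go y) (Go z) n (Gm y z n g)) = gcomp B' ?y y z n 0 g (ct y)"
    by (simp_all add: Gm_def)
qed

text \<open>The functor laws of the quasi-inverse follow by checking that the expected value
  satisfies the naturality equation.\<close>

lemma Gm_eqI:
  assumes yz: "y \<in> GObj B'" "z \<in> GObj B'" and g: "g \<in> tgt.hom y z n" and f: "f \<in> src.hom (Go y) (Go z) n"
    and eq: "gcomp B' (Fo (Go y)) (Fo (Go z)) z 0 n (ct z) (Fm (Go y) (Go z) n f) = gcomp B' (Fo (Go y)) y z n 0 g (ct y)"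
  shows "Gm y z n g = f"
proof -
  have "Fm (Go y) (Go z) n (Gm y z n g) = Fm (Go y) (Go z) n f"
    by (rule ct_cancel_left[OF yz(2) Fo_closed[OF Go_closed[OF yz(1)]], where n = n])
      (use yz f in \<open>simp_all add: Gm_spec[OF yz g] eq\<close>)
  then show ?thesis using Gm_spec(1)[OF yz g] yz f Fm_inj[OF Go_closed[OF yz(1)] Go_closed[OF yz(2)]] by blast
qed

lemma inverse_functor: "graded_functor K B' B Go Gm"
proof (intro graded_functor.intro graded_functor_axioms.intro src.graded_category_axioms tgt.graded_category_axioms)
  fix x y n f g assume *: "x \<in> GObj B'" "y \<in> GObj B'" "f \<in> tgt.hom x y n" "g \<in> tgt.hom x y n"
  show "Gm x y n (f \<oplus>\<^bsub>GHom B' x y n\<^esub> g) = Gm x y n f \<oplus>\<^bsub>GHom B (Go x) (Go y) n\<^esub> Gm x y n g"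
  proof (rule Gm_eqI[OF *(1,2)])
    show "gcomp B' (Fo (Go x)) (Fo (Go y)) y 0 n (ct y) (Fm (Go x) (Go y) n (Gm x y n f \<oplus>\<^bsub>GHom B (Go x) (Go y) n\<^esub> Gm x y n g)) =
        gcomp B' (Fo (Go x)) x y n 0 (f \<oplus>\<^bsub>GHom B' x y n\<^esub> g) (ct x)"
      using * by (simp add: Fm_add Gm_spec tgt.gcomp_add_left tgt.gcomp_add_right)
  qed (use * in \<open>simp_all add: Gm_spec\<close>)
next
  fix x y c n f assume *: "x \<in> GObj B'" "y \<in> GObj B'" "c \<in> carrier K" "f \<in> tgt.hom x y n"
  show "Gm x y n (c \<odot>\<^bsub>GHom B' x y n\<^esub> f) = c \<odot>\<^bsub>GHom B (Go x) (Go y) n\<^esub> Gm x y n f"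
  proof (rule Gm_eqI[OF *(1,2)])
    show "gcomp B' (Fo (Go x)) (Fo (Go y)) y 0 n (ct y) (Fm (Go x) (Go y) n (c \<odot>\<^bsub>GHom B (Go x) (Go y) n\<^esub> Gm x y n f)) =
        gcomp B' (Fo (Go x)) x y n 0 (c \<odot>\<^bsub>GHom B' x y n\<^esub> f) (ct x)"
      using * by (simp add: Fm_smult Gm_spec tgt.gcomp_smult_left tgt.gcomp_smult_right)
  qed (use * in \<open>simp_all add: Gm_spec\<close>)
next
  fix x y z g m f n assume *: "x \<in> GObj B'" "y \<in> GObj B'" "z \<in> GObj B'" "g \<in> tgt.hom y z m" "f \<in> tgt.hom x y n"
  note Gf = Gm_spec[OF *(1,2,5)] and Gg = Gm_spec[OF *(2,3,4)]
  let ?x = "Fo (Go x)" and ?y = "Fo (Go y)" and ?z = "Fo (Go z)"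
  let ?f = "Fm (Go x) (Go y) n (Gm x y n f)" and ?g = "Fm (Go y) (Go z) m (Gm y z m g)"
  have fg: "?f \<in> tgt.hom ?x ?y n" "?g \<in> tgt.hom ?y ?z m" using * Gf Gg by auto
  show "Gm x z (m + n) (gcomp B' x y z m n g f) = gcomp B (Go x) (Go y) (Go z) m n (Gm y z m g) (Gm x y n f)"
  proof (rule Gm_eqI)
    have "gcomp B' ?x ?z z 0 (m + n) (ct z) (gcomp B' ?x ?y ?z m n ?g ?f) = gcomp B' ?x ?y z m n (gcomp B' ?y ?z z 0 m (ct z) ?g) ?f"
      using * fg by (intro tgt.gcomp_assoc'[symmetric]) auto
    also have "\<dots> = gcomp B' ?x ?y z m n (gcomp B' ?y y z m 0 g (ct y)) ?f"
      using Gg by simp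
    also have "\<dots> = gcomp B' ?x y z m n g (gcomp B' ?x ?y y 0 n (ct y) ?f)"
      using * fg by (intro tgt.gcomp_assoc') auto
    also have "\<dots> = gcomp B' ?x y z m n g (gcomp B' ?x x y n 0 f (ct x))"
      using Gf by simp
    also have "\<dots> = gcomp B' ?x x z (m + n) 0 (gcomp B' x y z m n g f) (ct x)"
      using * by (intro tgt.gcomp_assoc'[symmetric]) auto
    finally show "gcomp B' ?x ?z z 0 (m + n) (ct z) (Fm (Go x) (Go z) (m + n) (gcomp B (Go x) (Go y) (Go z) m n (Gm y z m g) (Gm x y n f))) =
        gcomp B' ?x x z (m + n) 0 (gcomp B' x y z m n g f) (ct x)"
      using * Gf Gg by (simp add: Fm_comp)
  qed (use * Gf Gg in \<open>auto intro: tgt.gcomp_closed src.gcomp_closed\<close>)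
next
  fix x assume x: "x \<in> GObj B'"
  then show "Gm x x 0 (gident B' x) = gident B (Go x)"
    by (intro Gm_eqI) (auto simp: Fm_ident tgt.gident_closed src.gident_closed tgt.gcomp_ident_left tgt.gcomp_ident_right)
qed (auto intro: Gm_spec)

section \<open>Push-forwards along an equivalence and its quasi-inverse\<close>

sublocale G: graded_functor K B' B Go Gm by (rule inverse_functor)

text \<open>Naturality of \<open>ct\<close> exhibits the image of an endomorphism under both
  functors as its conjugate, which has the same class in the cocenter.\<close>

lemma push_G_push:
  assumes "f \<in> carrier tgt.D"
  shows "tgt.cong_comm (push (G.push f)) f"
  using assms
proof (induction rule: tgt.diag_induct)
  case zero
  then show ?case by (simp add: push.zero G.push.zero tgt.cong_refl)
next
  case (single f y n v)
  have "tgt.cong_comm (tgt.single (Fo (Go y)) n (Fm (Go y) (Go y) n (Gm y y n v))) (tgt.single y n v)"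
    using single by (intro tgt.cong_single_conj[of _ _ "ct y" "ct' y"] ct'_ct ct_ct' Gm_spec) auto
  with single show ?case
    by (simp add: push.add G.push.add G.push_single push_single tgt.cong_add)
qed

text \<open>The conjugating isomorphism now has to live in B: \<open>ct\<close> and its inverse at
  \<open>Fo x\<close> are lifted by fullness, and faithfulness carries their identities back to
  B.\<close>

lemma G_push_push:
  assumes "f \<in> carrier src.D"
  shows "src.cong_comm (G.push (push f)) f"
  using assms
proof (induction rule: src.diag_induct)
  case zero
  then show ?case by (simp add: push.zero G.push.zero src.cong_refl)
next
  case (single f x n v)
  let ?y = "Go (Fo x)"
  have x: "x \<in> GObj B" "?y \<in> GObj B" and v: "v \<in> src.hom x x n" using single by auto
  obtain u where u: "u \<in> src.hom ?y x 0" "Fm ?y x 0 u = ct (Fo x)"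
    using x Fm_surj[of ?y x "ct (Fo x)" 0] by auto
  obtain u' where u': "u' \<in> src.hom x ?y 0" "Fm x ?y 0 u' = ct' (Fo x)"
    using x Fm_surj[of x ?y "ct' (Fo x)" 0] by auto
  let ?e = "Gm (Fo x) (Fo x) n (Fm x x n v)"
  have e: "?e \<in> src.hom ?y ?y n" using x v by (intro Gm_spec) auto
  have 1: "gcomp B ?y x ?y 0 0 u' u = gident B ?y"
    using x u u' by (intro Fm_inj[of ?y ?y _ 0])
      (auto simp: Fm_comp' ct'_ct Fm_ident src.gident_closed intro: src.gcomp_closed')
  have 2: "gcomp B x ?y x 0 0 u u' = gident B x"
    using x u u' by (intro Fm_inj[of x x _ 0])
      (auto simp: Fm_comp' ct_ct' Fm_ident src.gident_closed intro: src.gcomp_closed')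
  have 3: "gcomp B ?y ?y x 0 n u ?e = gcomp B ?y x x n 0 v u"
    using x u u' v e Gm_spec(2)[of "Fo x" "Fo x" "Fm x x n v" n]
    by (intro Fm_inj[of ?y x _ n]) (auto simp: Fm_comp' intro: src.gcomp_closed')
  have "src.cong_comm (src.single ?y n ?e) (src.single x n v)"
    using x(2,1) u(1) u'(1) 1 2 e v 3 by (rule src.cong_single_conj)
  with single show ?case
    by (simp add: push.add G.push.add G.push_single push_single src.cong_add)
qed

text \<open>Centrality against \<open>ct y\<close> expresses the value at y through the value at
  \<open>Fo (Go y)\<close>, where both families are prescribed.\<close>

lemma corresp_unique:
  assumes "corresp n a b" "corresp n a c" "b \<in> gcenter_deg B' n" "c \<in> gcenter_deg B' n"
  shows "b = c"
proof (rule extensionalityI[OF tgt.gcenter_deg_extensional[OF assms(3)] tgt.gcenter_deg_extensional[OF assms(4)]])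
  fix y assume y: "y \<in> GObj B'"
  have "b (Fo (Go y)) = c (Fo (Go y))" using assms(1,2) y by (simp add: corresp_def)
  then have "gcomp B' (Fo (Go y)) y y n 0 (b y) (ct y) = gcomp B' (Fo (Go y)) y y n 0 (c y) (ct y)"
    by (simp only: tgt.gcenter_deg_central'[OF assms(3) Fo_closed[OF Go_closed[OF y]] y ct_closed[OF y] refl]
      tgt.gcenter_deg_central'[OF assms(4) Fo_closed[OF Go_closed[OF y]] y ct_closed[OF y] refl])
  then show "b y = c y"
    by (rule ct_cancel_right[OF y y tgt.gcenter_deg_closed[OF assms(3) y] tgt.gcenter_deg_closed[OF assms(4) y]])
qed

text \<open>The value at y is forced: it is the conjugate by \<open>ct y\<close> of the image of a
  at \<open>Go y\<close>. The conjugating morphisms have degree 0, so the only signs are those of a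
  itself.\<close>

lemma corresp_exists:
  assumes a: "a \<in> gcenter_deg B n"
  shows "\<exists>b\<in>gcenter_deg B' n. corresp n a b"
proof -
  let ?F = "\<lambda>y. Fo (Go y)" and ?a = "\<lambda>x. Fm x x n (a x)"
  define b where "b = (\<lambda>y\<in>GObj B'. gcomp B' y (?F y) y n 0 (gcomp B' (?F y) (?F y) y 0 n (ct y) (?a (Go y))) (ct' y))"
  have Fa: "?a x \<in> tgt.hom (Fo x) (Fo x) n" if "x \<in> GObj B" for x
    using that a by simp
  have wa: "gcomp B' (?F y) (?F y) y 0 n (ct y) (?a (Go y)) \<in> tgt.hom (?F y) y n" if "y \<in> GObj B'" for y
    using that Fa[of "Go y"] by (intro tgt.gcomp_closed') auto
  have b: "b y \<in> tgt.hom y y n" if "y \<in> GObj B'" for y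
    using that wa[OF that] by (simp add: b_def) (rule tgt.gcomp_closed', auto)
  have bw: "gcomp B' (?F y) y y n 0 (b y) (ct y) = gcomp B' (?F y) (?F y) y 0 n (ct y) (?a (Go y))" if y: "y \<in> GObj B'" for y
  proof -
    have "gcomp B' (?F y) y y n 0 (b y) (ct y) = gcomp B' (?F y) (?F y) y n 0
        (gcomp B' (?F y) (?F y) y 0 n (ct y) (?a (Go y))) (gcomp B' (?F y) y (?F y) 0 0 (ct' y) (ct y))"
      using y wa[OF y] by (simp add: b_def) (intro tgt.gcomp_assoc', auto)
    then show ?thesis using y wa by (simp add: ct'_ct tgt.gcomp_ident_right)
  qed
  \<comment> \<open>On the image of the functor the conjugation is undone by centrality of a against
    a lift of \<open>ct\<close>.\<close>
  have bF: "b (Fo x) = ?a x" if x: "x \<in> GObj B" for x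
  proof (rule ct_cancel_right)
    let ?y = "Go (Fo x)"
    obtain u where u: "u \<in> src.hom ?y x 0" "Fm ?y x 0 u = ct (Fo x)"
      using x Fm_surj[of ?y x "ct (Fo x)" 0] by auto
    have "gcomp B' (Fo ?y) (Fo ?y) (Fo x) 0 n (ct (Fo x)) (?a ?y) = Fm ?y x n (gcomp B ?y ?y x 0 n u (a ?y))"
      using x u a by (simp add: Fm_comp')
    also have "gcomp B ?y ?y x 0 n u (a ?y) = gcomp B ?y x x n 0 (a x) u"
      using src.gcenter_deg_central[OF a _ x u(1) refl] x by (simp add: sgn_mult_def)
    also have "Fm ?y x n (gcomp B ?y x x n 0 (a x) u) = gcomp B' (Fo ?y) (Fo x) (Fo x) n 0 (?a x) (ct (Fo x))"
      using x u a by (simp add: Fm_comp')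
    finally show "gcomp B' (Fo ?y) (Fo x) (Fo x) n 0 (b (Fo x)) (ct (Fo x)) = gcomp B' (Fo ?y) (Fo x) (Fo x) n 0 (?a x) (ct (Fo x))"
      using bw x by simp
  qed (use x b Fa in auto)
  have "b \<in> gcenter_deg B' n"
  proof (rule tgt.gcenter_degI)
    fix y z g j assume y: "y \<in> GObj B'" and z: "z \<in> GObj B'" and g: "g \<in> tgt.hom y z j"
    let ?f = "Gm y z j g"
    let ?Ff = "Fm (Go y) (Go z) j ?f"
    note f = Gm_spec[OF y z g]
    have Ff: "?Ff \<in> tgt.hom (?F y) (?F z) j" using f y z by simp
    have zg: "gcomp B' y z z n j (b z) g \<in> tgt.hom y z (n + j)" using y z g b by (auto intro: tgt.gcomp_closed)
    have FFa: "gcomp B' (?F y) (?F z) (?F z) n j (?a (Go z)) ?Ff \<in> tgt.hom (?F y) (?F z) (n + j)"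
      using y z Ff Fa by (auto intro: tgt.gcomp_closed)
    \<comment> \<open>Both sides are compared after composition with \<open>ct y\<close>, where g
      can be replaced by the image of its lift \<open>?f\<close> and centrality of a
      applies.\<close>
    have "gcomp B' (?F y) y z (n + j) 0 (gcomp B' y y z j n g (b y)) (ct y) = gcomp B' (?F y) y z j n g (gcomp B' (?F y) y y n 0 (b y) (ct y))"
      using y z g b by (intro tgt.gcomp_assoc') auto
    also have "\<dots> = gcomp B' (?F y) (?F y) z j n (gcomp B' (?F y) y z j 0 g (ct y)) (?a (Go y))"
      unfolding bw[OF y] using y z g Fa by (intro tgt.gcomp_assoc'[symmetric]) auto
    also have "\<dots> = gcomp B' (?F y) (?F z) z 0 (n + j) (ct z) (gcomp B' (?F y) (?F y) (?F z) j n ?Ff (?a (Go y)))"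
      unfolding f(2)[symmetric] using y z g Fa Ff by (intro tgt.gcomp_assoc') auto
    also have "gcomp B' (?F y) (?F y) (?F z) j n ?Ff (?a (Go y)) = Fm (Go y) (Go z) (n + j) (gcomp B (Go y) (Go y) (Go z) j n ?f (a (Go y)))"
      using y z f a by (intro Fm_comp'[symmetric]) auto
    also have "\<dots> = sgn_mult (GHom B' (?F y) (?F z) (n + j)) (n * j) (Fm (Go y) (Go z) (n + j) (gcomp B (Go y) (Go z) (Go z) n j (a (Go z)) ?f))"
      using y z f a
      by (subst src.gcenter_deg_central[OF a _ _ f(1) refl])
        (auto intro!: linear_map.sgn[OF Fm_linear] src.gcomp_closed)
    also have "Fm (Go y) (Go z) (n + j) (gcomp B (Go y) (Go z) (Go z) n j (a (Go z)) ?f) = gcomp B' (?F y) (?F z) (?F z) n j (?a (Go z)) ?Ff"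
      using y z f a by (intro Fm_comp') auto
    also have "gcomp B' (?F y) (?F z) z 0 (n + j) (ct z) (sgn_mult (GHom B' (?F y) (?F z) (n + j)) (n * j) \<dots>) =
        sgn_mult (GHom B' (?F y) z (n + j)) (n * j) (gcomp B' (?F y) (?F z) z 0 (n + j) (ct z) \<dots>)"
      using y z FFa by (intro tgt.gcomp_sgn_right) auto
    also have "gcomp B' (?F y) (?F z) z 0 (n + j) (ct z) (gcomp B' (?F y) (?F z) (?F z) n j (?a (Go z)) ?Ff) =
        gcomp B' (?F y) (?F z) z n j (gcomp B' (?F z) z z n 0 (b z) (ct z)) ?Ff"
      unfolding bw[OF z] using y z Ff Fa by (intro tgt.gcomp_assoc'[symmetric]) auto
    also have "\<dots> = gcomp B' (?F y) z z n j (b z) (gcomp B' (?F y) (?F z) z 0 j (ct z) ?Ff)"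
      using y z Ff b by (intro tgt.gcomp_assoc') auto
    also have "\<dots> = gcomp B' (?F y) y z (n + j) 0 (gcomp B' y z z n j (b z) g) (ct y)"
      unfolding f(2) using y z g b by (intro tgt.gcomp_assoc'[symmetric]) auto
    also have "sgn_mult (GHom B' (?F y) z (n + j)) (n * j) \<dots> =
        gcomp B' (?F y) y z (n + j) 0 (sgn_mult (GHom B' y z (n + j)) (n * j) (gcomp B' y z z n j (b z) g)) (ct y)"
      using y z zg by (intro tgt.gcomp_sgn_left[symmetric]) auto
    finally show "gcomp B' y y z j n g (b y) = sgn_mult (GHom B' y z (n + j)) (n * j) (gcomp B' y z z n j (b z) g)"
      using y z zg tgt.gcomp_closed'[OF add.commute y y z g b[OF y]]
      by (intro ct_cancel_right[OF y z _ tgt.hom_sgn[OF y z zg]])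
  qed (use b in \<open>auto simp: b_def\<close>)
  with bF show ?thesis by (auto simp: corresp_def)
qed

text \<open>The values are lifted by fullness at each object; that they form a central family is an
  identity of morphisms, which faithfulness reflects.\<close>

lemma corresp_surj:
  assumes b: "b \<in> gcenter_deg B' n"
  shows "\<exists>a\<in>gcenter_deg B n. corresp n a b"
proof -
  have "\<exists>v. v \<in> src.hom x x n \<and> Fm x x n v = b (Fo x)" if "x \<in> GObj B" for x
    using that b Fm_surj[of x x "b (Fo x)" n] by auto
  then obtain c where c: "\<And>x. x \<in> GObj B \<Longrightarrow> c x \<in> src.hom x x n \<and> Fm x x n (c x) = b (Fo x)" by metis
  define a where "a = restrict c (GObj B)"
  have a: "a x \<in> src.hom x x n" "Fm x x n (a x) = b (Fo x)" if "x \<in> GObj B" for x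
    using c that by (auto simp: a_def)
  have "a \<in> gcenter_deg B n"
  proof (rule src.gcenter_degI)
    fix x y f j assume x: "x \<in> GObj B" and y: "y \<in> GObj B" and f: "f \<in> src.hom x y j"
    have cl: "gcomp B x y y n j (a y) f \<in> src.hom x y (n + j)" "gcomp B x x y j n f (a x) \<in> src.hom x y (n + j)"
      using x y f a by (auto intro: src.gcomp_closed')
    have "Fm x y (n + j) (gcomp B x x y j n f (a x)) = gcomp B' (Fo x) (Fo x) (Fo y) j n (Fm x y j f) (b (Fo x))"
      using x y f a by (simp add: Fm_comp')
    also have "\<dots> = sgn_mult (GHom B' (Fo x) (Fo y) (n + j)) (n * j) (gcomp B' (Fo x) (Fo y) (Fo y) n j (b (Fo y)) (Fm x y j f))"
      using x y f b by (intro tgt.gcenter_deg_central) auto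
    also have "\<dots> = Fm x y (n + j) (sgn_mult (GHom B x y (n + j)) (n * j) (gcomp B x y y n j (a y) f))"
      using x y f a cl by (simp add: linear_map.sgn[OF Fm_linear] Fm_comp)
    finally show "gcomp B x x y j n f (a x) = sgn_mult (GHom B x y (n + j)) (n * j) (gcomp B x y y n j (a y) f)"
      using x y cl by (intro Fm_inj[of x y _ "n + j"]) auto
  qed (use a in \<open>auto simp: a_def\<close>)
  moreover have "corresp n a b" using a(2) by (simp add: corresp_def)
  ultimately show ?thesis by blast
qed

lemma corresp_inj:
  assumes "corresp n a b" "corresp n c b" "a \<in> gcenter_deg B n" "c \<in> gcenter_deg B n"
  shows "a = c"
proof (rule extensionalityI[OF src.gcenter_deg_extensional[OF assms(3)] src.gcenter_deg_extensional[OF assms(4)]])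
  fix x assume x: "x \<in> GObj B"
  with assms show "a x = c x"
    by (intro Fm_inj[of x x _ n]) (auto simp: corresp_def)
qed

text \<open>Phrased as a definite description like \<open>induced_map\<close>, so that the two agree
  once the two correspondence relations do.\<close>

definition center_map :: "(int \<Rightarrow> 'o \<Rightarrow> 'm) \<Rightarrow> int \<Rightarrow> 'o2 \<Rightarrow> 'm2" where
  "center_map a = (\<lambda>n. THE b. b \<in> gcenter_deg B' n \<and> corresp n (a n) b)"

lemma corresp_ex1: "a \<in> gcenter_deg B n \<Longrightarrow> \<exists>!b. b \<in> gcenter_deg B' n \<and> corresp n a b"
  using corresp_exists corresp_unique by blast

lemma center_map_spec:
  assumes "a \<in> gcenter B"
  shows "center_map a n \<in> gcenter_deg B' n" "corresp n (a n) (center_map a n)"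
  using theI'[OF corresp_ex1[of "a n" n]] assms by (auto simp: center_map_def src.gcenter_iff)

lemma center_map_apply: "\<lbrakk>a \<in> gcenter B; x \<in> GObj B\<rbrakk> \<Longrightarrow> center_map a n (Fo x) = Fm x x n (a n x)"
  using center_map_spec(2) by (simp add: corresp_def)

lemma corresp_zero: "corresp n (gcenter_zero B n) (gcenter_zero B' n)"
  by (simp add: corresp_def Fm_zero)

lemma gcenter_zero_deg: "gcenter_zero B n \<in> gcenter_deg B n" "gcenter_zero B' n \<in> gcenter_deg B' n"
  unfolding gcenter_zero_def by (rule src.gcenter_deg_zero tgt.gcenter_deg_zero)+

text \<open>Makes corresponding families have the same support, so that finiteness is transported in
  both directions.\<close>

lemma corresp_zero_iff:
  assumes "corresp n a b" "a \<in> gcenter_deg B n" "b \<in> gcenter_deg B' n"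
  shows "a = gcenter_zero B n \<longleftrightarrow> b = gcenter_zero B' n"
  using assms corresp_unique[OF _ corresp_zero] corresp_inj[OF _ corresp_zero] gcenter_zero_deg by blast

lemma center_map_zero_iff:
  "a \<in> gcenter B \<Longrightarrow> center_map a n = gcenter_zero B' n \<longleftrightarrow> a n = gcenter_zero B n"
proof -
  assume a: "a \<in> gcenter B"
  then have "a n \<in> gcenter_deg B n" by (simp add: src.gcenter_iff)
  then show ?thesis using corresp_zero_iff[OF center_map_spec(2)[OF a] _ center_map_spec(1)[OF a]] by blast
qed

lemma center_map_closed: "a \<in> gcenter B \<Longrightarrow> center_map a \<in> gcenter B'"
  using center_map_spec(1) by (simp add: tgt.gcenter_iff center_map_zero_iff) (simp add: src.gcenter_iff)

lemma center_map_eqI: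
  assumes "a \<in> gcenter B" "b \<in> gcenter B'" "\<And>n. corresp n (a n) (b n)"
  shows "center_map a = b"
proof
  show "center_map a n = b n" for n
    using assms center_map_spec[OF assms(1)] by (intro corresp_unique[of n "a n"]) (auto simp: tgt.gcenter_iff)
qed

lemma center_map_iso: "center_map \<in> ring_iso src.Z tgt.Z"
proof -
  have "center_map \<in> ring_hom src.Z tgt.Z"
  proof (rule ring_hom_memI)
    fix a assume "a \<in> carrier src.Z"
    then have a: "a \<in> gcenter B" by simp
    then show "center_map a \<in> carrier tgt.Z" by (simp add: center_map_closed)
    fix b assume "b \<in> carrier src.Z"
    then have b: "b \<in> gcenter B" by simp
    show "center_map (a \<oplus>\<^bsub>src.Z\<^esub> b) = center_map a \<oplus>\<^bsub>tgt.Z\<^esub> center_map b"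
      using a b
      by (intro center_map_eqI src.add_Z_closed tgt.add_Z_closed center_map_closed)
        (auto simp: corresp_def src.add_Z tgt.add_Z center_map_apply Fm_add)
    show "center_map (a \<otimes>\<^bsub>src.Z\<^esub> b) = center_map a \<otimes>\<^bsub>tgt.Z\<^esub> center_map b"
    \<comment> \<open>By uniqueness it suffices to compare the two sides at the objects
      \<open>Fo x\<close>.\<close>
    proof (intro center_map_eqI src.mult_Z_closed tgt.mult_Z_closed center_map_closed a b)
      fix n
      obtain I where I: "finite I" "\<And>n x. \<lbrakk>n \<notin> I; x \<in> GObj B\<rbrakk> \<Longrightarrow> a n x = \<zero>\<^bsub>GHom B x x n\<^esub>"
        using src.gcenter_support[OF a] by metis
      show "corresp n ((a \<otimes>\<^bsub>src.Z\<^esub> b) n) ((center_map a \<otimes>\<^bsub>tgt.Z\<^esub> center_map b) n)"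
        unfolding corresp_def
      proof
        fix x assume x: "x \<in> GObj B"
        let ?M = "GHom B' (Fo x) (Fo x) n"
        let ?t = "\<lambda>i. gcomp B x x x i (n - i) (a i x) (b (n - i) x)"
        have "(center_map a \<otimes>\<^bsub>tgt.Z\<^esub> center_map b) n (Fo x) = finsum ?M
            (\<lambda>i. gcomp B' (Fo x) (Fo x) (Fo x) i (n - i) (center_map a i (Fo x)) (center_map b (n - i) (Fo x))) I"
          using x I by (intro tgt.mult_Z_apply center_map_closed a b) (auto simp: center_map_apply a Fm_zero)
        also have "\<dots> = finsum ?M (\<lambda>i. Fm x x n (?t i)) I"
          using x a b
          by (intro abelian_monoid.finsum_cong'[OF tgt.GHom_monoid]) (auto simp: center_map_apply Fm_comp' intro!: tgt.gcomp_closed')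
        also have "\<dots> = Fm x x n (finsum (GHom B x x n) ?t I)"
          using x a b by (intro linear_map.finsum[OF Fm_linear, symmetric]) auto
        also have "finsum (GHom B x x n) ?t I = (a \<otimes>\<^bsub>src.Z\<^esub> b) n x"
          using x I by (intro src.mult_Z_apply[symmetric] a b) auto
        finally show "(center_map a \<otimes>\<^bsub>tgt.Z\<^esub> center_map b) n (Fo x) = Fm x x n ((a \<otimes>\<^bsub>src.Z\<^esub> b) n x)" .
      qed
    qed
  next
    show "center_map \<one>\<^bsub>src.Z\<^esub> = \<one>\<^bsub>tgt.Z\<^esub>"
      by (intro center_map_eqI src.one_Z_closed tgt.one_Z_closed)
        (auto simp: corresp_def src.one_Z tgt.one_Z Fm_ident Fm_zero)
  qed
  moreover have "inj_on center_map (gcenter B)"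
  proof (rule inj_onI, rule ext)
    fix a c n assume "a \<in> gcenter B" "c \<in> gcenter B" "center_map a = center_map c"
    then show "a n = c n"
      using center_map_spec(2)[of a n] center_map_spec(2)[of c n]
      by (intro corresp_inj[of n _ "center_map a n"]) (auto simp: src.gcenter_iff)
  qed
  moreover have "b \<in> center_map ` gcenter B" if b: "b \<in> gcenter B'" for b
  proof -
    have "\<exists>a. a \<in> gcenter_deg B n \<and> corresp n a (b n)" for n
      using corresp_surj[of "b n" n] b by (auto simp: tgt.gcenter_iff)
    then obtain a where a: "\<And>n. a n \<in> gcenter_deg B n \<and> corresp n (a n) (b n)" by metis
    have "a n = gcenter_zero B n \<longleftrightarrow> b n = gcenter_zero B' n" for n
      using corresp_zero_iff[of n "a n" "b n"] a[of n] b by (simp add: tgt.gcenter_iff)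
    then have "{n. a n \<noteq> gcenter_zero B n} = {n. b n \<noteq> gcenter_zero B' n}" by simp
    then have "a \<in> gcenter B" using a b by (simp add: src.gcenter_iff tgt.gcenter_iff)
    moreover have "b = center_map a" using calculation b a by (intro center_map_eqI[symmetric]) auto
    ultimately show ?thesis by blast
  qed
  ultimately show ?thesis
    using center_map_closed by (auto simp: ring_iso_def bij_betw_def)
qed

lemma center_map_image: "center_map ` gcenter B = gcenter B'"
  using center_map_iso by (auto simp: ring_iso_def bij_betw_def)

lemma center_map_graded_iso: "graded_algebra_iso K src.Z tgt.Z center_map"
  unfolding graded_algebra_iso_def
proof (intro conjI ballI allI center_map_iso)
  fix c a assume "c \<in> carrier K" "a \<in> carrier src.Z"
  then show "center_map (c \<odot>\<^bsub>src.Z\<^esub> a) = c \<odot>\<^bsub>tgt.Z\<^esub> center_map a"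
    by (intro center_map_eqI src.smult_Z_closed tgt.smult_Z_closed center_map_closed)
      (auto simp: corresp_def src.smult_Z tgt.smult_Z center_map_apply Fm_smult)
next
  fix n
  have "center_map a \<in> homogeneous tgt.Z n \<longleftrightarrow> a \<in> homogeneous src.Z n" if "a \<in> gcenter B" for a
    using that center_map_zero_iff[OF that] by (simp add: homogeneous_def src.zero_Z tgt.zero_Z center_map_closed)
  then show "center_map ` homogeneous src.Z n = homogeneous tgt.Z n"
    by (intro image_eq_of_iff[OF center_map_image]) (auto simp: homogeneous_def)
qed

end

section \<open>Transfer of the ideals along an equivalence\<close>

locale graded_equivalence_char = graded_equivalence K B B' Fo Fm + graded_functor_char K B B' Fo Fm p
  for K :: "('k, 'r) ring_scheme" and B :: "('k, 'o, 'm) gr_cat" and B' :: "('k, 'o2, 'm2) gr_cat"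
    and Fo :: "'o \<Rightarrow> 'o2" and Fm :: "'o \<Rightarrow> 'o \<Rightarrow> int \<Rightarrow> 'm \<Rightarrow> 'm2" and p :: nat
begin

sublocale G: graded_functor_char K B' B Go Gm p ..

text \<open>Push-forward along either functor preserves degrees, [B,B] and T_r. If a kills the image
  of f under the quasi-inverse, pushing forward shows that b kills f; conversely, if b kills the
  push-forward of f, going back along the quasi-inverse shows that a kills f.\<close>

lemma K_deg_transfer:
  assumes a: "a \<in> gcenter_deg B n" and b: "b \<in> gcenter_deg B' n" and ab: "corresp n a b"
  shows "a \<in> K_deg K B p r s n \<longleftrightarrow> b \<in> K_deg K B' p r s n"
proof
  assume L: "a \<in> K_deg K B p r s n"
  have "diag_lact B' n b f \<in> tgt.Comm" if f: "f \<in> diag_homogeneous B' (s - n)" and T: "(tgt.xi_rep ^^ r) f \<in> tgt.Comm" for f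
  proof -
    have fD: "f \<in> carrier tgt.D" using f by (rule tgt.diag_homogeneous_closed)
    have "(src.xi_rep ^^ r) (G.push f) \<in> src.Comm"
      using src.cong_comm_iff[OF G.push_xi_rep_pow[OF fD]] G.push_comm[OF T] by simp
    then have "diag_lact B n a (G.push f) \<in> src.Comm"
      using L G.push_homogeneous[OF f] by (simp add: src.K_deg_iff)
    then have "push (diag_lact B n a (G.push f)) \<in> tgt.Comm" by (rule push_comm)
    then have "diag_lact B' n b (push (G.push f)) \<in> tgt.Comm"
      using push_lact[OF a b ab] fD by simp
    moreover have "tgt.cong_comm (diag_lact B' n b (push (G.push f))) (diag_lact B' n b f)"
      using tgt.diag_lact_linear[OF b] tgt.diag_lact_comm[OF b] push_G_push[OF fD] by (rule tgt.cong_linear)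
    ultimately show ?thesis using tgt.cong_comm_iff by blast
  qed
  with b show "b \<in> K_deg K B' p r s n" by (simp add: tgt.K_deg_iff)
next
  assume R: "b \<in> K_deg K B' p r s n"
  have "diag_lact B n a f \<in> src.Comm" if f: "f \<in> diag_homogeneous B (s - n)" and T: "(src.xi_rep ^^ r) f \<in> src.Comm" for f
  proof -
    have fD: "f \<in> carrier src.D" using f by (rule src.diag_homogeneous_closed)
    have aD: "diag_lact B n a f \<in> carrier src.D"
      using src.diag_act_closed(1)[OF src.gcenter_deg_closed[OF a] fD] .
    have "(tgt.xi_rep ^^ r) (push f) \<in> tgt.Comm"
      using tgt.cong_comm_iff[OF push_xi_rep_pow[OF fD]] push_comm[OF T] by simp
    then have "diag_lact B' n b (push f) \<in> tgt.Comm"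
      using R push_homogeneous[OF f] by (simp add: tgt.K_deg_iff)
    then have "G.push (push (diag_lact B n a f)) \<in> src.Comm"
      using push_lact[OF a b ab fD] G.push_comm by simp
    then show ?thesis using src.cong_comm_iff[OF G_push_push[OF aD]] by simp
  qed
  with a show "a \<in> K_deg K B p r s n" by (simp add: src.K_deg_iff)
qed

lemma center_map_K_r: "center_map ` K_r K B p r = K_r K B' p r"
proof -
  have "a \<in> K_r K B p r \<longleftrightarrow> center_map a \<in> K_r K B' p r" if a: "a \<in> gcenter B" for a
  proof -
    have "a n \<in> K_deg K B p r s n \<longleftrightarrow> center_map a n \<in> K_deg K B' p r s n" for s n
      using a center_map_spec[OF a] by (intro K_deg_transfer) (auto simp: src.gcenter_iff)
    then show ?thesis using a center_map_closed[OF a] by (simp add: src.K_r_eq tgt.K_r_eq)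
  qed
  moreover have "K_r K B p r \<subseteq> gcenter B" "K_r K B' p r \<subseteq> gcenter B'"
    by (auto simp: src.K_r_eq tgt.K_r_eq)
  ultimately show ?thesis by (intro image_eq_of_iff[OF center_map_image]) simp_all
qed

end

section \<open>Linear categories and their functors\<close>

definition iso_mor :: "('k, 'o, 'm) lin_cat \<Rightarrow> 'o \<Rightarrow> 'o \<Rightarrow> 'm \<Rightarrow> bool" where
  "iso_mor A x y f \<longleftrightarrow> f \<in> carrier (Hom A x y) \<and> (\<exists>g. inverse_morphism A x y f g)"

lemma nat_iso_iff:
  "nat_iso A A' F G \<eta> \<longleftrightarrow> (\<forall>x\<in>Obj A. iso_mor A' (fobj F x) (fobj G x) (\<eta> x)) \<and>
    (\<forall>x\<in>Obj A. \<forall>y\<in>Obj A. \<forall>f\<in>carrier (Hom A x y).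
        cat_comp A' (fobj F x) (fobj F y) (fobj G y) (\<eta> y) (fmor F x y f)
      = cat_comp A' (fobj F x) (fobj G x) (fobj G y) (fmor G x y f) (\<eta> x))"
  unfolding nat_iso_def nat_trans_def iso_mor_def by blast

section \<open>Isomorphisms in a linear category\<close>

context linear_category
begin

lemma inverse_morphism_unique:
  assumes xy: "x \<in> Obj A" "y \<in> Obj A" and f: "f \<in> carrier (Hom A x y)"
    and g: "inverse_morphism A x y f g" and h: "inverse_morphism A x y f h"
  shows "g = h"
proof -
  have gh: "g \<in> carrier (Hom A y x)" "h \<in> carrier (Hom A y x)"
    "cat_comp A x y x g f = ident A x" "cat_comp A y x y f h = ident A y"
    using g h by (auto simp: inverse_morphism_def)
  have "g = cat_comp A y y x g (cat_comp A y x y f h)"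
    using xy gh by (simp add: comp_ident_right)
  also have "\<dots> = cat_comp A y x x (cat_comp A x y x g f) h"
    using xy gh f comp_assoc[of y x y x g f h] by simp
  also have "\<dots> = h" using xy gh by (simp add: comp_ident_left)
  finally show ?thesis .
qed

lemma inv_mor_eqI:
  "\<lbrakk>x \<in> Obj A; y \<in> Obj A; f \<in> carrier (Hom A x y); inverse_morphism A x y f g\<rbrakk> \<Longrightarrow> inv_mor A x y f = g"
  unfolding inv_mor_def using inverse_morphism_unique by blast

lemma inv_mor_inverse:
  "\<lbrakk>x \<in> Obj A; y \<in> Obj A; iso_mor A x y f\<rbrakk> \<Longrightarrow> inverse_morphism A x y f (inv_mor A x y f)"
  unfolding iso_mor_def using inv_mor_eqI by metis

lemma inv_mor:
  assumes "x \<in> Obj A" "y \<in> Obj A" "iso_mor A x y f"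
  shows "inv_mor A x y f \<in> carrier (Hom A y x)"
    and "cat_comp A x y x (inv_mor A x y f) f = ident A x"
    and "cat_comp A y x y f (inv_mor A x y f) = ident A y"
  using inv_mor_inverse[OF assms] by (auto simp: inverse_morphism_def)

lemma iso_cancel_left:
  assumes "x \<in> Obj A" "y \<in> Obj A" "z \<in> Obj A" "iso_mor A y z f"
    and "g \<in> carrier (Hom A x y)" "h \<in> carrier (Hom A x y)" "cat_comp A x y z f g = cat_comp A x y z f h"
  shows "g = h"
proof -
  have "cat_comp A x z y (inv_mor A y z f) (cat_comp A x y z f k) = k" if "k \<in> carrier (Hom A x y)" for k
    using assms(1-4) that inv_mor[OF assms(2,3,4)] comp_assoc[of x y z y "inv_mor A y z f" f k]
    by (simp add: iso_mor_def comp_ident_left)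
  from this[OF assms(5)] this[OF assms(6)] show ?thesis unfolding assms(7) by (rule trans[OF sym])
qed

lemma iso_cancel_right:
  assumes "x \<in> Obj A" "y \<in> Obj A" "z \<in> Obj A" "iso_mor A x y f"
    and "g \<in> carrier (Hom A y z)" "h \<in> carrier (Hom A y z)" "cat_comp A x y z g f = cat_comp A x y z h f"
  shows "g = h"
proof -
  have "cat_comp A y x z (cat_comp A x y z k f) (inv_mor A x y f) = k" if "k \<in> carrier (Hom A y z)" for k
    using assms(1-4) that inv_mor[OF assms(1,2,4)] comp_assoc[of y x y z k f "inv_mor A x y f"]
    by (simp add: iso_mor_def comp_ident_right)
  from this[OF assms(5)] this[OF assms(6)] show ?thesis unfolding assms(7) by (rule trans[OF sym])
qed

lemma iso_mor_inv: "\<lbrakk>x \<in> Obj A; y \<in> Obj A; iso_mor A x y f\<rbrakk> \<Longrightarrow> iso_mor A y x (inv_mor A x y f)"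
  using inv_mor[of x y f] unfolding iso_mor_def inverse_morphism_def by blast

lemma iso_mor_ident: "x \<in> Obj A \<Longrightarrow> iso_mor A x x (ident A x)"
  using ident_closed[of x] comp_ident_left[of x x "ident A x"] unfolding iso_mor_def inverse_morphism_def by blast

lemma iso_mor_comp:
  assumes xyz: "x \<in> Obj A" "y \<in> Obj A" "z \<in> Obj A" and g: "iso_mor A y z g" and f: "iso_mor A x y f"
  shows "iso_mor A x z (cat_comp A x y z g f)"
proof -
  note gi = inv_mor[OF xyz(2,3) g] and fi = inv_mor[OF xyz(1,2) f]
  have gf: "g \<in> carrier (Hom A y z)" "f \<in> carrier (Hom A x y)" using f g by (auto simp: iso_mor_def)
  let ?f = "inv_mor A x y f" and ?g = "inv_mor A y z g"
  have gf': "cat_comp A x y z g f \<in> carrier (Hom A x z)" using xyz gf by (intro comp_closed)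
  have "cat_comp A x z x (cat_comp A z y x ?f ?g) (cat_comp A x y z g f) = cat_comp A x y x ?f (cat_comp A x z y ?g (cat_comp A x y z g f))"
    using xyz gf gi fi gf' by (intro comp_assoc)
  also have "cat_comp A x z y ?g (cat_comp A x y z g f) = cat_comp A x y y (cat_comp A y z y ?g g) f"
    using xyz gf gi by (intro comp_assoc[symmetric])
  finally have 1: "cat_comp A x z x (cat_comp A z y x ?f ?g) (cat_comp A x y z g f) = ident A x"
    using xyz gf gi fi by (simp add: comp_ident_left)
  have "cat_comp A z x z (cat_comp A x y z g f) (cat_comp A z y x ?f ?g) = cat_comp A z y z g (cat_comp A z x y f (cat_comp A z y x ?f ?g))"
    using xyz gf gi fi by (intro comp_assoc comp_closed)
  also have "cat_comp A z x y f (cat_comp A z y x ?f ?g) = cat_comp A z y y (cat_comp A y x y f ?f) ?g"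
    using xyz gf gi fi by (intro comp_assoc[symmetric])
  finally have 2: "cat_comp A z x z (cat_comp A x y z g f) (cat_comp A z y x ?f ?g) = ident A z"
    using xyz gf gi fi by (simp add: comp_ident_left)
  have "cat_comp A z y x ?f ?g \<in> carrier (Hom A z x)" using xyz gi fi by (intro comp_closed)
  with 1 2 gf' show ?thesis unfolding iso_mor_def inverse_morphism_def by blast
qed

end

section \<open>Composites, powers and faithfulness of linear functors\<close>

lemma functor_simps [simp]:
  "fobj functor_id x = x" "fmor functor_id x y f = f"
  "fobj (functor_comp G F) x = fobj G (fobj F x)"
  "fmor (functor_comp G F) x y f = fmor G (fobj F x) (fobj F y) (fmor F x y f)"
  by (simp_all add: functor_id_def functor_comp_def)

lemma functor_id_linear: "linear_functor K A A functor_id"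
  by unfold_locales auto

lemma functor_comp_linear:
  assumes "linear_functor K A A' F" "linear_functor K A' A'' G"
  shows "linear_functor K A A'' (functor_comp G F)"
proof -
  interpret F: linear_functor K A A' F by fact
  interpret G: linear_functor K A' A'' G by fact
  show ?thesis
    by unfold_locales
      (simp_all add: F.fobj_closed G.fobj_closed F.fmor_closed G.fmor_closed F.fmor_add G.fmor_add
        F.fmor_smult G.fmor_smult F.fmor_comp G.fmor_comp F.fmor_ident G.fmor_ident)
qed

lemma functor_npow_linear: "linear_functor K A A S \<Longrightarrow> linear_functor K A A (functor_npow S n)"
  by (induction n) (auto intro: functor_id_linear functor_comp_linear)

lemma functor_eqD:
  assumes "functor_eq A F G"
  shows "x \<in> Obj A \<Longrightarrow> fobj F x = fobj G x"
    and "\<lbrakk>x \<in> Obj A; y \<in> Obj A; f \<in> carrier (Hom A x y)\<rbrakk> \<Longrightarrow> fmor F x y f = fmor G x y f"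
  using assms by (auto simp: functor_eq_def)

lemma functor_eq_linear:
  assumes "functor_eq A F G" "linear_functor K A A' G" "linear_category K A"
  shows "linear_functor K A A' F"
proof -
  interpret G: linear_functor K A A' G by fact
  interpret linear_category K A by fact
  have smult: "c \<odot>\<^bsub>Hom A x y\<^esub> f \<in> carrier (Hom A x y)"
    if "x \<in> Obj A" "y \<in> Obj A" "f \<in> carrier (Hom A x y)" "c \<in> carrier K" for x y f c
  proof -
    interpret module K "Hom A x y" using that by (intro Hom_module)
    show ?thesis using that by auto
  qed
  have add: "f \<oplus>\<^bsub>Hom A x y\<^esub> g \<in> carrier (Hom A x y)"
    if "x \<in> Obj A" "y \<in> Obj A" "f \<in> carrier (Hom A x y)" "g \<in> carrier (Hom A x y)" for x y f g
  proof -
    interpret module K "Hom A x y" using that by (intro Hom_module)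
    show ?thesis using that by auto
  qed
  note eq = functor_eqD[OF assms(1)]
  show ?thesis
  proof
    show "fmor F x z (cat_comp A x y z g f) = cat_comp A' (fobj F x) (fobj F y) (fobj F z) (fmor F y z g) (fmor F x y f)"
      if "x \<in> Obj A" "y \<in> Obj A" "z \<in> Obj A" "g \<in> carrier (Hom A y z)" "f \<in> carrier (Hom A x y)" for x y z g f
      using that comp_closed[OF that] by (simp add: eq G.fmor_comp)
  qed (simp_all add: eq add smult ident_closed G.fobj_closed G.fmor_closed G.fmor_add G.fmor_smult G.fmor_ident)
qed

lemma functor_iso_mor:
  assumes "linear_category K A" "linear_functor K A A' F" "x \<in> Obj A" "y \<in> Obj A" "iso_mor A x y f"
    and A': "linear_category K A'"
  shows "iso_mor A' (fobj F x) (fobj F y) (fmor F x y f)"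
    and "inv_mor A' (fobj F x) (fobj F y) (fmor F x y f) = fmor F y x (inv_mor A x y f)"
proof -
  interpret A: linear_category K A by fact
  interpret F: linear_functor K A A' F by fact
  note i = A.inv_mor[OF assms(3-5)]
  have f: "f \<in> carrier (Hom A x y)" using assms by (simp add: iso_mor_def)
  have inv: "inverse_morphism A' (fobj F x) (fobj F y) (fmor F x y f) (fmor F y x (inv_mor A x y f))"
    using assms(3,4) f i F.fmor_comp[of x y x "inv_mor A x y f" f] F.fmor_comp[of y x y f "inv_mor A x y f"]
    by (simp add: inverse_morphism_def F.fmor_closed F.fmor_ident)
  then show "iso_mor A' (fobj F x) (fobj F y) (fmor F x y f)"
    using assms(3,4) f F.fmor_closed unfolding iso_mor_def by blast
  show "inv_mor A' (fobj F x) (fobj F y) (fmor F x y f) = fmor F y x (inv_mor A x y f)"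
    using inv assms(3,4) f by (intro linear_category.inv_mor_eqI[OF A']) (auto simp: F.fobj_closed F.fmor_closed)
qed

text \<open>Naturality of the invertible \<open>\<alpha>\<close> recovers f from its image. This
  applies to an equivalence and, with the roles exchanged, to its quasi-inverse.\<close>

lemma faithful_if_left_inverse:
  assumes "linear_category K A" "linear_functor K A A' F" "linear_functor K A' A G"
    and \<alpha>: "nat_iso A A (functor_comp G F) functor_id \<alpha>"
    and "x \<in> Obj A" "y \<in> Obj A" "f \<in> carrier (Hom A x y)" "g \<in> carrier (Hom A x y)" "fmor F x y f = fmor F x y g"
  shows "f = g"
proof -
  interpret A: linear_category K A by fact
  interpret F: linear_functor K A A' F by fact
  interpret G: linear_functor K A' A G by fact
  have nat: "cat_comp A (fobj G (fobj F x)) x y h (\<alpha> x) = cat_comp A (fobj G (fobj F x)) (fobj G (fobj F y)) y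
      (\<alpha> y) (fmor G (fobj F x) (fobj F y) (fmor F x y h))" if "h \<in> carrier (Hom A x y)" for h
    using \<alpha> assms(5,6) that unfolding nat_iso_iff by simp
  have "cat_comp A (fobj G (fobj F x)) x y f (\<alpha> x) = cat_comp A (fobj G (fobj F x)) x y g (\<alpha> x)"
    unfolding nat[OF assms(7)] nat[OF assms(8)] assms(9) ..
  moreover have "iso_mor A (fobj G (fobj F x)) x (\<alpha> x)"
    using \<alpha> assms(5) unfolding nat_iso_iff by auto
  ultimately show ?thesis
    by (intro A.iso_cancel_right[OF G.fobj_closed[OF F.fobj_closed[OF assms(5)]] assms(5,6) _ assms(7,8)])
qed

text \<open>An equivalence between consecutive cases supplies the upward and the downward induction
  step at once.\<close>

lemma int_induct_iff:
  fixes Q :: "int \<Rightarrow> bool"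
  assumes "Q 0" "\<And>m. Q m \<longleftrightarrow> Q (m + 1)"
  shows "Q m"
proof (induction m rule: int_induct[of _ 0])
  case (step2 i)
  then show ?case using assms(2)[of "i - 1"] by simp
qed (use assms in auto)

section \<open>The orbit category\<close>

locale shift_category = linear_category K A for K :: "('k, 'r) ring_scheme" and A :: "('k, 'o, 'm) lin_cat" +
  fixes S :: "('o, 'm, 'o, 'm) fnctr"
  assumes cring: "cring K" and automorphism: "automorphism K A S"
begin

section \<open>The shift, its inverse and its integer powers\<close>

abbreviation T :: "('o, 'm, 'o, 'm) fnctr" where
  "T \<equiv> functor_inv A S"

abbreviation P :: "int \<Rightarrow> ('o, 'm, 'o, 'm) fnctr" where
  "P \<equiv> functor_pow A S"

abbreviation B :: "('k, 'o, 'm) gr_cat" where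
  "B \<equiv> orbit_cat A S"

sublocale S: linear_functor K A A S
  using automorphism by (simp add: automorphism_def)

text \<open>\<open>functor_inv\<close> is written with \<open>inv_into\<close>, object by object and
  hom set by hom set; comparison with an inverse functor known to exist lets it inherit
  functoriality and linearity.\<close>

lemma functor_inv_eq:
  assumes G: "linear_functor K A A G" and GS: "functor_eq A (functor_comp G S) functor_id"
    and SG: "functor_eq A (functor_comp S G) functor_id"
  shows "functor_eq A T G"
proof -
  interpret G: linear_functor K A A G by (rule G)
  have "inj_on (fobj S) (Obj A)"
    using functor_eqD(1)[OF GS] by (intro inj_on_inverseI[of _ "fobj G"]) simp
  then have o: "fobj T x = fobj G x" if "x \<in> Obj A" for x
    using that functor_eqD(1)[OF SG, of x] inv_into_f_f[of "fobj S" "Obj A" "fobj G x"]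
    by (simp add: functor_inv_def Let_def G.fobj_closed)
  have "fmor T x y f = fmor G x y f" if xy: "x \<in> Obj A" "y \<in> Obj A" and f: "f \<in> carrier (Hom A x y)" for x y f
  proof -
    let ?x = "fobj G x" and ?y = "fobj G y"
    have "inj_on (fmor S ?x ?y) (carrier (Hom A ?x ?y))"
      using functor_eqD(2)[OF GS, of ?x ?y] xy
      by (intro inj_on_inverseI[of _ "fmor G (fobj S ?x) (fobj S ?y)"]) (simp add: G.fobj_closed)
    moreover have "fmor S ?x ?y (fmor G x y f) = f"
      using functor_eqD(2)[OF SG xy f] by simp
    moreover have "fmor T x y f = inv_into (carrier (Hom A (fobj T x) (fobj T y))) (fmor S (fobj T x) (fobj T y)) f"
      by (simp add: functor_inv_def Let_def)
    ultimately show ?thesis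
      using G.fmor_closed[OF xy f] inv_into_f_f[of "fmor S ?x ?y" "carrier (Hom A ?x ?y)" "fmor G x y f"] xy
      by (simp add: o)
  qed
  with o show ?thesis by (simp add: functor_eq_def)
qed

lemma T_inverse:
  "linear_functor K A A T" "functor_eq A (functor_comp T S) functor_id" "functor_eq A (functor_comp S T) functor_id"
proof -
  obtain G where G: "linear_functor K A A G" "functor_eq A (functor_comp G S) functor_id" "functor_eq A (functor_comp S G) functor_id"
    using automorphism unfolding automorphism_def by blast
  interpret G: linear_functor K A A G by (rule G(1))
  note TG = functor_inv_eq[OF G]
  show "linear_functor K A A T" using functor_eq_linear[OF TG G(1) linear_category_axioms] .
  show "functor_eq A (functor_comp T S) functor_id" "functor_eq A (functor_comp S T) functor_id"
    using functor_eqD[OF TG] functor_eqD[OF G(2)] functor_eqD[OF G(3)]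
    by (simp_all add: functor_eq_def S.fobj_closed S.fmor_closed)
qed

sublocale T: linear_functor K A A T by (rule T_inverse)

lemma T_S: "x \<in> Obj A \<Longrightarrow> fobj T (fobj S x) = x"
  "\<lbrakk>x \<in> Obj A; y \<in> Obj A; f \<in> carrier (Hom A x y)\<rbrakk> \<Longrightarrow> fmor T (fobj S x) (fobj S y) (fmor S x y f) = f"
  using functor_eqD[OF T_inverse(2)] by simp_all

lemma S_T: "x \<in> Obj A \<Longrightarrow> fobj S (fobj T x) = x"
  "\<lbrakk>x \<in> Obj A; y \<in> Obj A; f \<in> carrier (Hom A x y)\<rbrakk> \<Longrightarrow> fmor S (fobj T x) (fobj T y) (fmor T x y f) = f"
  using functor_eqD[OF T_inverse(3)] by simp_all

lemma S_faithful:
  "\<lbrakk>x \<in> Obj A; y \<in> Obj A; f \<in> carrier (Hom A x y); g \<in> carrier (Hom A x y); fmor S x y f = fmor S x y g\<rbrakk> \<Longrightarrow> f = g"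
  by (metis T_S(2))

lemma P_linear: "linear_functor K A A (P n)"
  by (simp add: functor_pow_def functor_npow_linear S.linear_functor_axioms T_inverse(1))

lemma P_obj [simp]: "x \<in> Obj A \<Longrightarrow> fobj (P n) x \<in> Obj A"
  by (rule linear_functor.fobj_closed[OF P_linear])

lemma P_mor [simp]:
  "\<lbrakk>x \<in> Obj A; y \<in> Obj A; f \<in> carrier (Hom A x y)\<rbrakk> \<Longrightarrow> fmor (P n) x y f \<in> carrier (Hom A (fobj (P n) x) (fobj (P n) y))"
  by (rule linear_functor.fmor_closed[OF P_linear])

lemma P_zero [simp]: "P 0 = functor_id"
  by (simp add: functor_pow_def)

lemma P_neg: "P (- int k) = functor_npow T k"
  by (cases "k = 0") (simp_all add: functor_pow_def)

lemma P_nonneg: "P (int k) = functor_npow S k"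
  by (simp add: functor_pow_def)

text \<open>Below 0 the definition recurses with the inverse functor; cancelling that against S
  gives one recursion for all integers.\<close>

lemma P_step: "functor_eq A (P (n + 1)) (functor_comp S (P n))"
proof (cases "0 \<le> n")
  case True
  then obtain k where k: "n = int k" using nonneg_int_cases by blast
  then have "n + 1 = int (Suc k)" by simp
  then have "P (n + 1) = functor_npow S (Suc k)" by (simp only: P_nonneg)
  then show ?thesis by (simp add: k P_nonneg functor_eq_def)
next
  case False
  define k where "k = nat (- n - 1)"
  have n: "n = - int (Suc k)" "n + 1 = - int k" using False by (simp_all add: k_def)
  have "P n = functor_comp T (P (n + 1))"
    unfolding n(2) unfolding n(1) P_neg by simp
  then show ?thesis by (simp add: functor_eq_def S_T)
qed

lemmas P_step' = functor_eqD[OF P_step, simplified]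

text \<open>The shift is an automorphism, so this is an equality and not just an isomorphism;
  composites in the orbit category need it to have the right target. The downward step cancels S by
  its inverse on objects and by faithfulness on morphisms.\<close>

lemma P_add: "functor_eq A (P (m + n)) (functor_comp (P m) (P n))"
proof (rule int_induct_iff[of "\<lambda>m. functor_eq A (P (m + n)) (functor_comp (P m) (P n))" m])
  show "functor_eq A (P (0 + n)) (functor_comp (P 0) (P n))" by (simp add: functor_eq_def)
  fix m
  have 1: "m + 1 + n = m + n + 1" by simp
  show "functor_eq A (P (m + n)) (functor_comp (P m) (P n)) \<longleftrightarrow> functor_eq A (P (m + 1 + n)) (functor_comp (P (m + 1)) (P n))"
    (is "?L \<longleftrightarrow> ?R")
  proof
    assume L: ?L
    show ?R unfolding 1 using functor_eqD[OF L] by (simp add: functor_eq_def P_step')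
  next
    assume R: ?R
    have S: "fobj S (fobj (P (m + n)) x) = fobj S (fobj (P m) (fobj (P n) x))" if "x \<in> Obj A" for x
      using functor_eqD(1)[OF R that] that by (simp add: 1 P_step')
    have o: "fobj (P (m + n)) x = fobj (P m) (fobj (P n) x)" if "x \<in> Obj A" for x
    proof -
      have "fobj (P (m + n)) x = fobj T (fobj S (fobj (P (m + n)) x))" using that by (simp add: T_S(1))
      also have "\<dots> = fobj T (fobj S (fobj (P m) (fobj (P n) x)))" using S[OF that] by (simp only:)
      finally show ?thesis using that by (simp add: T_S(1))
    qed
    have "fmor (P (m + n)) x y f = fmor (P m) (fobj (P n) x) (fobj (P n) y) (fmor (P n) x y f)"
      if xy: "x \<in> Obj A" "y \<in> Obj A" and f: "f \<in> carrier (Hom A x y)" for x y f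
    proof (rule S_faithful)
      show "fmor S (fobj (P (m + n)) x) (fobj (P (m + n)) y) (fmor (P (m + n)) x y f) =
          fmor S (fobj (P (m + n)) x) (fobj (P (m + n)) y) (fmor (P m) (fobj (P n) x) (fobj (P n) y) (fmor (P n) x y f))"
        using functor_eqD(2)[OF R xy f] xy f by (simp add: 1 P_step' o)
      show "fmor (P m) (fobj (P n) x) (fobj (P n) y) (fmor (P n) x y f) \<in> carrier (Hom A (fobj (P (m + n)) x) (fobj (P (m + n)) y))"
        using xy f by (simp add: o)
    qed (use xy f in simp_all)
    with o show ?L by (simp add: functor_eq_def)
  qed
qed

lemma P_P_obj: "x \<in> Obj A \<Longrightarrow> k = m + n \<Longrightarrow> fobj (P m) (fobj (P n) x) = fobj (P k) x"
  using functor_eqD(1)[OF P_add] by simp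

lemma P_P_mor:
  "\<lbrakk>x \<in> Obj A; y \<in> Obj A; f \<in> carrier (Hom A x y); k = m + n\<rbrakk> \<Longrightarrow>
    fmor (P m) (fobj (P n) x) (fobj (P n) y) (fmor (P n) x y f) = fmor (P k) x y f"
  using functor_eqD(2)[OF P_add] by simp

lemma P_one: "fobj (P 1) x = fobj S x" "fmor (P 1) x y f = fmor S x y f"
  by (simp_all add: functor_pow_def)

section \<open>The orbit category as a graded category, and its center\<close>

lemma orbit_simps [simp]:
  "GObj B = Obj A" "GHom B x y n = Hom A x (fobj (P n) y)" "gident B = ident A"
  "gcomp B x y z m n g f = cat_comp A x (fobj (P n) y) (fobj (P (m + n)) z) (fmor (P n) y (fobj (P m) z) g) f"
  by (simp_all add: orbit_cat_def Let_def)

lemma P_mor':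
  assumes "y \<in> Obj A" "z \<in> Obj A" "g \<in> carrier (Hom A y (fobj (P m) z))"
  shows "fmor (P n) y (fobj (P m) z) g \<in> carrier (Hom A (fobj (P n) y) (fobj (P (m + n)) z))"
  using assms P_mor[of y "fobj (P m) z" g n] P_P_obj[of z "m + n" n m] by (simp add: add.commute)

text \<open>Apart from linearity the point is associativity: both bracketings of h, g, f reduce to
  Sigma^(m+n)(h) Sigma^n(g) f.\<close>

lemma orbit_graded_category: "graded_category K B"
proof (rule graded_category.intro)
  show "cring K" by (rule cring)
next
  fix x y z :: 'o and m n g f assume *: "x \<in> GObj B" "y \<in> GObj B" "z \<in> GObj B"
    "g \<in> carrier (GHom B y z m)" "f \<in> carrier (GHom B x y n)"
  then show "gcomp B x y z m n g f \<in> carrier (GHom B x z (m + n))"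
    by (auto intro!: comp_closed P_mor')
next
  fix x y z :: 'o and m n g h f assume *: "x \<in> GObj B" "y \<in> GObj B" "z \<in> GObj B"
    "g \<in> carrier (GHom B y z m)" "h \<in> carrier (GHom B y z m)" "f \<in> carrier (GHom B x y n)"
  then show "gcomp B x y z m n (g \<oplus>\<^bsub>GHom B y z m\<^esub> h) f = gcomp B x y z m n g f \<oplus>\<^bsub>GHom B x z (m + n)\<^esub> gcomp B x y z m n h f"
    using P_P_obj[of z "m + n" n m]
      comp_add_left[of x "fobj (P n) y" "fobj (P (m + n)) z" "fmor (P n) y (fobj (P m) z) g" "fmor (P n) y (fobj (P m) z) h" f]
    by (simp add: linear_functor.fmor_add[OF P_linear] P_mor' add.commute)
next
  fix x y z :: 'o and m n g h f assume *: "x \<in> GObj B" "y \<in> GObj B" "z \<in> GObj B"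
    "g \<in> carrier (GHom B y z m)" "f \<in> carrier (GHom B x y n)" "h \<in> carrier (GHom B x y n)"
  then show "gcomp B x y z m n g (f \<oplus>\<^bsub>GHom B x y n\<^esub> h) = gcomp B x y z m n g f \<oplus>\<^bsub>GHom B x z (m + n)\<^esub> gcomp B x y z m n g h"
    by (simp add: comp_add_right P_mor')
next
  fix x y z :: 'o and m n c g f assume *: "x \<in> GObj B" "y \<in> GObj B" "z \<in> GObj B" "c \<in> carrier K"
    "g \<in> carrier (GHom B y z m)" "f \<in> carrier (GHom B x y n)"
  then show "gcomp B x y z m n (c \<odot>\<^bsub>GHom B y z m\<^esub> g) f = c \<odot>\<^bsub>GHom B x z (m + n)\<^esub> gcomp B x y z m n g f"
    using P_P_obj[of z "m + n" n m]
      comp_smult_left[of x "fobj (P n) y" "fobj (P (m + n)) z" c "fmor (P n) y (fobj (P m) z) g" f]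
    by (simp add: linear_functor.fmor_smult[OF P_linear] P_mor' add.commute)
  show "gcomp B x y z m n g (c \<odot>\<^bsub>GHom B x y n\<^esub> f) = c \<odot>\<^bsub>GHom B x z (m + n)\<^esub> gcomp B x y z m n g f"
    using * by (simp add: comp_smult_right P_mor')
next
  fix w x y z :: 'o and l m n h g f assume *: "w \<in> GObj B" "x \<in> GObj B" "y \<in> GObj B" "z \<in> GObj B"
    "h \<in> carrier (GHom B y z l)" "g \<in> carrier (GHom B x y m)" "f \<in> carrier (GHom B w x n)"
  let ?x = "fobj (P n) x" and ?y = "fobj (P (m + n)) y" and ?z = "fobj (P (l + m + n)) z"
  have Ph: "fmor (P m) y (fobj (P l) z) h \<in> carrier (Hom A (fobj (P m) y) (fobj (P (l + m)) z))"
    and Pg: "fmor (P n) x (fobj (P m) y) g \<in> carrier (Hom A ?x ?y)"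
    and Ph': "fmor (P (m + n)) y (fobj (P l) z) h \<in> carrier (Hom A ?y ?z)"
    using * P_mor'[of y z h l "m + n"] by (simp_all add: P_mor' add.assoc)
  have "fmor (P n) x (fobj (P (l + m)) z) (cat_comp A x (fobj (P m) y) (fobj (P (l + m)) z) (fmor (P m) y (fobj (P l) z) h) g) =
      cat_comp A ?x (fobj (P n) (fobj (P m) y)) (fobj (P n) (fobj (P (l + m)) z))
        (fmor (P n) (fobj (P m) y) (fobj (P (l + m)) z) (fmor (P m) y (fobj (P l) z) h)) (fmor (P n) x (fobj (P m) y) g)"
    using * Ph by (intro linear_functor.fmor_comp[OF P_linear]) auto
  also have "fobj (P n) (fobj (P m) y) = ?y" using * by (intro P_P_obj) auto
  also have "fobj (P n) (fobj (P (l + m)) z) = ?z" using * by (intro P_P_obj) auto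
  also have "fmor (P n) (fobj (P m) y) (fobj (P (l + m)) z) (fmor (P m) y (fobj (P l) z) h) = fmor (P (m + n)) y (fobj (P l) z) h"
    using * P_P_mor[of y "fobj (P l) z" h "m + n" n m] P_P_obj[of z "l + m" m l] by (simp add: add.commute)
  finally have "gcomp B w x z (l + m) n (gcomp B x y z l m h g) f =
      cat_comp A w ?x ?z (cat_comp A ?x ?y ?z (fmor (P (m + n)) y (fobj (P l) z) h) (fmor (P n) x (fobj (P m) y) g)) f"
    by simp
  also have "\<dots> = cat_comp A w ?y ?z (fmor (P (m + n)) y (fobj (P l) z) h) (cat_comp A w ?x ?y (fmor (P n) x (fobj (P m) y) g) f)"
    using * Pg Ph' by (intro comp_assoc) auto
  finally show "gcomp B w x z (l + m) n (gcomp B x y z l m h g) f = gcomp B w y z l (m + n) h (gcomp B w x y m n g f)"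
    by (simp add: add.assoc)
qed (auto simp: Hom_module ident_closed comp_ident_left comp_ident_right linear_functor.fmor_ident[OF P_linear])

sublocale B: graded_category K B by (rule orbit_graded_category)

text \<open>The defining relation of the graded center is the case of one shift. Going down is
  possible because S is faithful and signs are involutions.\<close>

lemma center_deg_iterate:
  assumes \<eta>: "\<eta> \<in> center_deg A S n" and x: "x \<in> Obj A"
  shows "\<eta> (fobj (P j) x) = sgn_mult (Hom A (fobj (P j) x) (fobj (P (n + j)) x)) (n * j) (fmor (P j) x (fobj (P n) x) (\<eta> x))"
proof (rule int_induct_iff[of "\<lambda>j. \<eta> (fobj (P j) x) = sgn_mult (Hom A (fobj (P j) x) (fobj (P (n + j)) x)) (n * j)
      (fmor (P j) x (fobj (P n) x) (\<eta> x))" j])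
  have \<eta>x: "\<eta> y \<in> carrier (Hom A y (fobj (P n) y))" if "y \<in> Obj A" for y
    using \<eta> that by (auto simp: center_deg_def nat_trans_def)
  show "\<eta> (fobj (P 0) x) = sgn_mult (Hom A (fobj (P 0) x) (fobj (P (n + 0)) x)) (n * 0) (fmor (P 0) x (fobj (P n) x) (\<eta> x))"
    by (simp add: sgn_mult_def)
  fix j
  let ?y = "fobj (P j) x" and ?z = "fobj (P (n + j)) x"
  let ?t = "fmor (P j) x (fobj (P n) x) (\<eta> x)"
  have yz: "?y \<in> Obj A" "?z \<in> Obj A" using x by auto
  have z: "fobj (P n) ?y = ?z" "fobj (P j) (fobj (P n) x) = ?z" using x by (auto intro!: P_P_obj)
  have nj: "n + (j + 1) = n + j + 1" by simp
  have Sy: "fobj (P (j + 1)) x = fobj S ?y" and Sz: "fobj (P (n + (j + 1))) x = fobj S ?z"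
    unfolding nj using x by (simp_all add: P_step')
  have t: "?t \<in> carrier (Hom A ?y ?z)" using x P_mor[of x "fobj (P n) x" "\<eta> x" j] \<eta>x by (simp add: z)
  have "fobj (P n) (fobj S ?y) = fobj S ?z"
    using P_P_obj[of x "n + (j + 1)" n "j + 1"] x by (simp add: Sy Sz)
  then have \<eta>S: "\<eta> (fobj S ?y) = sgn_mult (Hom A (fobj S ?y) (fobj S ?z)) n (fmor S ?y ?z (\<eta> ?y))"
    using \<eta> yz by (simp add: center_deg_def z)
  have \<eta>y: "\<eta> ?y \<in> carrier (Hom A ?y ?z)" using \<eta>x[OF yz(1)] z by simp
  interpret M: module K "Hom A ?y ?z" using yz by (intro Hom_module)
  have SH: "module K (Hom A (fobj S ?y) (fobj S ?z))" using yz by (intro Hom_module S.fobj_closed)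
  interpret lin: linear_map K "Hom A ?y ?z" "Hom A (fobj S ?y) (fobj S ?z)" "fmor S ?y ?z"
    using yz by (intro linear_map.intro linear_map_axioms.intro Hom_module SH) (auto simp: S.fmor_closed S.fmor_add S.fmor_smult)
  have tS: "fmor (P (j + 1)) x (fobj (P n) x) (\<eta> x) = fmor S ?y ?z ?t"
    using x \<eta>x P_step'(2)[of x "fobj (P n) x" "\<eta> x" j] by (simp add: z)
  have "\<eta> ?y = sgn_mult (Hom A ?y ?z) (n * j) ?t \<longleftrightarrow> fmor S ?y ?z (\<eta> ?y) = fmor S ?y ?z (sgn_mult (Hom A ?y ?z) (n * j) ?t)"
    using S_faithful[OF yz \<eta>y sgn_mult_closed[OF M.module_axioms t]] by auto
  also have "\<dots> \<longleftrightarrow> fmor S ?y ?z (\<eta> ?y) = sgn_mult (Hom A (fobj S ?y) (fobj S ?z)) (n * j) (fmor S ?y ?z ?t)"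
    using t by (simp add: lin.sgn)
  also have "\<dots> \<longleftrightarrow> sgn_mult (Hom A (fobj S ?y) (fobj S ?z)) n (fmor S ?y ?z (\<eta> ?y)) =
      sgn_mult (Hom A (fobj S ?y) (fobj S ?z)) (n * (j + 1)) (fmor S ?y ?z ?t)"
  proof -
    let ?N = "Hom A (fobj S ?y) (fobj S ?z)"
    note neg_neg = abelian_group.minus_minus[OF module.axioms(2)[OF SH]]
    have "a = sgn_mult ?N (n * j) b \<longleftrightarrow> sgn_mult ?N n a = sgn_mult ?N (n * (j + 1)) b"
      if a: "a \<in> carrier ?N" and b: "b \<in> carrier ?N" for a b
    proof -
      have "\<ominus>\<^bsub>?N\<^esub> a = \<ominus>\<^bsub>?N\<^esub> b \<longleftrightarrow> a = b" using neg_neg[OF a] neg_neg[OF b] by metis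
      then show ?thesis using neg_neg[OF b] neg_neg[OF a] by (auto simp: sgn_mult_def)
    qed
    then show ?thesis using \<eta>y t by simp
  qed
  finally show "\<eta> (fobj (P j) x) = sgn_mult (Hom A (fobj (P j) x) (fobj (P (n + j)) x)) (n * j) ?t \<longleftrightarrow>
      \<eta> (fobj (P (j + 1)) x) = sgn_mult (Hom A (fobj (P (j + 1)) x) (fobj (P (n + (j + 1))) x)) (n * (j + 1))
        (fmor (P (j + 1)) x (fobj (P n) x) (\<eta> x))"
    by (simp only: Sy Sz tS \<eta>S)
qed

text \<open>A morphism of degree j is some f from x to Sigma^j y: naturality at f, followed by
  \<open>center_deg_iterate\<close> at y, gives centrality. Conversely, centrality against degree 0
  is naturality, and the sign condition comes from one particular morphism of degree 1.\<close>

lemma center_deg_eq: "center_deg A S n = gcenter_deg B n"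
proof (intro equalityI subsetI)
  fix \<eta> assume \<eta>: "\<eta> \<in> center_deg A S n"
  then have \<eta>x: "\<eta> y \<in> carrier (Hom A y (fobj (P n) y))" if "y \<in> Obj A" for y
    using that by (auto simp: center_deg_def nat_trans_def)
  have nat: "cat_comp A x y (fobj (P n) y) (\<eta> y) f = cat_comp A x (fobj (P n) x) (fobj (P n) y) (fmor (P n) x y f) (\<eta> x)"
    if "x \<in> Obj A" "y \<in> Obj A" "f \<in> carrier (Hom A x y)" for x y f
    using \<eta> that by (auto simp: center_deg_def nat_trans_def)
  show "\<eta> \<in> gcenter_deg B n"
  proof (rule B.gcenter_degI)
    fix x y f j assume *: "x \<in> GObj B" "y \<in> GObj B" "f \<in> carrier (GHom B x y j)"
    then have xy: "x \<in> Obj A" "y \<in> Obj A" and f: "f \<in> carrier (Hom A x (fobj (P j) y))" by simp_all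
    let ?z = "fobj (P (n + j)) y"
    let ?t = "fmor (P j) y (fobj (P n) y) (\<eta> y)"
    have t: "?t \<in> carrier (Hom A (fobj (P j) y) ?z)" using xy \<eta>x by (intro P_mor') auto
    have z: "fobj (P n) (fobj (P j) y) = ?z" using xy by (intro P_P_obj) auto
    have "gcomp B x x y j n f (\<eta> x) = cat_comp A x (fobj (P j) y) ?z (\<eta> (fobj (P j) y)) f"
      using nat[OF xy(1) P_obj[OF xy(2)] f] z by (simp add: add.commute)
    also have "\<dots> = cat_comp A x (fobj (P j) y) ?z (sgn_mult (Hom A (fobj (P j) y) ?z) (n * j) ?t) f"
      using center_deg_iterate[OF \<eta> xy(2)] by simp
    also have "\<dots> = sgn_mult (Hom A x ?z) (n * j) (cat_comp A x (fobj (P j) y) ?z ?t f)"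
    proof -
      interpret linear_map K "Hom A (fobj (P j) y) ?z" "Hom A x ?z" "\<lambda>g. cat_comp A x (fobj (P j) y) ?z g f"
        using xy f by (intro linear_map.intro linear_map_axioms.intro Hom_module)
          (auto simp: comp_closed comp_add_left comp_smult_left)
      show ?thesis using t by (rule sgn)
    qed
    finally show "gcomp B x x y j n f (\<eta> x) = sgn_mult (GHom B x y (n + j)) (n * j) (gcomp B x y y n j (\<eta> y) f)"
      by simp
  qed (use \<eta> \<eta>x in \<open>auto simp: center_deg_def\<close>)
next
  fix \<eta> assume \<eta>: "\<eta> \<in> gcenter_deg B n"
  have \<eta>x: "\<eta> x \<in> carrier (Hom A x (fobj (P n) x))" if "x \<in> Obj A" for x
    using B.gcenter_deg_closed[OF \<eta>] that by simp
  have nat: "cat_comp A x y (fobj (P n) y) (\<eta> y) f = cat_comp A x (fobj (P n) x) (fobj (P n) y) (fmor (P n) x y f) (\<eta> x)"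
    if "x \<in> Obj A" "y \<in> Obj A" "f \<in> carrier (Hom A x y)" for x y f
    using B.gcenter_deg_central[OF \<eta>, of x y f 0 n] that by (simp add: sgn_mult_def)
  have "\<eta> (fobj S x) = sgn_mult (Hom A (fobj S x) (fobj (P n) (fobj S x))) n (fmor S x (fobj (P n) x) (\<eta> x))"
    if x: "x \<in> Obj A" for x
  proof -
    let ?y = "fobj S x" and ?z = "fobj (P (n + 1)) x"
    have y: "?y \<in> Obj A" using x by (rule S.fobj_closed)
    have z: "fobj (P n) ?y = ?z" using P_P_obj[OF x, of "n + 1" n 1] by (simp add: P_one)
    have z': "fobj S (fobj (P n) x) = ?z" using x by (simp add: P_step')
    \<comment> \<open>That morphism is the identity of \<open>fobj S x\<close>, read as a morphism
      of degree 1 from \<open>fobj S x\<close> to x.\<close>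
    have "gcomp B ?y ?y x 1 n (ident A ?y) (\<eta> ?y) = sgn_mult (GHom B ?y x (n + 1)) (n * 1) (gcomp B ?y x x n 1 (\<eta> x) (ident A ?y))"
      using B.gcenter_deg_central[OF \<eta>, of ?y x "ident A ?y" 1 "n + 1"] x y by (simp add: P_one ident_closed)
    moreover have "gcomp B ?y ?y x 1 n (ident A ?y) (\<eta> ?y) = \<eta> ?y"
      using x y \<eta>x[OF y] z by (simp add: P_one linear_functor.fmor_ident[OF P_linear] add.commute comp_ident_left)
    moreover have "gcomp B ?y x x n 1 (\<eta> x) (ident A ?y) = fmor S x (fobj (P n) x) (\<eta> x)"
      using x y S.fmor_closed[OF x P_obj[OF x] \<eta>x[OF x]] by (simp add: P_one z' comp_ident_right)
    ultimately show ?thesis by (simp add: z)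
  qed
  with \<eta>x nat B.gcenter_deg_extensional[OF \<eta>] show "\<eta> \<in> center_deg A S n"
    by (simp add: center_deg_def nat_trans_def)
qed

text \<open>An equality of records, so statements about ideals and isomorphisms pass over by
  rewriting.\<close>

lemma graded_center_eq: "graded_center A S = gcenter_ring B"
proof -
  have z: "center_zero A S = gcenter_zero B" by (auto simp: center_zero_def gcenter_zero_def)
  have "carrier (graded_center A S) = gcenter B"
    by (auto simp: graded_center_def Let_def B.gcenter_iff center_deg_eq z)
  then show ?thesis
    unfolding graded_center_def gcenter_ring_def Let_def by (simp add: z cong: if_cong)
qed

end

section \<open>Equivalences commuting with the shift\<close>

text \<open>S and S' are arbitrary linear endofunctors here, so the lemma serves both for the shifts
  with upsilon and for their inverses with the inverted isomorphism.\<close>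

lemma iso_npow_nat_iso:
  assumes "linear_category K A" "linear_category K A'"
    and "linear_functor K A A S" "linear_functor K A' A' S'" "linear_functor K A A' F"
    and V: "nat_iso A A' (functor_comp S' F) (functor_comp F S) V"
  shows "nat_iso A A' (functor_comp (functor_npow S' n) F) (functor_comp F (functor_npow S n)) (iso_npow A' S S' F V n)"
proof (induction n)
  interpret A: linear_category K A by fact
  interpret A': linear_category K A' by fact
  interpret F: linear_functor K A A' F by fact
  case 0
  show ?case unfolding nat_iso_iff
    by (simp add: A'.iso_mor_ident A'.comp_ident_left A'.comp_ident_right F.fobj_closed F.fmor_closed)
next
  interpret A: linear_category K A by fact
  interpret A': linear_category K A' by fact
  interpret F: linear_functor K A A' F by fact
  interpret S: linear_functor K A A S by fact
  interpret S': linear_functor K A' A' S' by fact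
  case (Suc n)
  let ?Q = "functor_npow S n" and ?Q' = "functor_npow S' n" and ?p = "iso_npow A' S S' F V n"
  interpret Q: linear_functor K A A ?Q by (rule functor_npow_linear) fact
  interpret Q': linear_functor K A' A' ?Q' by (rule functor_npow_linear) fact
  have p: "iso_mor A' (fobj ?Q' (fobj F x)) (fobj F (fobj ?Q x)) (?p x)" if "x \<in> Obj A" for x
    using Suc.IH that unfolding nat_iso_iff by simp
  have v: "iso_mor A' (fobj S' (fobj F x)) (fobj F (fobj S x)) (V x)" if "x \<in> Obj A" for x
    using V that unfolding nat_iso_iff by simp
  note pc = p[unfolded iso_mor_def, THEN conjunct1] and vc = v[unfolded iso_mor_def, THEN conjunct1]
  note cl = F.fobj_closed S.fobj_closed S'.fobj_closed Q.fobj_closed Q'.fobj_closed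
    F.fmor_closed S.fmor_closed S'.fmor_closed Q.fmor_closed Q'.fmor_closed
  show ?case unfolding nat_iso_iff
  proof (intro conjI ballI)
    fix x assume x: "x \<in> Obj A"
    have "iso_mor A' (fobj S' (fobj ?Q' (fobj F x))) (fobj S' (fobj F (fobj ?Q x)))
        (fmor S' (fobj ?Q' (fobj F x)) (fobj F (fobj ?Q x)) (?p x))"
      using x by (intro functor_iso_mor(1)[OF assms(2,4)] p cl assms(2))
    then show "iso_mor A' (fobj (functor_comp (functor_npow S' (Suc n)) F) x) (fobj (functor_comp F (functor_npow S (Suc n))) x)
        (iso_npow A' S S' F V (Suc n) x)"
      using x v[of "fobj ?Q x"] by (simp add: Let_def A'.iso_mor_comp cl)
    fix y f assume y: "y \<in> Obj A" and f: "f \<in> carrier (Hom A x y)"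
    let ?x = "fobj ?Q x" and ?y = "fobj ?Q y" and ?X = "fobj ?Q' (fobj F x)" and ?Y = "fobj ?Q' (fobj F y)"
    let ?f = "fmor ?Q x y f" and ?F = "fmor ?Q' (fobj F x) (fobj F y) (fmor F x y f)"
    have c: "?x \<in> Obj A" "?y \<in> Obj A" "?X \<in> Obj A'" "?Y \<in> Obj A'" "?f \<in> carrier (Hom A ?x ?y)" "?F \<in> carrier (Hom A' ?X ?Y)"
      "fobj F ?x \<in> Obj A'" "fobj F ?y \<in> Obj A'" "fmor F ?x ?y ?f \<in> carrier (Hom A' (fobj F ?x) (fobj F ?y))"
      using x y f by (simp_all add: cl)
    have nat_p: "cat_comp A' ?X ?Y (fobj F ?y) (?p y) ?F = cat_comp A' ?X (fobj F ?x) (fobj F ?y) (fmor F ?x ?y ?f) (?p x)"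
      using Suc.IH x y f unfolding nat_iso_iff by simp
    have nat_v: "cat_comp A' (fobj S' (fobj F ?x)) (fobj S' (fobj F ?y)) (fobj F (fobj S ?y)) (V ?y) (fmor S' (fobj F ?x) (fobj F ?y) (fmor F ?x ?y ?f))
        = cat_comp A' (fobj S' (fobj F ?x)) (fobj F (fobj S ?x)) (fobj F (fobj S ?y)) (fmor F (fobj S ?x) (fobj S ?y) (fmor S ?x ?y ?f)) (V ?x)"
      using V c unfolding nat_iso_iff by simp
    let ?Sp = "\<lambda>x. fmor S' (fobj ?Q' (fobj F x)) (fobj F (fobj ?Q x)) (?p x)"
    \<comment> \<open>The square for n + 1 is S' applied to the square for n, pasted with the square
      of \<open>V\<close>.\<close>
    have "cat_comp A' (fobj S' ?X) (fobj S' ?Y) (fobj F (fobj S ?y))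
        (cat_comp A' (fobj S' ?Y) (fobj S' (fobj F ?y)) (fobj F (fobj S ?y)) (V ?y) (?Sp y)) (fmor S' ?X ?Y ?F)
      = cat_comp A' (fobj S' ?X) (fobj S' (fobj F ?y)) (fobj F (fobj S ?y)) (V ?y)
          (cat_comp A' (fobj S' ?X) (fobj S' ?Y) (fobj S' (fobj F ?y)) (?Sp y) (fmor S' ?X ?Y ?F))"
      using c x y pc vc by (intro A'.comp_assoc) (simp_all add: cl)
    also have "cat_comp A' (fobj S' ?X) (fobj S' ?Y) (fobj S' (fobj F ?y)) (?Sp y) (fmor S' ?X ?Y ?F)
      = fmor S' ?X (fobj F ?y) (cat_comp A' ?X ?Y (fobj F ?y) (?p y) ?F)"
      using c y pc by (intro S'.fmor_comp[symmetric]) simp_all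
    also have "\<dots> = cat_comp A' (fobj S' ?X) (fobj S' (fobj F ?x)) (fobj S' (fobj F ?y)) (fmor S' (fobj F ?x) (fobj F ?y) (fmor F ?x ?y ?f)) (?Sp x)"
      unfolding nat_p using c x pc by (intro S'.fmor_comp) simp_all
    also have "cat_comp A' (fobj S' ?X) (fobj S' (fobj F ?y)) (fobj F (fobj S ?y)) (V ?y) \<dots>
      = cat_comp A' (fobj S' ?X) (fobj S' (fobj F ?x)) (fobj F (fobj S ?y))
        (cat_comp A' (fobj S' (fobj F ?x)) (fobj S' (fobj F ?y)) (fobj F (fobj S ?y)) (V ?y) (fmor S' (fobj F ?x) (fobj F ?y) (fmor F ?x ?y ?f)))
        (?Sp x)"
      using c x pc vc by (intro A'.comp_assoc[symmetric]) (simp_all add: cl)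
    also have "\<dots> = cat_comp A' (fobj S' ?X) (fobj F (fobj S ?x)) (fobj F (fobj S ?y)) (fmor F (fobj S ?x) (fobj S ?y) (fmor S ?x ?y ?f))
        (cat_comp A' (fobj S' ?X) (fobj S' (fobj F ?x)) (fobj F (fobj S ?x)) (V ?x) (?Sp x))"
      unfolding nat_v using c x pc vc by (intro A'.comp_assoc) (simp_all add: cl)
    finally show "cat_comp A' (fobj (functor_comp (functor_npow S' (Suc n)) F) x) (fobj (functor_comp (functor_npow S' (Suc n)) F) y)
         (fobj (functor_comp F (functor_npow S (Suc n))) y) (iso_npow A' S S' F V (Suc n) y)
         (fmor (functor_comp (functor_npow S' (Suc n)) F) x y f) =
        cat_comp A' (fobj (functor_comp (functor_npow S' (Suc n)) F) x) (fobj (functor_comp F (functor_npow S (Suc n))) x)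
         (fobj (functor_comp F (functor_npow S (Suc n))) y) (fmor (functor_comp F (functor_npow S (Suc n))) x y f)
         (iso_npow A' S S' F V (Suc n) x)"
      by (simp add: Let_def)
  qed
qed

locale shift_equivalence = src: shift_category K A S + tgt: shift_category K A' S'
  for K :: "('k, 'r) ring_scheme" and A :: "('k, 'o, 'm) lin_cat" and S :: "('o, 'm, 'o, 'm) fnctr"
    and A' :: "('k, 'o2, 'm2) lin_cat" and S' :: "('o2, 'm2, 'o2, 'm2) fnctr" +
  fixes F :: "('o, 'm, 'o2, 'm2) fnctr" and \<upsilon> :: "'o \<Rightarrow> 'm2"
  assumes equivalence: "lin_equivalence K A A' F"
    and \<upsilon>: "nat_iso A A' (functor_comp S' F) (functor_comp F S) \<upsilon>"
begin

sublocale F: linear_functor K A A' F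
  using equivalence by (simp add: lin_equivalence_def)

lemma F_obj [simp]: "x \<in> Obj A \<Longrightarrow> fobj F x \<in> Obj A'"
  by (rule F.fobj_closed)

lemma \<upsilon>_iso: "x \<in> Obj A \<Longrightarrow> iso_mor A' (fobj S' (fobj F x)) (fobj F (fobj S x)) (\<upsilon> x)"
  using \<upsilon> unfolding nat_iso_iff by simp

lemma \<upsilon>_closed: "x \<in> Obj A \<Longrightarrow> \<upsilon> x \<in> carrier (Hom A' (fobj S' (fobj F x)) (fobj F (fobj S x)))"
  using \<upsilon>_iso by (simp add: iso_mor_def)

lemma \<upsilon>_natural:
  "\<lbrakk>x \<in> Obj A; y \<in> Obj A; f \<in> carrier (Hom A x y)\<rbrakk> \<Longrightarrow>
    cat_comp A' (fobj S' (fobj F x)) (fobj S' (fobj F y)) (fobj F (fobj S y)) (\<upsilon> y) (fmor S' (fobj F x) (fobj F y) (fmor F x y f))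
    = cat_comp A' (fobj S' (fobj F x)) (fobj F (fobj S x)) (fobj F (fobj S y)) (fmor F (fobj S x) (fobj S y) (fmor S x y f)) (\<upsilon> x)"
  using \<upsilon> unfolding nat_iso_iff by simp

section \<open>Integer powers of the isomorphism between the shifts\<close>

abbreviation V :: "'o \<Rightarrow> 'm2" where
  "V \<equiv> iso_inv A A' S S' F \<upsilon>"

abbreviation U :: "int \<Rightarrow> 'o \<Rightarrow> 'm2" where
  "U \<equiv> iso_pow A A' S S' F \<upsilon>"

lemma V_eq:
  assumes "x \<in> Obj A"
  shows "V x = fmor tgt.T (fobj F x) (fobj S' (fobj F (fobj src.T x)))
    (inv_mor A' (fobj S' (fobj F (fobj src.T x))) (fobj F x) (\<upsilon> (fobj src.T x)))"
  by (simp add: iso_inv_def Let_def)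

text \<open>\<open>V\<close> arises by inverting upsilon at the object shifted back and then
  applying the inverse shift. Accordingly the naturality square of upsilon is inverted first and
  shifted back afterwards.\<close>

lemma V_nat_iso: "nat_iso A A' (functor_comp tgt.T F) (functor_comp F src.T) V"
  unfolding nat_iso_iff
proof (intro conjI ballI)
  fix x assume x: "x \<in> Obj A"
  let ?x = "fobj src.T x"
  have Tx: "?x \<in> Obj A" using x by (rule src.T.fobj_closed)
  have ix: "iso_mor A' (fobj S' (fobj F ?x)) (fobj F x) (\<upsilon> ?x)"
    using \<upsilon>_iso[OF Tx] x by (simp add: src.S_T)
  note vx = tgt.inv_mor[OF _ _ ix]
  have inv: "iso_mor A' (fobj F x) (fobj S' (fobj F ?x)) (inv_mor A' (fobj S' (fobj F ?x)) (fobj F x) (\<upsilon> ?x))"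
    using x Tx ix by (intro tgt.iso_mor_inv) (auto simp: tgt.S.fobj_closed)
  then have "iso_mor A' (fobj tgt.T (fobj F x)) (fobj tgt.T (fobj S' (fobj F ?x))) (V x)"
    unfolding V_eq[OF x] using x Tx
    by (intro functor_iso_mor(1)[OF tgt.linear_category_axioms tgt.T_inverse(1)] tgt.linear_category_axioms) (auto simp: tgt.S.fobj_closed)
  then show "iso_mor A' (fobj (functor_comp tgt.T F) x) (fobj (functor_comp F src.T) x) (V x)"
    using Tx by (simp add: tgt.T_S)
  fix y f assume y: "y \<in> Obj A" and f: "f \<in> carrier (Hom A x y)"
  let ?y = "fobj src.T y" and ?g = "fmor src.T x y f"
  have Ty: "?y \<in> Obj A" using y by (rule src.T.fobj_closed)
  have iy: "iso_mor A' (fobj S' (fobj F ?y)) (fobj F y) (\<upsilon> ?y)"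
    using \<upsilon>_iso[OF Ty] y by (simp add: src.S_T)
  have g: "?g \<in> carrier (Hom A ?x ?y)" using x y f by (rule src.T.fmor_closed)
  have obj: "fobj F x \<in> Obj A'" "fobj F y \<in> Obj A'" "fobj S' (fobj F ?x) \<in> Obj A'" "fobj S' (fobj F ?y) \<in> Obj A'"
    using x y Tx Ty by (simp_all add: tgt.S.fobj_closed)
  let ?sx = "fobj S' (fobj F ?x)" and ?sy = "fobj S' (fobj F ?y)"
  let ?ix = "inv_mor A' ?sx (fobj F x) (\<upsilon> ?x)" and ?iy = "inv_mor A' ?sy (fobj F y) (\<upsilon> ?y)"
  note vx = tgt.inv_mor[OF obj(3,1) ix] and vy = tgt.inv_mor[OF obj(4,2) iy]
  have c: "\<upsilon> ?x \<in> carrier (Hom A' ?sx (fobj F x))" "\<upsilon> ?y \<in> carrier (Hom A' ?sy (fobj F y))"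
    using ix iy by (auto simp: iso_mor_def)
  have Ff: "fmor F x y f \<in> carrier (Hom A' (fobj F x) (fobj F y))" using x y f by (rule F.fmor_closed)
  have Fg: "fmor F ?x ?y ?g \<in> carrier (Hom A' (fobj F ?x) (fobj F ?y))" using Tx Ty g by (rule F.fmor_closed)
  let ?sg = "fmor S' (fobj F ?x) (fobj F ?y) (fmor F ?x ?y ?g)"
  have sg: "?sg \<in> carrier (Hom A' ?sx ?sy)" using Tx Ty Fg by (intro tgt.S.fmor_closed) auto
  have nat: "cat_comp A' ?sx ?sy (fobj F y) (\<upsilon> ?y) ?sg = cat_comp A' ?sx (fobj F x) (fobj F y) (fmor F x y f) (\<upsilon> ?x)"
    using \<upsilon>_natural[OF Tx Ty g] x y f by (simp add: src.S_T)
  \<comment> \<open>The square of upsilon at \<open>?g\<close> with the components of upsilon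
    inverted; it is checked after composing with upsilon at \<open>?y\<close>.\<close>
  have "cat_comp A' (fobj F x) (fobj F y) ?sy ?iy (fmor F x y f) = cat_comp A' (fobj F x) ?sx ?sy ?sg ?ix"
  proof (rule tgt.iso_cancel_left[OF obj(1,4,2) iy])
    have "cat_comp A' (fobj F x) ?sy (fobj F y) (\<upsilon> ?y) (cat_comp A' (fobj F x) ?sx ?sy ?sg ?ix) =
        cat_comp A' (fobj F x) ?sx (fobj F y) (cat_comp A' ?sx ?sy (fobj F y) (\<upsilon> ?y) ?sg) ?ix"
      by (intro tgt.comp_assoc[symmetric] obj c sg vx)
    also have "\<dots> = cat_comp A' (fobj F x) (fobj F x) (fobj F y) (fmor F x y f) (cat_comp A' (fobj F x) ?sx (fobj F x) (\<upsilon> ?x) ?ix)"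
      unfolding nat by (intro tgt.comp_assoc obj c Ff vx)
    also have "\<dots> = fmor F x y f" using obj Ff vx(3) by (simp add: tgt.comp_ident_right)
    finally have 1: "cat_comp A' (fobj F x) ?sy (fobj F y) (\<upsilon> ?y) (cat_comp A' (fobj F x) ?sx ?sy ?sg ?ix) = fmor F x y f" .
    have "cat_comp A' (fobj F x) ?sy (fobj F y) (\<upsilon> ?y) (cat_comp A' (fobj F x) (fobj F y) ?sy ?iy (fmor F x y f)) =
        cat_comp A' (fobj F x) (fobj F y) (fobj F y) (cat_comp A' (fobj F y) ?sy (fobj F y) (\<upsilon> ?y) ?iy) (fmor F x y f)"
      by (intro tgt.comp_assoc[symmetric] obj c Ff vy)
    also have "\<dots> = fmor F x y f" using obj Ff vy(3) by (simp add: tgt.comp_ident_left)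
    finally show "cat_comp A' (fobj F x) ?sy (fobj F y) (\<upsilon> ?y) (cat_comp A' (fobj F x) (fobj F y) ?sy ?iy (fmor F x y f)) =
        cat_comp A' (fobj F x) ?sy (fobj F y) (\<upsilon> ?y) (cat_comp A' (fobj F x) ?sx ?sy ?sg ?ix)"
      using 1 by simp
  qed (intro tgt.comp_closed obj vx vy Ff sg)+
  from arg_cong[OF this, of "fmor tgt.T (fobj F x) ?sy"]
  have "cat_comp A' (fobj tgt.T (fobj F x)) (fobj tgt.T (fobj F y)) (fobj tgt.T ?sy) (V y) (fmor tgt.T (fobj F x) (fobj F y) (fmor F x y f)) =
      cat_comp A' (fobj tgt.T (fobj F x)) (fobj tgt.T ?sx) (fobj tgt.T ?sy) (fmor tgt.T ?sx ?sy ?sg) (V x)"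
    using tgt.T.fmor_comp[OF obj(1,2,4) vy(1) Ff] tgt.T.fmor_comp[OF obj(1,3,4) sg vx(1)]
    by (simp add: V_eq[OF x] V_eq[OF y])
  then show "cat_comp A' (fobj (functor_comp tgt.T F) x) (fobj (functor_comp tgt.T F) y) (fobj (functor_comp F src.T) y) (V y)
        (fmor (functor_comp tgt.T F) x y f) =
      cat_comp A' (fobj (functor_comp tgt.T F) x) (fobj (functor_comp F src.T) x) (fobj (functor_comp F src.T) y)
        (fmor (functor_comp F src.T) x y f) (V x)"
    using Tx Ty Fg by (simp add: tgt.T_S)
qed

lemma U_nonneg: "U (int k) = iso_npow A' S S' F \<upsilon> k"
  by (simp add: iso_pow_def)

lemma U_neg: "U (- int k) = iso_npow A' src.T tgt.T F V k"
  by (cases "k = 0") (auto simp: iso_pow_def)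

lemma U_nat_iso: "nat_iso A A' (functor_comp (tgt.P n) F) (functor_comp F (src.P n)) (U n)"
proof (cases "0 \<le> n")
  case True
  then obtain k where "n = int k" using nonneg_int_cases by blast
  then show ?thesis
    using iso_npow_nat_iso[OF src.linear_category_axioms tgt.linear_category_axioms src.S.linear_functor_axioms
        tgt.S.linear_functor_axioms F.linear_functor_axioms \<upsilon>]
    by (simp add: U_nonneg src.P_nonneg tgt.P_nonneg)
next
  case False
  then obtain k where "n = - int k" using int_cases2 by (metis of_nat_0_le_iff)
  then show ?thesis
    using iso_npow_nat_iso[OF src.linear_category_axioms tgt.linear_category_axioms src.T_inverse(1)
        tgt.T_inverse(1) F.linear_functor_axioms V_nat_iso]
    by (simp add: U_neg src.P_neg tgt.P_neg)
qed

lemma U_iso: "x \<in> Obj A \<Longrightarrow> iso_mor A' (fobj (tgt.P n) (fobj F x)) (fobj F (fobj (src.P n) x)) (U n x)"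
  using U_nat_iso[of n] unfolding nat_iso_iff by simp

lemma U_closed: "x \<in> Obj A \<Longrightarrow> U n x \<in> carrier (Hom A' (fobj (tgt.P n) (fobj F x)) (fobj F (fobj (src.P n) x)))"
  using U_iso by (simp add: iso_mor_def)

lemma U_natural:
  "\<lbrakk>x \<in> Obj A; y \<in> Obj A; f \<in> carrier (Hom A x y)\<rbrakk> \<Longrightarrow>
    cat_comp A' (fobj (tgt.P n) (fobj F x)) (fobj (tgt.P n) (fobj F y)) (fobj F (fobj (src.P n) y))
      (U n y) (fmor (tgt.P n) (fobj F x) (fobj F y) (fmor F x y f))
    = cat_comp A' (fobj (tgt.P n) (fobj F x)) (fobj F (fobj (src.P n) x)) (fobj F (fobj (src.P n) y))
      (fmor F (fobj (src.P n) x) (fobj (src.P n) y) (fmor (src.P n) x y f)) (U n x)"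
  using U_nat_iso[of n] unfolding nat_iso_iff by simp

lemma U_zero: "U 0 x = ident A' (fobj F x)"
  by (simp add: iso_pow_def)

text \<open>Below 0 the value at n is built from the value at n + 1 with \<open>V\<close>. Since S'
  applied to \<open>V\<close> is an inverse of upsilon, this recursion can be read upward, and one
  formula covers all integers.\<close>

lemma U_step:
  assumes x: "x \<in> Obj A"
  shows "U (n + 1) x = cat_comp A' (fobj S' (fobj (tgt.P n) (fobj F x))) (fobj S' (fobj F (fobj (src.P n) x)))
    (fobj F (fobj S (fobj (src.P n) x))) (\<upsilon> (fobj (src.P n) x))
    (fmor S' (fobj (tgt.P n) (fobj F x)) (fobj F (fobj (src.P n) x)) (U n x))"
proof (cases "0 \<le> n")
  case True
  then obtain k where k: "n = int k" using nonneg_int_cases by blast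
  then have "n + 1 = int (Suc k)" by simp
  then have "U (n + 1) = iso_npow A' S S' F \<upsilon> (Suc k)" by (simp only: U_nonneg)
  then show ?thesis by (simp add: k U_nonneg src.P_nonneg tgt.P_nonneg Let_def)
next
  case False
  define k where "k = nat (- n - 1)"
  have n: "n = - int (Suc k)" "n + 1 = - int k" using False by (simp_all add: k_def)
  let ?y = "fobj (functor_npow src.T k) x" and ?z = "fobj (functor_npow tgt.T k) (fobj F x)"
  let ?w = "fobj src.T ?y" and ?u = "iso_npow A' src.T tgt.T F V k x"
  have Pn: "fobj (src.P n) x = ?w" "fobj (tgt.P n) (fobj F x) = fobj tgt.T ?z"
    unfolding n(1) by (simp_all only: src.P_neg tgt.P_neg functor_npow.simps functor_simps)
  have y: "?y \<in> Obj A" and z: "?z \<in> Obj A'"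
    using x src.P_obj[of x "- int k"] tgt.P_obj[of "fobj F x" "- int k"] by (simp_all add: src.P_neg tgt.P_neg)
  have w: "?w \<in> Obj A" using y by (rule src.T.fobj_closed)
  have u: "?u \<in> carrier (Hom A' ?z (fobj F ?y))"
    using U_closed[OF x, of "- int k"] by (simp add: U_neg src.P_neg tgt.P_neg)
  let ?s = "fobj S' (fobj F ?w)"
  have s: "?s \<in> Obj A'" using w by (simp add: tgt.S.fobj_closed)
  have Fy: "fobj F ?y \<in> Obj A'" using y by simp
  let ?v = "inv_mor A' ?s (fobj F ?y) (\<upsilon> ?w)"
  have iw: "iso_mor A' ?s (fobj F ?y) (\<upsilon> ?w)" using \<upsilon>_iso[OF w] y by (simp add: src.S_T)
  note v = tgt.inv_mor[OF s Fy iw]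
  have c: "\<upsilon> ?w \<in> carrier (Hom A' ?s (fobj F ?y))" using iw by (simp add: iso_mor_def)
  have Tv: "V ?y = fmor tgt.T (fobj F ?y) ?s ?v" using y by (rule V_eq)
  have Tvc: "fmor tgt.T (fobj F ?y) ?s ?v \<in> carrier (Hom A' (fobj tgt.T (fobj F ?y)) (fobj tgt.T ?s))"
    using Fy s v(1) by (rule tgt.T.fmor_closed)
  have Tu: "fmor tgt.T ?z (fobj F ?y) ?u \<in> carrier (Hom A' (fobj tgt.T ?z) (fobj tgt.T (fobj F ?y)))"
    using z Fy u by (rule tgt.T.fmor_closed)
  have Ts: "fobj tgt.T ?s = fobj F ?w" using w by (simp add: tgt.T_S)
  have "U n x = cat_comp A' (fobj tgt.T ?z) (fobj tgt.T (fobj F ?y)) (fobj F ?w) (V ?y) (fmor tgt.T ?z (fobj F ?y) ?u)"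
    unfolding n(1) U_neg by (simp add: Let_def)
  also have "\<dots> = fmor tgt.T ?z ?s (cat_comp A' ?z (fobj F ?y) ?s ?v ?u)"
    unfolding Tv by (rule tgt.T.fmor_comp[OF z Fy s v(1) u, unfolded Ts, symmetric])
  finally have Un: "U n x = fmor tgt.T ?z ?s (cat_comp A' ?z (fobj F ?y) ?s ?v ?u)" .
  have vu: "cat_comp A' ?z (fobj F ?y) ?s ?v ?u \<in> carrier (Hom A' ?z ?s)"
    using z Fy s v(1) u by (rule tgt.comp_closed)
  have "fmor S' (fobj tgt.T ?z) (fobj F ?w) (U n x) = cat_comp A' ?z (fobj F ?y) ?s ?v ?u"
    unfolding Un by (rule tgt.S_T(2)[OF z s vu, unfolded Ts])
  then have "cat_comp A' ?z ?s (fobj F ?y) (\<upsilon> ?w) (fmor S' (fobj tgt.T ?z) (fobj F ?w) (U n x)) =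
      cat_comp A' ?z (fobj F ?y) (fobj F ?y) (cat_comp A' (fobj F ?y) ?s (fobj F ?y) (\<upsilon> ?w) ?v) ?u"
    using z s Fy c v(1) u by (simp add: tgt.comp_assoc)
  also have "\<dots> = ?u" using z Fy u v(3) by (simp add: tgt.comp_ident_left)
  also have "?u = U (n + 1) x" unfolding n(2) U_neg ..
  finally show ?thesis unfolding Pn using y z by (simp add: src.S_T tgt.S_T)
qed

text \<open>This cocycle identity is what functoriality on orbit categories requires. Both sides
  satisfy the recursion \<open>U_step\<close> in m, and equality can be carried down as well as up
  because upsilon is invertible and S' is faithful.\<close>

lemma U_add:
  assumes x: "x \<in> Obj A"
  shows "U (m + n) x = cat_comp A' (fobj (tgt.P (m + n)) (fobj F x)) (fobj (tgt.P m) (fobj F (fobj (src.P n) x)))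
    (fobj F (fobj (src.P (m + n)) x)) (U m (fobj (src.P n) x))
    (fmor (tgt.P m) (fobj (tgt.P n) (fobj F x)) (fobj F (fobj (src.P n) x)) (U n x))"
proof -
  let ?x = "fobj (src.P n) x" and ?X = "fobj (tgt.P n) (fobj F x)"
  define R where "R m = cat_comp A' (fobj (tgt.P (m + n)) (fobj F x)) (fobj (tgt.P m) (fobj F ?x))
    (fobj F (fobj (src.P (m + n)) x)) (U m ?x) (fmor (tgt.P m) ?X (fobj F ?x) (U n x))" for m
  have obj: "?x \<in> Obj A" "?X \<in> Obj A'" "fobj F ?x \<in> Obj A'" using x by simp_all
  note Un = U_closed[OF x, of n]
  have "U (m + n) x = R m"
  proof (rule int_induct_iff[of "\<lambda>m. U (m + n) x = R m" m])
    show "U (0 + n) x = R 0"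
      using obj Un by (simp add: R_def U_zero tgt.comp_ident_left)
    fix m
    let ?Y = "fobj (tgt.P (m + n)) (fobj F x)" and ?Z = "fobj (tgt.P m) (fobj F ?x)" and ?y = "fobj (src.P (m + n)) x"
    have mn: "m + 1 + n = m + n + 1" by simp
    have PY: "fobj (tgt.P m) ?X = ?Y" "fobj (src.P m) ?x = ?y" using x by (simp_all add: src.P_P_obj tgt.P_P_obj)
    have objs: "?Y \<in> Obj A'" "?Z \<in> Obj A'" "?y \<in> Obj A" "fobj F ?y \<in> Obj A'" using x by simp_all
    have S1: "fobj (tgt.P (m + 1 + n)) (fobj F x) = fobj S' ?Y" "fobj (tgt.P (m + 1)) (fobj F ?x) = fobj S' ?Z"
      "fobj (src.P (m + 1 + n)) x = fobj S ?y"
      unfolding mn using x by (simp_all add: src.P_step' tgt.P_step')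
    have u: "U m ?x \<in> carrier (Hom A' ?Z (fobj F ?y))" using U_closed[OF obj(1), of m] by (simp add: PY)
    have pu: "fmor (tgt.P m) ?X (fobj F ?x) (U n x) \<in> carrier (Hom A' ?Y ?Z)"
      using tgt.P_mor[OF obj(2,3) Un, of m] by (simp add: PY)
    have Rm: "R m \<in> carrier (Hom A' ?Y (fobj F ?y))"
      unfolding R_def by (intro tgt.comp_closed objs u pu)
    have Umn: "U (m + n) x \<in> carrier (Hom A' ?Y (fobj F ?y))" by (rule U_closed[OF x])
    have vy: "iso_mor A' (fobj S' (fobj F ?y)) (fobj F (fobj S ?y)) (\<upsilon> ?y)" by (rule \<upsilon>_iso[OF objs(3)])
    have Sobj: "fobj S' ?Y \<in> Obj A'" "fobj S' ?Z \<in> Obj A'" "fobj S' (fobj F ?y) \<in> Obj A'" "fobj F (fobj S ?y) \<in> Obj A'"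
      using objs by (simp_all add: tgt.S.fobj_closed src.S.fobj_closed)
    have L: "U (m + 1 + n) x = cat_comp A' (fobj S' ?Y) (fobj S' (fobj F ?y)) (fobj F (fobj S ?y)) (\<upsilon> ?y) (fmor S' ?Y (fobj F ?y) (U (m + n) x))"
      unfolding mn by (rule U_step[OF x])
    have "R (m + 1) = cat_comp A' (fobj S' ?Y) (fobj S' ?Z) (fobj F (fobj S ?y))
        (cat_comp A' (fobj S' ?Z) (fobj S' (fobj F ?y)) (fobj F (fobj S ?y)) (\<upsilon> ?y) (fmor S' ?Z (fobj F ?y) (U m ?x)))
        (fmor S' ?Y ?Z (fmor (tgt.P m) ?X (fobj F ?x) (U n x)))"
      unfolding R_def S1 using U_step[OF obj(1), of m] tgt.P_step'(2)[OF obj(2,3) Un, of m] by (simp add: PY)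
    also have "\<dots> = cat_comp A' (fobj S' ?Y) (fobj S' (fobj F ?y)) (fobj F (fobj S ?y)) (\<upsilon> ?y)
        (cat_comp A' (fobj S' ?Y) (fobj S' ?Z) (fobj S' (fobj F ?y)) (fmor S' ?Z (fobj F ?y) (U m ?x))
          (fmor S' ?Y ?Z (fmor (tgt.P m) ?X (fobj F ?x) (U n x))))"
      using Sobj objs u pu \<upsilon>_closed[OF objs(3)] by (intro tgt.comp_assoc tgt.S.fmor_closed)
    also have "\<dots> = cat_comp A' (fobj S' ?Y) (fobj S' (fobj F ?y)) (fobj F (fobj S ?y)) (\<upsilon> ?y) (fmor S' ?Y (fobj F ?y) (R m))"
      unfolding R_def using objs u pu by (simp add: tgt.S.fmor_comp)
    finally have R1: "R (m + 1) = cat_comp A' (fobj S' ?Y) (fobj S' (fobj F ?y)) (fobj F (fobj S ?y)) (\<upsilon> ?y) (fmor S' ?Y (fobj F ?y) (R m))" .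
    show "U (m + n) x = R m \<longleftrightarrow> U (m + 1 + n) x = R (m + 1)"
    proof
      assume "U (m + 1 + n) x = R (m + 1)"
      then have "fmor S' ?Y (fobj F ?y) (U (m + n) x) = fmor S' ?Y (fobj F ?y) (R m)"
        unfolding L R1
        by (rule tgt.iso_cancel_left[OF Sobj(1,3,4) vy tgt.S.fmor_closed[OF objs(1,4) Umn] tgt.S.fmor_closed[OF objs(1,4) Rm]])
      then show "U (m + n) x = R m"
        by (rule tgt.S_faithful[OF objs(1,4) Umn Rm])
    qed (simp add: L R1)
  qed
  then show ?thesis by (simp add: R_def)
qed

section \<open>The equivalence is faithful, full and dense\<close>

lemma F_faithful:
  "\<lbrakk>x \<in> Obj A; y \<in> Obj A; f \<in> carrier (Hom A x y); g \<in> carrier (Hom A x y); fmor F x y f = fmor F x y g\<rbrakk> \<Longrightarrow> f = g"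
  using equivalence faithful_if_left_inverse[OF src.linear_category_axioms F.linear_functor_axioms]
  unfolding lin_equivalence_def by blast

text \<open>The preimage is \<open>\<alpha>\<close> at y, after G(h), after the inverse of
  \<open>\<alpha>\<close> at x. Naturality gives G(F(f)) = G(h), and G is faithful because F G is
  isomorphic to the identity.\<close>

lemma F_full:
  assumes x: "x \<in> Obj A" and y: "y \<in> Obj A" and h: "h \<in> carrier (Hom A' (fobj F x) (fobj F y))"
  shows "\<exists>f\<in>carrier (Hom A x y). fmor F x y f = h"
proof -
  obtain G \<alpha> \<beta> where G: "linear_functor K A' A G" and \<alpha>: "nat_iso A A (functor_comp G F) functor_id \<alpha>"
    and \<beta>: "nat_iso A' A' (functor_comp F G) functor_id \<beta>"
    using equivalence unfolding lin_equivalence_def by blast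
  interpret G: linear_functor K A' A G by (rule G)
  let ?gx = "fobj G (fobj F x)" and ?gy = "fobj G (fobj F y)"
  have g: "?gx \<in> Obj A" "?gy \<in> Obj A" using x y by (simp_all add: G.fobj_closed)
  have ax: "iso_mor A ?gx x (\<alpha> x)" and ay: "iso_mor A ?gy y (\<alpha> y)"
    using \<alpha> x y unfolding nat_iso_iff by simp_all
  note ix = src.inv_mor[OF g(1) x ax]
  have c: "\<alpha> x \<in> carrier (Hom A ?gx x)" "\<alpha> y \<in> carrier (Hom A ?gy y)" using ax ay by (auto simp: iso_mor_def)
  have Gh: "fmor G (fobj F x) (fobj F y) h \<in> carrier (Hom A ?gx ?gy)" using x y h by (intro G.fmor_closed) auto
  let ?ah = "cat_comp A ?gx ?gy y (\<alpha> y) (fmor G (fobj F x) (fobj F y) h)"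
  have ah: "?ah \<in> carrier (Hom A ?gx y)" using g y c Gh by (intro src.comp_closed)
  define f where "f = cat_comp A x ?gx y ?ah (inv_mor A ?gx x (\<alpha> x))"
  have f: "f \<in> carrier (Hom A x y)" unfolding f_def by (rule src.comp_closed[OF x g(1) y ah ix(1)])
  have Ff: "fmor F x y f \<in> carrier (Hom A' (fobj F x) (fobj F y))" using x y f by (rule F.fmor_closed)
  have GFf: "fmor G (fobj F x) (fobj F y) (fmor F x y f) \<in> carrier (Hom A ?gx ?gy)"
    using x y Ff by (intro G.fmor_closed) auto
  have "cat_comp A ?gx ?gy y (\<alpha> y) (fmor G (fobj F x) (fobj F y) (fmor F x y f)) = cat_comp A ?gx x y f (\<alpha> x)"
    using \<alpha> x y f unfolding nat_iso_iff by simp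
  also have "\<dots> = cat_comp A ?gx ?gx y ?ah (cat_comp A ?gx x ?gx (inv_mor A ?gx x (\<alpha> x)) (\<alpha> x))"
    unfolding f_def using g x y ah ix(1) c(1) by (intro src.comp_assoc)
  also have "\<dots> = ?ah" using g y ah ix(2) by (simp add: src.comp_ident_right)
  finally have "fmor G (fobj F x) (fobj F y) (fmor F x y f) = fmor G (fobj F x) (fobj F y) h"
    by (rule src.iso_cancel_left[OF g y ay GFf Gh])
  then have "fmor F x y f = h"
    by (rule faithful_if_left_inverse[OF tgt.linear_category_axioms G F.linear_functor_axioms \<beta> F_obj[OF x] F_obj[OF y] Ff h])
  with f show ?thesis by blast
qed

lemma F_dense:
  assumes "z \<in> Obj A'"
  shows "\<exists>x\<in>Obj A. \<exists>w. iso_mor A' (fobj F x) z w"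
proof -
  obtain G \<beta> where "linear_functor K A' A G" "nat_iso A' A' (functor_comp F G) functor_id \<beta>"
    using equivalence unfolding lin_equivalence_def by blast
  with assms linear_functor.fobj_closed show ?thesis unfolding nat_iso_iff by fastforce
qed

text \<open>The action on morphisms of the functor between orbit categories. On an endomorphism of
  degree n it is literally the formula in \<open>corresponds\<close>.\<close>

definition orbit_mor :: "'o \<Rightarrow> 'o \<Rightarrow> int \<Rightarrow> 'm \<Rightarrow> 'm2" where
  "orbit_mor x y n f =
    (let v = fobj (tgt.P n) (fobj F y); w = fobj F (fobj (src.P n) y) in
      cat_comp A' (fobj F x) w v (inv_mor A' v w (U n y)) (fmor F x (fobj (src.P n) y) f))"

lemma orbit_mor:
  assumes x: "x \<in> Obj A" and y: "y \<in> Obj A" and f: "f \<in> carrier (Hom A x (fobj (src.P n) y))"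
  shows "orbit_mor x y n f \<in> carrier (Hom A' (fobj F x) (fobj (tgt.P n) (fobj F y)))"
    and "cat_comp A' (fobj F x) (fobj (tgt.P n) (fobj F y)) (fobj F (fobj (src.P n) y)) (U n y) (orbit_mor x y n f) =
      fmor F x (fobj (src.P n) y) f"
proof -
  let ?v = "fobj (tgt.P n) (fobj F y)" and ?w = "fobj F (fobj (src.P n) y)"
  let ?i = "inv_mor A' ?v ?w (U n y)" and ?f = "fmor F x (fobj (src.P n) y) f"
  have o: "?v \<in> Obj A'" "?w \<in> Obj A'" "fobj F x \<in> Obj A'" using x y by simp_all
  note i = tgt.inv_mor[OF o(1,2) U_iso[OF y]]
  have Ff: "?f \<in> carrier (Hom A' (fobj F x) ?w)" using x y f by (intro F.fmor_closed) auto
  show "orbit_mor x y n f \<in> carrier (Hom A' (fobj F x) ?v)"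
    unfolding orbit_mor_def Let_def by (intro tgt.comp_closed o i Ff)
  have "cat_comp A' (fobj F x) ?v ?w (U n y) (orbit_mor x y n f) =
      cat_comp A' (fobj F x) ?w ?w (cat_comp A' ?w ?v ?w (U n y) ?i) ?f"
    unfolding orbit_mor_def Let_def by (intro tgt.comp_assoc[symmetric] o i Ff U_closed[OF y])
  then show "cat_comp A' (fobj F x) ?v ?w (U n y) (orbit_mor x y n f) = ?f"
    using o Ff i(3) by (simp add: tgt.comp_ident_left)
qed

text \<open>Avoids handling the inverse of \<open>U n y\<close>: the functor laws become equations
  between composites with \<open>U n y\<close> itself.\<close>

lemma orbit_mor_eqI:
  assumes x: "x \<in> Obj A" and y: "y \<in> Obj A" and f: "f \<in> carrier (Hom A x (fobj (src.P n) y))"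
    and g: "g \<in> carrier (Hom A' (fobj F x) (fobj (tgt.P n) (fobj F y)))"
    and eq: "cat_comp A' (fobj F x) (fobj (tgt.P n) (fobj F y)) (fobj F (fobj (src.P n) y)) (U n y) g = fmor F x (fobj (src.P n) y) f"
  shows "orbit_mor x y n f = g"
proof -
  have o: "fobj F x \<in> Obj A'" "fobj (tgt.P n) (fobj F y) \<in> Obj A'" "fobj F (fobj (src.P n) y) \<in> Obj A'"
    using x y by simp_all
  show ?thesis
    using orbit_mor(2)[OF x y f] eq by (intro tgt.iso_cancel_left[OF o U_iso[OF y] orbit_mor(1)[OF x y f] g]) simp
qed

lemma orbit_graded_functor: "graded_functor K src.B tgt.B (fobj F) orbit_mor"
proof (intro graded_functor.intro graded_functor_axioms.intro src.orbit_graded_category tgt.orbit_graded_category)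
  fix x y :: 'o and n f g assume "x \<in> GObj src.B" "y \<in> GObj src.B" "f \<in> carrier (GHom src.B x y n)" "g \<in> carrier (GHom src.B x y n)"
  then have *: "x \<in> Obj A" "y \<in> Obj A" "f \<in> carrier (Hom A x (fobj (src.P n) y))" "g \<in> carrier (Hom A x (fobj (src.P n) y))"
    by simp_all
  note ab = module.axioms(2)[OF src.Hom_module, THEN abelian_group.axioms(1), THEN abelian_monoid.a_closed]
    module.axioms(2)[OF tgt.Hom_module, THEN abelian_group.axioms(1), THEN abelian_monoid.a_closed]
  have "orbit_mor x y n (f \<oplus>\<^bsub>Hom A x (fobj (src.P n) y)\<^esub> g) =
      orbit_mor x y n f \<oplus>\<^bsub>Hom A' (fobj F x) (fobj (tgt.P n) (fobj F y))\<^esub> orbit_mor x y n g"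
    using * by (intro orbit_mor_eqI) (simp_all add: ab orbit_mor F.fmor_add tgt.comp_add_right U_closed)
  then show "orbit_mor x y n (f \<oplus>\<^bsub>GHom src.B x y n\<^esub> g) =
      orbit_mor x y n f \<oplus>\<^bsub>GHom tgt.B (fobj F x) (fobj F y) n\<^esub> orbit_mor x y n g" by simp
next
  fix x y :: 'o and c n f assume "x \<in> GObj src.B" "y \<in> GObj src.B" "c \<in> carrier K" "f \<in> carrier (GHom src.B x y n)"
  then have *: "x \<in> Obj A" "y \<in> Obj A" "c \<in> carrier K" "f \<in> carrier (Hom A x (fobj (src.P n) y))"
    by simp_all
  have "orbit_mor x y n (c \<odot>\<^bsub>Hom A x (fobj (src.P n) y)\<^esub> f) =
      c \<odot>\<^bsub>Hom A' (fobj F x) (fobj (tgt.P n) (fobj F y))\<^esub> orbit_mor x y n f"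
    using * by (intro orbit_mor_eqI)
      (simp_all add: module.smult_closed[OF src.Hom_module] module.smult_closed[OF tgt.Hom_module] orbit_mor F.fmor_smult
        tgt.comp_smult_right U_closed)
  then show "orbit_mor x y n (c \<odot>\<^bsub>GHom src.B x y n\<^esub> f) =
      c \<odot>\<^bsub>GHom tgt.B (fobj F x) (fobj F y) n\<^esub> orbit_mor x y n f" by simp
next
  fix x y z :: 'o and g m f n assume "x \<in> GObj src.B" "y \<in> GObj src.B" "z \<in> GObj src.B"
    "g \<in> carrier (GHom src.B y z m)" "f \<in> carrier (GHom src.B x y n)"
  then have x: "x \<in> Obj A" and y: "y \<in> Obj A" and z: "z \<in> Obj A"
    and g: "g \<in> carrier (Hom A y (fobj (src.P m) z))" and f: "f \<in> carrier (Hom A x (fobj (src.P n) y))"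
    by simp_all
  let ?X = "fobj F x" and ?y = "fobj (src.P n) y" and ?Y = "fobj (tgt.P n) (fobj F y)"
  let ?mz = "fobj (src.P m) z" and ?z = "fobj (src.P (m + n)) z" and ?Z = "fobj (tgt.P (m + n)) (fobj F z)"
  let ?W = "fobj (tgt.P n) (fobj F ?mz)"
  have o: "?X \<in> Obj A'" "?y \<in> Obj A" "?Y \<in> Obj A'" "?mz \<in> Obj A" "?z \<in> Obj A" "?Z \<in> Obj A'" "?W \<in> Obj A'"
    "fobj F ?z \<in> Obj A'" "fobj F ?y \<in> Obj A'" "fobj F ?mz \<in> Obj A'" "fobj F y \<in> Obj A'"
    "fobj (tgt.P m) (fobj F z) \<in> Obj A'" using x y z by simp_all
  have PZ: "fobj (tgt.P n) (fobj (tgt.P m) (fobj F z)) = ?Z" and Pz: "fobj (src.P n) ?mz = ?z"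
    using z by (simp_all add: src.P_P_obj tgt.P_P_obj add.commute)
  let ?f = "orbit_mor x y n f" and ?g = "orbit_mor y z m g"
  let ?Pg = "fmor (tgt.P n) (fobj F y) (fobj (tgt.P m) (fobj F z)) ?g"
  let ?PU = "fmor (tgt.P n) (fobj (tgt.P m) (fobj F z)) (fobj F ?mz) (U m z)"
  let ?png = "fmor (src.P n) y ?mz g"
  note fc = orbit_mor[OF x y f] and gc = orbit_mor[OF y z g]
  have Pg: "?Pg \<in> carrier (Hom A' ?Y ?Z)" using tgt.P_mor[OF o(11,12) gc(1), of n] by (simp add: PZ)
  have PU: "?PU \<in> carrier (Hom A' ?Z ?W)" using tgt.P_mor[OF o(12,10) U_closed[OF z], of n] by (simp add: PZ)
  have Un: "U n ?mz \<in> carrier (Hom A' ?W (fobj F ?z))" using U_closed[OF o(4), of n] by (simp add: Pz)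
  have png: "?png \<in> carrier (Hom A ?y ?z)" using src.P_mor[OF y o(4) g, of n] by (simp add: Pz)
  have Fpng: "fmor F ?y ?z ?png \<in> carrier (Hom A' (fobj F ?y) (fobj F ?z))" using o png by (intro F.fmor_closed)
  have Fg: "fmor F y ?mz g \<in> carrier (Hom A' (fobj F y) (fobj F ?mz))" using y o g by (intro F.fmor_closed)
  have PFg: "fmor (tgt.P n) (fobj F y) (fobj F ?mz) (fmor F y ?mz g) \<in> carrier (Hom A' ?Y ?W)"
    using tgt.P_mor[OF o(11,10) Fg] .
  have Pgf: "cat_comp A' ?X ?Y ?Z ?Pg ?f \<in> carrier (Hom A' ?X ?Z)" using o Pg fc by (intro tgt.comp_closed)
  \<comment> \<open>The cocycle identity is taken with n before m: the composite applies Sigma^n to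
    g, so the isomorphism for degree m is the one that gets shifted.\<close>
  have Umn: "U (m + n) z = cat_comp A' ?Z ?W (fobj F ?z) (U n ?mz) ?PU"
    using U_add[OF z, of n m] by (simp add: add.commute)
  have "cat_comp A' ?X ?Z (fobj F ?z) (U (m + n) z) (cat_comp A' ?X ?Y ?Z ?Pg ?f) =
      cat_comp A' ?X ?W (fobj F ?z) (U n ?mz) (cat_comp A' ?X ?Z ?W ?PU (cat_comp A' ?X ?Y ?Z ?Pg ?f))"
    unfolding Umn by (intro tgt.comp_assoc o Un PU Pgf)
  also have "cat_comp A' ?X ?Z ?W ?PU (cat_comp A' ?X ?Y ?Z ?Pg ?f) = cat_comp A' ?X ?Y ?W (cat_comp A' ?Y ?Z ?W ?PU ?Pg) ?f"
    by (intro tgt.comp_assoc[symmetric] o PU Pg fc)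
  also have "cat_comp A' ?Y ?Z ?W ?PU ?Pg = fmor (tgt.P n) (fobj F y) (fobj F ?mz) (fmor F y ?mz g)"
    using linear_functor.fmor_comp[OF tgt.P_linear o(11,12,10) U_closed[OF z] gc(1), of n] by (simp add: PZ gc(2))
  also have "cat_comp A' ?X ?W (fobj F ?z) (U n ?mz) (cat_comp A' ?X ?Y ?W (fmor (tgt.P n) (fobj F y) (fobj F ?mz) (fmor F y ?mz g)) ?f)
    = cat_comp A' ?X ?Y (fobj F ?z) (cat_comp A' ?Y ?W (fobj F ?z) (U n ?mz) (fmor (tgt.P n) (fobj F y) (fobj F ?mz) (fmor F y ?mz g))) ?f"
    by (intro tgt.comp_assoc[symmetric] o Un PFg fc)
  \<comment> \<open>Naturality of \<open>U n\<close> at g moves it to the right, where it meets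
    \<open>?f\<close>.\<close>
  also have "cat_comp A' ?Y ?W (fobj F ?z) (U n ?mz) (fmor (tgt.P n) (fobj F y) (fobj F ?mz) (fmor F y ?mz g)) =
      cat_comp A' ?Y (fobj F ?y) (fobj F ?z) (fmor F ?y ?z ?png) (U n y)"
    using U_natural[OF y o(4) g, of n] by (simp add: Pz)
  also have "cat_comp A' ?X ?Y (fobj F ?z) (cat_comp A' ?Y (fobj F ?y) (fobj F ?z) (fmor F ?y ?z ?png) (U n y)) ?f =
      cat_comp A' ?X (fobj F ?y) (fobj F ?z) (fmor F ?y ?z ?png) (cat_comp A' ?X ?Y (fobj F ?y) (U n y) ?f)"
    by (intro tgt.comp_assoc o Fpng U_closed[OF y] fc)
  also have "\<dots> = fmor F x ?z (cat_comp A x ?y ?z ?png f)"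
    unfolding fc(2) using x o png f by (intro F.fmor_comp[symmetric])
  finally have eq: "cat_comp A' ?X ?Z (fobj F ?z) (U (m + n) z) (cat_comp A' ?X ?Y ?Z ?Pg ?f) = fmor F x ?z (cat_comp A x ?y ?z ?png f)" .
  have "orbit_mor x z (m + n) (cat_comp A x ?y ?z ?png f) = cat_comp A' ?X ?Y ?Z ?Pg ?f"
    by (rule orbit_mor_eqI[OF x z _ Pgf eq]) (intro src.comp_closed x o png f)
  then show "orbit_mor x z (m + n) (gcomp src.B x y z m n g f) =
      gcomp tgt.B ?X (fobj F y) (fobj F z) m n ?g ?f" by simp
next
  fix x :: 'o assume "x \<in> GObj src.B"
  then have x: "x \<in> Obj A" by simp
  have "orbit_mor x x 0 (ident A x) = ident A' (fobj F x)"
    using x by (intro orbit_mor_eqI)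
      (simp_all add: src.ident_closed tgt.ident_closed U_zero tgt.comp_ident_left F.fmor_ident)
  then show "orbit_mor x x 0 (gident src.B x) = gident tgt.B (fobj F x)" by simp
qed (simp_all add: orbit_mor)

lemma orbit_graded_equivalence: "graded_equivalence K src.B tgt.B (fobj F) orbit_mor"
proof (intro graded_equivalence.intro graded_equivalence_axioms.intro orbit_graded_functor)
  fix x y :: 'o and n assume "x \<in> GObj src.B" "y \<in> GObj src.B"
  then have x: "x \<in> Obj A" and y: "y \<in> Obj A" by simp_all
  let ?y = "fobj (src.P n) y" and ?Y = "fobj (tgt.P n) (fobj F y)"
  have yo: "?y \<in> Obj A" "?Y \<in> Obj A'" "fobj F x \<in> Obj A'" "fobj F ?y \<in> Obj A'" using x y by simp_all
  have "inj_on (orbit_mor x y n) (carrier (Hom A x ?y))"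
  proof (rule inj_onI)
    fix f g assume f: "f \<in> carrier (Hom A x ?y)" and g: "g \<in> carrier (Hom A x ?y)" and "orbit_mor x y n f = orbit_mor x y n g"
    then have "fmor F x ?y f = fmor F x ?y g"
      using orbit_mor(2)[OF x y f] orbit_mor(2)[OF x y g] by simp
    then show "f = g" by (rule F_faithful[OF x yo(1) f g])
  qed
  moreover have "h \<in> orbit_mor x y n ` carrier (Hom A x ?y)" if h: "h \<in> carrier (Hom A' (fobj F x) ?Y)" for h
  proof -
    have "cat_comp A' (fobj F x) ?Y (fobj F ?y) (U n y) h \<in> carrier (Hom A' (fobj F x) (fobj F ?y))"
      by (intro tgt.comp_closed yo U_closed[OF y] h)
    from F_full[OF x yo(1) this] obtain f where f: "f \<in> carrier (Hom A x ?y)"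
      "fmor F x ?y f = cat_comp A' (fobj F x) ?Y (fobj F ?y) (U n y) h" by blast
    have "orbit_mor x y n f = h" by (rule orbit_mor_eqI[OF x y f(1) h f(2)[symmetric]])
    with f(1) show ?thesis by blast
  qed
  ultimately show "bij_betw (orbit_mor x y n) (carrier (GHom src.B x y n)) (carrier (GHom tgt.B (fobj F x) (fobj F y) n))"
    using orbit_mor(1)[OF x y] by (auto simp: bij_betw_def)
next
  fix z assume "z \<in> GObj tgt.B"
  then have z: "z \<in> Obj A'" by simp
  then obtain x w where x: "x \<in> Obj A" and w: "iso_mor A' (fobj F x) z w" using F_dense by blast
  have Fx: "fobj F x \<in> Obj A'" using x by simp
  note i = tgt.inv_mor[OF Fx z w]
  \<comment> \<open>The degree 0 part of the orbit category is A' itself, so an isomorphism of A'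
    serves.\<close>
  show "\<exists>x\<in>GObj src.B. \<exists>w\<in>carrier (GHom tgt.B (fobj F x) z 0). \<exists>w'\<in>carrier (GHom tgt.B z (fobj F x) 0).
      gcomp tgt.B (fobj F x) z (fobj F x) 0 0 w' w = gident tgt.B (fobj F x) \<and> gcomp tgt.B z (fobj F x) z 0 0 w w' = gident tgt.B z"
    using x w i by (intro bexI[of _ x] bexI[of _ w] bexI[of _ "inv_mor A' (fobj F x) z w"]) (auto simp: iso_mor_def)
qed

sublocale orbit: graded_equivalence K src.B tgt.B "fobj F" orbit_mor
  by (rule orbit_graded_equivalence)

section \<open>Identification with the induced map of graded centers\<close>

lemma corresponds_iff: "corresponds A A' S S' F \<upsilon> n \<eta> \<theta> \<longleftrightarrow> orbit.corresp n \<eta> \<theta>"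
  by (simp add: corresponds_def orbit.corresp_def orbit_mor_def Let_def)

lemma induced_map_eq: "induced_map A A' S S' F \<upsilon> = orbit.center_map"
  by (intro ext) (simp add: induced_map_def orbit.center_map_def corresponds_iff tgt.center_deg_eq)

end

theorem corollary3p5:
  fixes K :: "('k, 'r) ring_scheme" and p :: nat
    and A :: "('k, 'o, 'm) lin_cat" and S :: "('o, 'm, 'o, 'm) fnctr" and s :: int
  assumes "field K" and "has_characteristic K p" and "p > 0"
    and "linear_category K A" and "automorphism K A S"
  shows
    "(carrier (graded_center A S) = K_rs K (orbit_cat A S) p 0 s \<and>
      (\<forall>r. graded_ideal (K_rs K (orbit_cat A S) p r s) (graded_center A S) \<and>
           K_rs K (orbit_cat A S) p (Suc r) s \<subseteq> K_rs K (orbit_cat A S) p r s \<and>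
           R_s K (orbit_cat A S) p s \<subseteq> K_rs K (orbit_cat A S) p r s) \<and>
      graded_ideal (R_s K (orbit_cat A S) p s) (graded_center A S)) \<and>
     (carrier (graded_center A S) = K_r K (orbit_cat A S) p 0 \<and>
      (\<forall>r. graded_ideal (K_r K (orbit_cat A S) p r) (graded_center A S) \<and>
           K_r K (orbit_cat A S) p (Suc r) \<subseteq> K_r K (orbit_cat A S) p r \<and>
           R_all K (orbit_cat A S) p \<subseteq> K_r K (orbit_cat A S) p r) \<and>
      graded_ideal (R_all K (orbit_cat A S) p) (graded_center A S)) \<and>
     (\<forall>(A' :: ('k, 'o2, 'm2) lin_cat) S' F \<upsilon>.
        linear_category K A' \<and> automorphism K A' S' \<and> lin_equivalence K A A' F \<and>
        nat_iso A A' (functor_comp S' F) (functor_comp F S) \<upsilon> \<longrightarrow>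
        (\<forall>n. \<forall>\<eta>\<in>center_deg A S n.
           \<exists>!\<theta>. \<theta> \<in> center_deg A' S' n \<and> corresponds A A' S S' F \<upsilon> n \<eta> \<theta>) \<and>
        graded_algebra_iso K (graded_center A S) (graded_center A' S')
          (induced_map A A' S S' F \<upsilon>) \<and>
        (\<forall>r. induced_map A A' S S' F \<upsilon> ` K_r K (orbit_cat A S) p r = K_r K (orbit_cat A' S') p r))"
proof -
  interpret field K by fact
  interpret src: shift_category K A S
    using assms cring_axioms by (intro shift_category.intro shift_category_axioms.intro)
  interpret B: graded_category_char K "orbit_cat A S" p
    using assms src.orbit_graded_category by (intro graded_category_char.intro graded_category_char_axioms.intro)
  have "\<forall>(A' :: ('k, 'o2, 'm2) lin_cat) S' F \<upsilon>.
        linear_category K A' \<and> automorphism K A' S' \<and> lin_equivalence K A A' F \<and>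
        nat_iso A A' (functor_comp S' F) (functor_comp F S) \<upsilon> \<longrightarrow>
        (\<forall>n. \<forall>\<eta>\<in>center_deg A S n.
           \<exists>!\<theta>. \<theta> \<in> center_deg A' S' n \<and> corresponds A A' S S' F \<upsilon> n \<eta> \<theta>) \<and>
        graded_algebra_iso K (graded_center A S) (graded_center A' S')
          (induced_map A A' S S' F \<upsilon>) \<and>
        (\<forall>r. induced_map A A' S S' F \<upsilon> ` K_r K (orbit_cat A S) p r = K_r K (orbit_cat A' S') p r)"
  proof (intro allI impI)
    fix A' :: "('k, 'o2, 'm2) lin_cat" and S' F \<upsilon>
    assume *: "linear_category K A' \<and> automorphism K A' S' \<and> lin_equivalence K A A' F \<and>
        nat_iso A A' (functor_comp S' F) (functor_comp F S) \<upsilon>"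
    interpret tgt: shift_category K A' S'
      using * cring_axioms by (intro shift_category.intro shift_category_axioms.intro) auto
    interpret E: shift_equivalence K A S A' S' F \<upsilon>
      using * by (intro shift_equivalence.intro shift_equivalence_axioms.intro src.shift_category_axioms tgt.shift_category_axioms) auto
    interpret B': graded_category_char K "orbit_cat A' S'" p
      using assms tgt.orbit_graded_category by (intro graded_category_char.intro graded_category_char_axioms.intro)
    interpret C: graded_equivalence_char K "orbit_cat A S" "orbit_cat A' S'" "fobj F" E.orbit_mor p ..
    show "(\<forall>n. \<forall>\<eta>\<in>center_deg A S n.
           \<exists>!\<theta>. \<theta> \<in> center_deg A' S' n \<and> corresponds A A' S S' F \<upsilon> n \<eta> \<theta>) \<and>
        graded_algebra_iso K (graded_center A S) (graded_center A' S')
          (induced_map A A' S S' F \<upsilon>) \<and>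
        (\<forall>r. induced_map A A' S S' F \<upsilon> ` K_r K (orbit_cat A S) p r = K_r K (orbit_cat A' S') p r)"
      \<comment> \<open>All notions are rewritten into those of the orbit categories, where each
        conjunct is a fact about graded equivalences.\<close>
      unfolding E.induced_map_eq E.corresponds_iff src.center_deg_eq tgt.center_deg_eq src.graded_center_eq tgt.graded_center_eq
      using E.orbit.corresp_ex1 E.orbit.center_map_graded_iso C.center_map_K_r by blast
  qed
  moreover have "R_s K (orbit_cat A S) p s \<subseteq> K_rs K (orbit_cat A S) p r s"
    "K_r K (orbit_cat A S) p (Suc r) \<subseteq> K_r K (orbit_cat A S) p r"
    "R_all K (orbit_cat A S) p \<subseteq> K_r K (orbit_cat A S) p r" for r
    using B.K_rs_Suc by (auto simp: R_s_def K_r_def R_all_def)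
  moreover have "K_r K (orbit_cat A S) p 0 = gcenter (orbit_cat A S)"
    by (simp add: K_r_def B.K_rs_zero)
  ultimately show ?thesis
    unfolding src.graded_center_eq
    by (simp add: B.K_rs_zero B.K_rs_Suc B.K_rs_graded_ideal B.K_r_graded_ideal B.R_s_graded_ideal B.R_all_graded_ideal)
qed

end
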